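(* Let $\Omega\subset\mathbb{R}^d$ be a bounded $C^2$ domain equipped with heterogeneous localization functions $\eta_\delta$, $0<\delta<\delta_0$, and let $\rho$ be an admissible, normalized kernel (as defined in the context). Then there is a constant $C=C(d,\rho,\Omega)$ such that for each $\delta\in(0,\delta_0)$ there exists a weakly closed subspace $\mathfrak{H}$ of the Hilbert space $\mathfrak{W}^{\delta,2}(\Omega)$ (with the inherited norm) with $$H^1_0(\Omega)\subset\mathfrak{H}\subset L^2(\Omega),$$ for which the weak formulation of the nonlocal problem $\mathcal{L}_\delta u=f$ in $\Omega$, $u=0$ on $\partial\Omega$, is well-posed; that is, for every $f\in\mathfrak{H}^*$ there exists a unique $u\in\mathfrak{H}$ such that $$B_{\rho,\delta}(u,v)=\langle f,v\rangle\qquad\text{for all }v\in\mathfrak{H},$$ and it satisfies the energy estimate $\|u\|_{\mathfrak{H}}\le C\|f\|_{\mathfrak{H}^*}$.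
   Context: Domain and localization functions. $\Omega\subset\mathbb{R}^d$ is a bounded $C^2$ domain. There are constants $\kappa_0\in(0,1)$ and $\kappa_1,\kappa_2,\bar\kappa_0>0$ depending at most on $d$ and $\Omega$ and, with $\delta_0:=\min\{1,\frac{1}{9\kappa_1^2},\frac{1}{2\bar\kappa_0^2}\}$, for every $0<\delta<\delta_0$ a function $\eta_\delta:\overline\Omega\to[0,\infty)$, positive in $\Omega$, such that: (i) $\eta_\delta(x)=\operatorname{dist}(x,\partial\Omega)^2$ for $x\in\Omega$ with $\operatorname{dist}(x,\partial\Omega)^2<\kappa_0\delta$; (ii) $\eta_\delta(x)=\delta$ for $x\in\Omega$ with $\kappa_0\operatorname{dist}(x,\partial\Omega)^2>\delta$; (iii) $\eta_\delta\in C^2(\overline\Omega)$ with $|\nabla\eta_\delta|\le\kappa_1\sqrt\delta$ and $|\nabla^2\eta_\delta|\le\kappa_2$ in $\Omega$; (iv) $\eta_\delta(x)\le\bar\kappa_0\min\{\delta,\operatorname{dist}(x,\partial\Omega)^2\}$ in $\Omega$. These data are fixed with $\Omega$; a constant "depending on $\Omega$" may depend on $\kappa_0,\kappa_1,\kappa_2,\bar\kappa_0$ but not on $\delta$. Kernel. $\rho:[0,\infty)\to[0,\infty)$ is admissible if there are constants $0<\rho_0<\infty$ and $0<r_0<R_0<1$ such that $\rho\in C^1([0,\infty))$, $\rho\ge0$, $\lim_{r\to0^+}\rho'(r)/r$ exists, $\operatorname{supp}\rho\subset[0,R_0)$, and $\rho(r)\ge\rho_0$ for all $r\in[0,r_0]$.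 It is normalized if $\int_{B(0,1)}|z|^2\rho(|z|)\,dz=d$. For $\alpha\in\mathbb{R}$ set $\rho_{\delta,\alpha}(x,y):=\frac12\Big[\frac{1}{\eta_\delta(x)^{d+\alpha}}\rho\big(\tfrac{|y-x|}{\eta_\delta(x)}\big)+\frac{1}{\eta_\delta(y)^{d+\alpha}}\rho\big(\tfrac{|y-x|}{\eta_\delta(y)}\big)\Big]$, $\mathcal{L}_\delta u(x):=2\int_\Omega\rho_{\delta,2}(x,y)(u(x)-u(y))\,dy$, and $B_{\rho,\delta}(u,v):=\int_\Omega\int_\Omega\rho_{\delta,2}(x,y)(u(x)-u(y))(v(x)-v(y))\,dy\,dx$. Function space. Fix a constant $R\in(0,1)$ (constants may depend on this fixed choice). $[u]_{\mathfrak{W}^{\delta,2}(\Omega)}^2:=\int_\Omega\int_{\Omega\cap\{|y-x|\le R\eta_\delta(x)\}}\frac{|u(x)-u(y)|^2}{\eta_\delta(x)^{d+2}}\,dy\,dx$, $\|u\|_{\mathfrak{W}^{\delta,2}(\Omega)}^2:=\|u\|_{L^2(\Omega)}^2+[u]_{\mathfrak{W}^{\delta,2}(\Omega)}^2$, and $\mathfrak{W}^{\delta,2}(\Omega)$ is the closure of $C^\infty(\overline\Omega)$ in this norm. $\langle\cdot,\cdot\rangle$ denotes the duality pairing. *)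

theory Defs
  imports "HOL-Analysis.Analysis"
begin

section \<open>Classical differentiability classes\<close>

text \<open>Iterated partial derivatives along a list of coordinate directions (elements of
  \<^const>\<open>Basis\<close>); the last element of the list is differentiated first.\<close>

fun partials :: "'a list \<Rightarrow> ('a::euclidean_space \<Rightarrow> real) \<Rightarrow> 'a \<Rightarrow> real" where
  "partials [] f = f"
| "partials (b # bs) f = (\<lambda>x. frechet_derivative (partials bs f) (at x) b)"

definition Ck_on :: "nat \<Rightarrow> 'a set \<Rightarrow> ('a::euclidean_space \<Rightarrow> real) \<Rightarrow> bool" where
  "Ck_on k S f \<longleftrightarrow>
    (\<forall>bs. set bs \<subseteq> Basis \<and> length bs \<le> k \<longrightarrow> continuous_on S (partials bs f)) \<and>
    (\<forall>bs. set bs \<subseteq> Basis \<and> length bs < k \<longrightarrow> (\<forall>x\<in>S. partials bs f differentiable at x))"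

text \<open>Here \<open>\<Omega>\<close> is open: all derivatives up to order \<open>k\<close> exist in \<open>\<Omega>\<close> and extend
  continuously to the closure.\<close>

definition Ck_closure :: "nat \<Rightarrow> 'a set \<Rightarrow> ('a::euclidean_space \<Rightarrow> real) \<Rightarrow> bool" where
  "Ck_closure k \<Omega> f \<longleftrightarrow>
    continuous_on (closure \<Omega>) f \<and> Ck_on k \<Omega> f \<and>
    (\<forall>bs. set bs \<subseteq> Basis \<and> length bs \<le> k \<longrightarrow>
      (\<exists>g. continuous_on (closure \<Omega>) g \<and> (\<forall>x\<in>\<Omega>. g x = partials bs f x)))"

definition smooth_closure :: "'a set \<Rightarrow> ('a::euclidean_space \<Rightarrow> real) set" where
  "smooth_closure \<Omega> = {f. \<forall>k. Ck_closure k \<Omega> f}"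

definition test_functions :: "'a set \<Rightarrow> ('a::euclidean_space \<Rightarrow> real) set" where
  "test_functions \<Omega> = {\<phi>. (\<forall>k. Ck_on k UNIV \<phi>) \<and>
    compact (closure {x. \<phi> x \<noteq> 0}) \<and> closure {x. \<phi> x \<noteq> 0} \<subseteq> \<Omega>}"

definition grad :: "('a::euclidean_space \<Rightarrow> real) \<Rightarrow> 'a \<Rightarrow> 'a" where
  "grad f x = (\<Sum>b\<in>Basis. partials [b] f x *\<^sub>R b)"

definition hessian_norm :: "('a::euclidean_space \<Rightarrow> real) \<Rightarrow> 'a \<Rightarrow> real" where
  "hessian_norm f x = sqrt (\<Sum>i\<in>Basis. \<Sum>j\<in>Basis. (partials [i, j] f x)\<^sup>2)"

text \<open>Near each boundary point the domain is, in suitable orthonormal coordinates, the part of a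
  ball lying above the graph of a \<open>C\<^sup>2\<close> function. The last coordinate direction is the
  unit vector \<open>e\<close>; only the restriction of \<open>\<gamma>\<close> to the hyperplane orthogonal to \<open>e\<close> matters.\<close>

definition bounded_C2_domain :: "'a::euclidean_space set \<Rightarrow> bool" where
  "bounded_C2_domain \<Omega> \<longleftrightarrow>
    open \<Omega> \<and> connected \<Omega> \<and> \<Omega> \<noteq> {} \<and> bounded \<Omega> \<and>
    (\<forall>p\<in>frontier \<Omega>. \<exists>r>0. \<exists>e \<gamma>. norm e = 1 \<and> Ck_on 2 UNIV \<gamma> \<and>
      \<Omega> \<inter> ball p r = {x \<in> ball p r. \<gamma> (x - (x \<bullet> e) *\<^sub>R e) < x \<bullet> e})"


section \<open>Localization functions and kernels\<close>

definition delta0 :: "real \<Rightarrow> real \<Rightarrow> real" where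
  "delta0 \<kappa>1 \<kappa>b = min 1 (min (1 / (9 * \<kappa>1\<^sup>2)) (1 / (2 * \<kappa>b\<^sup>2)))"

text \<open>\<open>\<kappa>b\<close> is the constant usually written as \<open>\<kappa>\<^sub>0\<close> with a bar.\<close>

definition localization_family ::
    "'a::euclidean_space set \<Rightarrow> real \<Rightarrow> real \<Rightarrow> real \<Rightarrow> real \<Rightarrow> (real \<Rightarrow> 'a \<Rightarrow> real) \<Rightarrow> bool" where
  "localization_family \<Omega> \<kappa>0 \<kappa>1 \<kappa>2 \<kappa>b \<eta> \<longleftrightarrow>
    (\<forall>\<delta>. 0 < \<delta> \<and> \<delta> < delta0 \<kappa>1 \<kappa>b \<longrightarrow>
      (\<forall>x\<in>closure \<Omega>. 0 \<le> \<eta> \<delta> x) \<and>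
      (\<forall>x\<in>\<Omega>. 0 < \<eta> \<delta> x) \<and>
      (\<forall>x\<in>\<Omega>. (infdist x (frontier \<Omega>))\<^sup>2 < \<kappa>0 * \<delta> \<longrightarrow> \<eta> \<delta> x = (infdist x (frontier \<Omega>))\<^sup>2) \<and>
      (\<forall>x\<in>\<Omega>. \<delta> < \<kappa>0 * (infdist x (frontier \<Omega>))\<^sup>2 \<longrightarrow> \<eta> \<delta> x = \<delta>) \<and>
      Ck_closure 2 \<Omega> (\<eta> \<delta>) \<and>
      (\<forall>x\<in>\<Omega>. norm (grad (\<eta> \<delta>) x) \<le> \<kappa>1 * sqrt \<delta>) \<and>
      (\<forall>x\<in>\<Omega>. hessian_norm (\<eta> \<delta>) x \<le> \<kappa>2) \<and>
      (\<forall>x\<in>\<Omega>. \<eta> \<delta> x \<le> \<kappa>b * min \<delta> ((infdist x (frontier \<Omega>))\<^sup>2)))"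

text \<open>Kernels live on \<open>[0,\<infinity>)\<close>; their values at negative arguments are irrelevant.\<close>

definition admissible_kernel :: "(real \<Rightarrow> real) \<Rightarrow> bool" where
  "admissible_kernel \<rho> \<longleftrightarrow>
    (\<exists>\<rho>0 r0 R0. 0 < \<rho>0 \<and> 0 < r0 \<and> r0 < R0 \<and> R0 < 1 \<and>
      (\<exists>\<rho>'. continuous_on {0..} \<rho>' \<and>
        (\<forall>r\<ge>0. (\<rho> has_real_derivative \<rho>' r) (at r within {0..})) \<and>
        (\<exists>l. ((\<lambda>r. \<rho>' r / r) \<longlongrightarrow> l) (at_right 0))) \<and>
      (\<forall>r\<ge>0. 0 \<le> \<rho> r) \<and>
      closure {r. 0 \<le> r \<and> \<rho> r \<noteq> 0} \<subseteq> {0..<R0} \<and>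
      (\<forall>r\<in>{0..r0}. \<rho>0 \<le> \<rho> r))"

text \<open>The first argument only selects the space in which the ball is taken.\<close>

definition normalized_kernel :: "'a::euclidean_space itself \<Rightarrow> (real \<Rightarrow> real) \<Rightarrow> bool" where
  "normalized_kernel _ \<rho> \<longleftrightarrow>
    (LINT z:ball (0::'a) 1|lborel. (norm z)\<^sup>2 * \<rho> (norm z)) = real DIM('a)"

text \<open>In the remaining definitions \<open>e\<close> stands for a single function \<open>\<eta>\<^sub>\<delta>\<close>.\<close>

definition scaled_kernel ::
    "(real \<Rightarrow> real) \<Rightarrow> ('a::euclidean_space \<Rightarrow> real) \<Rightarrow> real \<Rightarrow> 'a \<Rightarrow> 'a \<Rightarrow> real" where
  "scaled_kernel \<rho> e \<alpha> x y =
    1/2 * (1 / e x powr (real DIM('a) + \<alpha>) * \<rho> (norm (y - x) / e x)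
         + 1 / e y powr (real DIM('a) + \<alpha>) * \<rho> (norm (y - x) / e y))"


section \<open>Function spaces\<close>

text \<open>Elements of the function spaces are represented by Borel functions, of which only the
  values on \<open>\<Omega>\<close> matter; functions that agree almost everywhere in \<open>\<Omega>\<close> represent the same
  element. All spaces below are invariant under such changes.\<close>

abbreviation leb_on :: "'a::euclidean_space set \<Rightarrow> 'a measure" where
  "leb_on \<Omega> \<equiv> restrict_space lborel \<Omega>"

definition nonlocal_form ::
    "(real \<Rightarrow> real) \<Rightarrow> ('a::euclidean_space \<Rightarrow> real) \<Rightarrow> 'a set \<Rightarrow> ('a \<Rightarrow> real) \<Rightarrow> ('a \<Rightarrow> real) \<Rightarrow> real" where
  "nonlocal_form \<rho> e \<Omega> u v =
    (LINT x|leb_on \<Omega>. LINT y|leb_on \<Omega>. scaled_kernel \<rho> e 2 x y * (u x - u y) * (v x - v y))"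

definition L2 :: "'a::euclidean_space set \<Rightarrow> ('a \<Rightarrow> 'b::euclidean_space) set" where
  "L2 \<Omega> = {u \<in> borel_measurable (leb_on \<Omega>). integrable (leb_on \<Omega>) (\<lambda>x. (norm (u x))\<^sup>2)}"

definition weak_gradient ::
    "'a::euclidean_space set \<Rightarrow> ('a \<Rightarrow> real) \<Rightarrow> ('a \<Rightarrow> 'a) \<Rightarrow> bool" where
  "weak_gradient \<Omega> u g \<longleftrightarrow>
    (\<forall>\<phi>\<in>test_functions \<Omega>. \<forall>b\<in>Basis.
      (LINT x|leb_on \<Omega>. u x * partials [b] \<phi> x) = - (LINT x|leb_on \<Omega>. (g x \<bullet> b) * \<phi> x))"

text \<open>The closure of the test functions in \<open>H\<^sup>1(\<Omega>)\<close>; \<open>g\<close> is the weak gradient of \<open>u\<close>.\<close>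

definition H10 :: "'a::euclidean_space set \<Rightarrow> ('a \<Rightarrow> real) set" where
  "H10 \<Omega> = {u \<in> L2 \<Omega>. \<exists>g\<in>L2 \<Omega>. weak_gradient \<Omega> u g \<and>
    (\<forall>\<epsilon>>0. \<exists>\<phi>\<in>test_functions \<Omega>.
      (LINT x|leb_on \<Omega>. (u x - \<phi> x)\<^sup>2) + (LINT x|leb_on \<Omega>. (norm (g x - grad \<phi> x))\<^sup>2) < \<epsilon>\<^sup>2)}"

text \<open>The squared norm is defined with values in \<^typ>\<open>ennreal\<close>, so that no finiteness is
  built in.\<close>

definition W_seminorm_sq ::
    "real \<Rightarrow> ('a::euclidean_space \<Rightarrow> real) \<Rightarrow> 'a set \<Rightarrow> ('a \<Rightarrow> real) \<Rightarrow> ennreal" where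
  "W_seminorm_sq R e \<Omega> u =
    (\<integral>\<^sup>+x. (\<integral>\<^sup>+y. ennreal (\<bar>u x - u y\<bar>\<^sup>2 / e x ^ (DIM('a) + 2))
        * indicator {y. norm (y - x) \<le> R * e x} y \<partial>leb_on \<Omega>) \<partial>leb_on \<Omega>)"

definition W_norm_sq ::
    "real \<Rightarrow> ('a::euclidean_space \<Rightarrow> real) \<Rightarrow> 'a set \<Rightarrow> ('a \<Rightarrow> real) \<Rightarrow> ennreal" where
  "W_norm_sq R e \<Omega> u = (\<integral>\<^sup>+x. ennreal (\<bar>u x\<bar>\<^sup>2) \<partial>leb_on \<Omega>) + W_seminorm_sq R e \<Omega> u"

definition W_norm ::
    "real \<Rightarrow> ('a::euclidean_space \<Rightarrow> real) \<Rightarrow> 'a set \<Rightarrow> ('a \<Rightarrow> real) \<Rightarrow> real" where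
  "W_norm R e \<Omega> u = sqrt (enn2real (W_norm_sq R e \<Omega> u))"

definition W_space ::
    "real \<Rightarrow> ('a::euclidean_space \<Rightarrow> real) \<Rightarrow> 'a set \<Rightarrow> ('a \<Rightarrow> real) set" where
  "W_space R e \<Omega> = {u \<in> L2 \<Omega>. W_norm_sq R e \<Omega> u < \<infinity> \<and>
    (\<forall>\<epsilon>::real. 0 < \<epsilon> \<longrightarrow> (\<exists>\<phi>\<in>smooth_closure \<Omega>. W_norm_sq R e \<Omega> (\<lambda>x. u x - \<phi> x) < ennreal (\<epsilon>\<^sup>2)))}"


section \<open>Duality and weak topology of a (semi)normed space of functions\<close>

definition function_subspace :: "('b \<Rightarrow> real) set \<Rightarrow> bool" where
  "function_subspace H \<longleftrightarrow> (\<lambda>x. 0) \<in> H \<and>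
    (\<forall>u\<in>H. \<forall>v\<in>H. (\<lambda>x. u x + v x) \<in> H) \<and>
    (\<forall>c. \<forall>u\<in>H. (\<lambda>x. c * u x) \<in> H)"

definition dual_space ::
    "(('b \<Rightarrow> real) \<Rightarrow> real) \<Rightarrow> ('b \<Rightarrow> real) set \<Rightarrow> (('b \<Rightarrow> real) \<Rightarrow> real) set" where
  "dual_space N X = {f.
    (\<forall>u\<in>X. \<forall>v\<in>X. f (\<lambda>x. u x + v x) = f u + f v) \<and>
    (\<forall>c. \<forall>u\<in>X. f (\<lambda>x. c * u x) = c * f u) \<and>
    (\<exists>K. \<forall>u\<in>X. \<bar>f u\<bar> \<le> K * N u)}"

definition dual_norm ::
    "(('b \<Rightarrow> real) \<Rightarrow> real) \<Rightarrow> ('b \<Rightarrow> real) set \<Rightarrow> (('b \<Rightarrow> real) \<Rightarrow> real) \<Rightarrow> real" where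
  "dual_norm N X f = (SUP v\<in>{v\<in>X. N v \<le> 1}. \<bar>f v\<bar>)"

definition weak_topology ::
    "(('b \<Rightarrow> real) \<Rightarrow> real) \<Rightarrow> ('b \<Rightarrow> real) set \<Rightarrow> ('b \<Rightarrow> real) topology" where
  "weak_topology N X =
    topology_generated_by {{u\<in>X. f u \<in> U} | f U. f \<in> dual_space N X \<and> open U}"

end

theory Submission imports Defs begin

text \<open>The space is the closure of the test functions in the norm of the nonlocal space, and the
  solution is the Riesz representative for the form itself, which is a scalar product equivalent
  to the given one. What has to be proved is that the form controls the norm uniformly in \<open>\<delta>\<close>.

  For \<open>|z| \<le> 1\<close> the jump \<open>x \<mapsto> x + \<eta>(x) z\<close> maps \<open>\<Omega>\<close> injectively into itself with Jacobian
  \<open>1 + \<nabla>\<eta> \<bullet> z\<close>; on every line parallel to \<open>z\<close> this is a one-dimensional substitution. Hence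
  \<open>\<integral> F(x + \<eta> z) (1 + \<nabla>\<eta> \<bullet> z) \<le> \<integral> F\<close> for \<open>F \<ge> 0\<close>. With \<open>F = l \<phi>\<^sup>2 / \<eta>\<close>, where \<open>l\<close> is linear
  and increasing in the direction \<open>z\<close>, this yields \<open>|z|\<^sup>2 \<integral> \<phi>\<^sup>2 \<le> C \<integral> |\<phi>(x + \<eta> z) - \<phi>(x)|\<^sup>2 / \<eta>\<^sup>2\<close>
  for small \<open>z\<close>, with \<open>C\<close> depending only on the size of \<open>\<Omega>\<close> and on the bound for the second
  derivatives of \<open>\<eta>\<close>. Integration over \<open>z\<close> gives the Poincare inequality. Horizons of different
  relative size are compared by passing through midpoints, and the same substitution bounds the
  nonlocal seminorm by the norm of the gradient.\<close>

section \<open>Riesz representation in a space of functions\<close>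

text \<open>The horizon shrinks like the squared distance to the boundary, and the constant has to
  survive \<delta> tending to 0, so an explicit inequality takes the place of a compactness
  argument. The weight \<open>1/e\<close> in \<open>F\<close> makes it uniform: one jump raises
  \<open>l\<close> by \<open>e |z|^2\<close>, so after division by \<open>e\<close> the gain is
  \<open>|z|^2 \<phi>^2\<close>, whatever the size of the horizon. The ratio of the horizons at the
  two ends of a jump is at most \<open>1 + \<nabla>\<eta> \<bullet> z\<close> plus a term of order
  \<open>\<kappa>2 e |z|^2\<close>; the Jacobian cancels the first-order part, and the rest,
  multiplied by \<open>l \<le> 2 M |z|\<close>, is cubic in \<open>|z|\<close>. The quadratic gain
  absorbs it once \<open>6 \<kappa>2 M |z| \<le> 1\<close>. The Poincare inequality therefore comes
  with a small radius \<open>r\<close>, and the kernel is bounded below only for small arguments,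
  whereas the norm uses \<open>R\<close> and the form may reach up to radius 1: this gap is what the
  midpoint comparison closes. Since \<open>1/e\<close> blows up at the boundary, finiteness of the
  integral of \<open>F\<close> is secured by compact support, hence test functions first and their
  closure afterwards.\<close>

lemma function_subspace_zero: "function_subspace V \<Longrightarrow> (\<lambda>x. 0) \<in> V"
  and function_subspace_add: "function_subspace V \<Longrightarrow> u \<in> V \<Longrightarrow> v \<in> V \<Longrightarrow> (\<lambda>x. u x + v x) \<in> V"
  and function_subspace_scale: "function_subspace V \<Longrightarrow> u \<in> V \<Longrightarrow> (\<lambda>x. c * u x) \<in> V"
  by (auto simp: function_subspace_def)

lemma function_subspace_diff:
  assumes "function_subspace V" "u \<in> V" "v \<in> V"
  shows "(\<lambda>x. u x - v x) \<in> V"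
  using function_subspace_add[OF assms(1,2) function_subspace_scale[OF assms(1,3), of "-1"]] by simp

text \<open>A parabola through the origin that stays nonnegative has slope zero there. At
  \<open>t = -a/(b+1)\<close> its value is \<open>-a^2 (b+2)/(b+1)^2\<close>; the denominator
  \<open>b+1\<close> instead of \<open>b\<close> covers \<open>b = 0\<close> as well.\<close>

lemma quadratic_nonneg_imp_zero:
  fixes a b :: real
  assumes "\<And>t. 0 \<le> 2 * t * a + t\<^sup>2 * b" "0 \<le> b"
  shows "a = 0"
proof -
  have "0 \<le> 2 * (- a / (b + 1)) * a + (- a / (b + 1))\<^sup>2 * b" by (rule assms)
  also have "\<dots> = - (a\<^sup>2 * (b + 2)) / (b + 1)\<^sup>2"
    using assms(2) by (simp add: divide_simps power2_eq_square) (simp add: algebra_simps)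
  finally have "a\<^sup>2 * (b + 2) \<le> 0"
    using assms(2) by (simp add: zero_le_divide_iff divide_le_0_iff split: if_splits)
  then show ?thesis
    using assms(2) by (simp add: mult_le_0_iff)
qed

text \<open>Definiteness is left out because the elements are functions and not classes: differences
  that vanish almost everywhere have length zero. The axioms are restricted to \<open>V\<close>,
  since Bochner integrals are additive only for integrable arguments. Linearity in the second
  argument comes from \<open>sym\<close>.\<close>

locale semi_inner_product =
  fixes V :: "('b \<Rightarrow> real) set" and G :: "('b \<Rightarrow> real) \<Rightarrow> ('b \<Rightarrow> real) \<Rightarrow> real"
  assumes subspace: "function_subspace V"
    and sym: "u \<in> V \<Longrightarrow> v \<in> V \<Longrightarrow> G u v = G v u"
    and add: "u \<in> V \<Longrightarrow> v \<in> V \<Longrightarrow> w \<in> V \<Longrightarrow> G (\<lambda>x. u x + v x) w = G u w + G v w"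
    and scale: "u \<in> V \<Longrightarrow> w \<in> V \<Longrightarrow> G (\<lambda>x. c * u x) w = c * G u w"
    and nonneg: "u \<in> V \<Longrightarrow> 0 \<le> G u u"
begin

lemma diff: "u \<in> V \<Longrightarrow> v \<in> V \<Longrightarrow> w \<in> V \<Longrightarrow> G (\<lambda>x. u x - v x) w = G u w - G v w"
  using add[OF _ function_subspace_scale[OF subspace], of u v w "-1"] scale[of v w "-1"] by simp

lemma expand:
  assumes "u \<in> V" "v \<in> V"
  shows "G (\<lambda>x. u x + t * v x) (\<lambda>x. u x + t * v x) = G u u + 2 * t * G u v + t\<^sup>2 * G v v"
proof -
  have tv: "(\<lambda>x. t * v x) \<in> V" and s: "(\<lambda>x. u x + t * v x) \<in> V"
    using assms function_subspace_add[OF subspace] function_subspace_scale[OF subspace] by auto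
  have *: "G w (\<lambda>x. u x + t * v x) = G w u + t * G w v" if "w \<in> V" for w
    using sym[OF that s] add[OF assms(1) tv that] scale[OF assms(2) that] sym that assms by simp
  show ?thesis
    using add[OF assms(1) tv s] scale[OF assms(2) s] *[OF assms(1)] *[OF assms(2)] sym[OF assms]
    by (simp add: algebra_simps power2_eq_square)
qed

lemma parallelogram:
  assumes "u \<in> V" "v \<in> V"
  shows "G (\<lambda>x. u x - v x) (\<lambda>x. u x - v x)
    = 2 * G u u + 2 * G v v - 4 * G (\<lambda>x. 1/2 * (u x + v x)) (\<lambda>x. 1/2 * (u x + v x))"
proof -
  have p: "(\<lambda>x. u x + v x) \<in> V" "(\<lambda>x. 1/2 * (u x + v x)) \<in> V"
    using assms function_subspace_add[OF subspace] function_subspace_scale[OF subspace] by blast+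
  have "G (\<lambda>x. 1/2 * (u x + v x)) (\<lambda>x. 1/2 * (u x + v x)) = 1/4 * G (\<lambda>x. u x + v x) (\<lambda>x. u x + v x)"
    using scale[OF p(1) p(2), of "1/2"] scale[OF p(1) p(1), of "1/2"] sym[OF p] by simp
  then show ?thesis
    using expand[OF assms, of 1] expand[OF assms, of "-1"] by simp
qed

lemma cauchy_schwarz:
  assumes "u \<in> V" "v \<in> V"
  shows "\<bar>G u v\<bar> \<le> sqrt (G u u) * sqrt (G v v)"
proof -
  have q: "0 \<le> G u u + 2 * t * G u v + t\<^sup>2 * G v v" for t
    using expand[OF assms] nonneg function_subspace_add[OF subspace assms(1)
      function_subspace_scale[OF subspace assms(2)]] by metis
  have "(G u v)\<^sup>2 \<le> G u u * G v v"
  proof (cases "G v v = 0")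
    case True
    have "G u v = 0"
    proof (rule ccontr)
      assume "G u v \<noteq> 0"
      \<comment> \<open>With \<open>G v v = 0\<close> the quadratic in \<open>t\<close> is affine,
        and at this \<open>t\<close> it equals -1.\<close>
      then show False
        using q[of "- (G u u + 1) / (2 * G u v)"] True nonneg[OF assms(1)] by (simp add: field_simps)
    qed
    then show ?thesis using True by simp
  next
    case False
    then have pos: "0 < G v v" using nonneg[OF assms(2)] by simp
    have "0 \<le> G u u - (G u v)\<^sup>2 / G v v"
      using q[of "- G u v / G v v"] pos by (simp add: power2_eq_square divide_simps)
    then show ?thesis using pos by (simp add: field_simps)
  qed
  then have "sqrt ((G u v)\<^sup>2) \<le> sqrt (G u u * G v v)" by (rule real_sqrt_le_mono)
  then show ?thesis by (simp add: real_sqrt_mult)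
qed

text \<open>Direct method: \<open>J v = G v v - 2 * f v\<close> is bounded below by
  \<open>-K^2\<close> on completing the square, a minimizing sequence is Cauchy by the parallelogram
  law, and the Euler equation at the limit is the claim. Completeness is assumed in terms of
  \<open>G\<close> itself, so a mere seminorm suffices and the limit is unique only up to length
  zero.\<close>

lemma riesz:
  fixes f :: "('b \<Rightarrow> real) \<Rightarrow> real"
  assumes complete: "\<And>X. (\<And>n::nat. X n \<in> V) \<Longrightarrow>
      (\<And>\<epsilon>::real. 0 < \<epsilon> \<Longrightarrow> \<exists>N. \<forall>m\<ge>N. \<forall>n\<ge>N. G (\<lambda>x. X m x - X n x) (\<lambda>x. X m x - X n x) < \<epsilon>) \<Longrightarrow>
      \<exists>u\<in>V. (\<lambda>n. G (\<lambda>x. X n x - u x) (\<lambda>x. X n x - u x)) \<longlonglongrightarrow> 0"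
    and f_add: "\<And>u v. u \<in> V \<Longrightarrow> v \<in> V \<Longrightarrow> f (\<lambda>x. u x + v x) = f u + f v"
    and f_scale: "\<And>c u. u \<in> V \<Longrightarrow> f (\<lambda>x. c * u x) = c * f u"
    and f_bound: "\<And>u. u \<in> V \<Longrightarrow> \<bar>f u\<bar> \<le> K * sqrt (G u u)"
  shows "\<exists>u\<in>V. \<forall>v\<in>V. G u v = f v"
proof -
  define J where "J v = G v v - 2 * f v" for v
  have lower: "- K\<^sup>2 \<le> J v" if "v \<in> V" for v
  proof -
    have "0 \<le> (sqrt (G v v) - K)\<^sup>2" by simp
    then show ?thesis
      using f_bound[OF that] nonneg[OF that] by (simp add: J_def power2_diff algebra_simps abs_le_iff)
  qed
  define I where "I = Inf (J ` V)"
  have ne: "V \<noteq> {}" using function_subspace_zero[OF subspace] by auto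
  have bdd: "bdd_below (J ` V)" using lower by (auto intro!: bdd_belowI2)
  have I: "I \<le> J v" if "v \<in> V" for v
    unfolding I_def using bdd that by (rule cINF_lower)
  have "\<exists>v\<in>V. J v < I + 1 / real (Suc n)" for n
    using cInf_lessD[of "J ` V" "I + 1 / real (Suc n)"] ne by (auto simp: I_def)
  then obtain X where XV: "\<And>n. X n \<in> V" and X: "\<And>n. J (X n) < I + 1 / real (Suc n)"
    by metis
  have cauchy: "\<exists>N. \<forall>m\<ge>N. \<forall>n\<ge>N. G (\<lambda>x. X m x - X n x) (\<lambda>x. X m x - X n x) < \<epsilon>"
    if "0 < \<epsilon>" for \<epsilon> :: real
  proof -
    obtain N where N: "1 / real (Suc N) < \<epsilon> / 4"
      using reals_Archimedean[of "\<epsilon> / 4"] \<open>0 < \<epsilon>\<close> by (auto simp: inverse_eq_divide)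
    have small: "J (X n) < I + \<epsilon> / 4" if "N \<le> n" for n
    proof -
      have "1 / real (Suc n) \<le> 1 / real (Suc N)" using that by (simp add: frac_le)
      then show ?thesis using X[of n] N by linarith
    qed
    have "G (\<lambda>x. X m x - X n x) (\<lambda>x. X m x - X n x) < \<epsilon>" if "N \<le> m" "N \<le> n" for m n
    proof -
      let ?h = "\<lambda>x. 1/2 * (X m x + X n x)"
      have s: "(\<lambda>x. X m x + X n x) \<in> V" and h: "?h \<in> V"
        using XV function_subspace_add[OF subspace] function_subspace_scale[OF subspace] by blast+
      have "f ?h = 1/2 * (f (X m) + f (X n))"
        using f_scale[OF s, of "1/2"] f_add[OF XV XV] by simp
      \<comment> \<open>The linear terms cancel because \<open>f\<close> of the midpoint is the mean
        of the values. As \<open>J ?h\<close> is at least the infimum \<open>I\<close>, two values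
        below \<open>I + \<epsilon>/4\<close> leave less than \<epsilon>.\<close>
      then have "G (\<lambda>x. X m x - X n x) (\<lambda>x. X m x - X n x) = 2 * J (X m) + 2 * J (X n) - 4 * J ?h"
        using parallelogram[OF XV XV] by (simp add: J_def)
      then show ?thesis using small[OF that(1)] small[OF that(2)] I[OF h] by linarith
    qed
    then show ?thesis by blast
  qed
  obtain u where u: "u \<in> V" and lim: "(\<lambda>n. G (\<lambda>x. X n x - u x) (\<lambda>x. X n x - u x)) \<longlonglongrightarrow> 0"
    using complete[OF XV cauchy] by blast
  have "G u v = f v" if v: "v \<in> V" for v
  proof -
    have "(\<lambda>n. sqrt (G (\<lambda>x. X n x - u x) (\<lambda>x. X n x - u x)) * sqrt (G v v)) \<longlonglongrightarrow> sqrt 0 * sqrt (G v v)"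
      by (intro tendsto_intros lim)
    then have "(\<lambda>n. sqrt (G (\<lambda>x. X n x - u x) (\<lambda>x. X n x - u x)) * sqrt (G v v)) \<longlonglongrightarrow> 0" by simp
    then have "(\<lambda>n. G (X n) v - G u v) \<longlonglongrightarrow> 0"
      by (rule Lim_null_comparison[rotated], intro always_eventually allI)
        (use cauchy_schwarz[OF function_subspace_diff[OF subspace XV u] v] diff[OF XV u v] in simp)
    then have conv: "(\<lambda>n. G (X n) v) \<longlonglongrightarrow> G u v" by (simp add: LIM_zero_iff)
    \<comment> \<open>The variation is carried out at \<open>X n\<close>, where it fails to be
      nonnegative by at most \<open>1/(n+1)\<close>, and only the resulting inequality is taken to
      the limit. Continuity of \<open>J\<close> along the sequence is thus avoided.\<close>
    have "0 \<le> 2 * t * (G u v - f v) + t\<^sup>2 * G v v" for t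
    proof (rule LIMSEQ_le)
      have "(\<lambda>n. - (1 / real (Suc n))) \<longlonglongrightarrow> - 0"
        by (intro tendsto_minus LIMSEQ_Suc lim_1_over_n)
      then show "(\<lambda>n. - (1 / real (Suc n))) \<longlonglongrightarrow> 0" by simp
      show "(\<lambda>n. 2 * t * (G (X n) v - f v) + t\<^sup>2 * G v v) \<longlonglongrightarrow> 2 * t * (G u v - f v) + t\<^sup>2 * G v v"
        by (intro tendsto_intros conv)
      show "\<exists>N. \<forall>n\<ge>N. - (1 / real (Suc n)) \<le> 2 * t * (G (X n) v - f v) + t\<^sup>2 * G v v"
      proof (intro exI allI impI)
        fix n
        have tv: "(\<lambda>x. t * v x) \<in> V" using v function_subspace_scale[OF subspace] by auto
        have "J (\<lambda>x. X n x + t * v x) = J (X n) + 2 * t * (G (X n) v - f v) + t\<^sup>2 * G v v"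
          using expand[OF XV v] f_add[OF XV tv] f_scale[OF v] by (simp add: J_def algebra_simps)
        then show "- (1 / real (Suc n)) \<le> 2 * t * (G (X n) v - f v) + t\<^sup>2 * G v v"
          using I[OF function_subspace_add[OF subspace XV[of n] tv]] X[of n] by linarith
      qed
    qed
    from quadratic_nonneg_imp_zero[OF this nonneg[OF v]] show ?thesis by simp
  qed
  with u show ?thesis by blast
qed

end

section \<open>Quadratic forms given by a kernel\<close>

text \<open>The tail infima increase, so the sum of their suprema is the supremum of their sums. It
  lets the two parts of the squared norm pass through Fatou together.\<close>

lemma liminf_add_ennreal_le:
  fixes a b :: "nat \<Rightarrow> ennreal"
  shows "liminf a + liminf b \<le> liminf (\<lambda>n. a n + b n)"
proof -
  have "liminf a + liminf b = (SUP n. (INF m\<in>{n..}. a m) + (INF m\<in>{n..}. b m))"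
    unfolding liminf_SUP_INF
    by (intro ennreal_SUP_add[symmetric]) (auto simp: incseq_def intro!: INF_superset_mono)
  also have "\<dots> \<le> (SUP n. INF m\<in>{n..}. a m + b m)"
    by (intro SUP_mono' INF_greatest add_mono INF_lower) auto
  finally show ?thesis unfolding liminf_SUP_INF .
qed

lemma square_sum_le: "(a + b)\<^sup>2 \<le> 2 * a\<^sup>2 + 2 * (b::real)\<^sup>2"
  using zero_le_power2[of "a - b"] by (simp add: power2_eq_square algebra_simps)

lemma nn_integral_square_add_le:
  fixes u v w :: "'b \<Rightarrow> real"
  assumes [measurable]: "u \<in> borel_measurable M" "v \<in> borel_measurable M" "w \<in> borel_measurable M"
    and w: "\<And>x. x \<in> space M \<Longrightarrow> 0 \<le> w x"
  shows "(\<integral>\<^sup>+x. ennreal (w x * (u x + v x)\<^sup>2) \<partial>M)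
    \<le> 2 * (\<integral>\<^sup>+x. ennreal (w x * (u x)\<^sup>2) \<partial>M) + 2 * (\<integral>\<^sup>+x. ennreal (w x * (v x)\<^sup>2) \<partial>M)"
proof -
  have "(\<integral>\<^sup>+x. ennreal (w x * (u x + v x)\<^sup>2) \<partial>M)
      \<le> (\<integral>\<^sup>+x. 2 * ennreal (w x * (u x)\<^sup>2) + 2 * ennreal (w x * (v x)\<^sup>2) \<partial>M)"
  proof (rule nn_integral_mono)
    fix x assume x: "x \<in> space M"
    have "w x * (u x + v x)\<^sup>2 \<le> w x * (2 * (u x)\<^sup>2 + 2 * (v x)\<^sup>2)"
      by (intro mult_left_mono square_sum_le w x)
    then have "ennreal (w x * (u x + v x)\<^sup>2) \<le> ennreal (2 * (w x * (u x)\<^sup>2) + 2 * (w x * (v x)\<^sup>2))"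
      by (intro ennreal_leI) (simp add: algebra_simps)
    also have "\<dots> = 2 * ennreal (w x * (u x)\<^sup>2) + 2 * ennreal (w x * (v x)\<^sup>2)"
      using w[OF x] by (simp add: ennreal_plus ennreal_mult del: ennreal_plus[symmetric])
    finally show "ennreal (w x * (u x + v x)\<^sup>2) \<le> 2 * ennreal (w x * (u x)\<^sup>2) + 2 * ennreal (w x * (v x)\<^sup>2)" .
  qed
  also have "\<dots> = 2 * (\<integral>\<^sup>+x. ennreal (w x * (u x)\<^sup>2) \<partial>M) + 2 * (\<integral>\<^sup>+x. ennreal (w x * (v x)\<^sup>2) \<partial>M)"
    by (simp add: nn_integral_add nn_integral_cmult)
  finally show ?thesis .
qed

lemma nn_integral_square_scale:
  fixes u w :: "'b \<Rightarrow> real"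
  assumes [measurable]: "u \<in> borel_measurable M" "w \<in> borel_measurable M"
    and w: "\<And>x. x \<in> space M \<Longrightarrow> 0 \<le> w x"
  shows "(\<integral>\<^sup>+x. ennreal (w x * (c * u x)\<^sup>2) \<partial>M) = ennreal (c\<^sup>2) * (\<integral>\<^sup>+x. ennreal (w x * (u x)\<^sup>2) \<partial>M)"
proof -
  have "(\<integral>\<^sup>+x. ennreal (w x * (c * u x)\<^sup>2) \<partial>M) = (\<integral>\<^sup>+x. ennreal (c\<^sup>2) * ennreal (w x * (u x)\<^sup>2) \<partial>M)"
    using w by (intro nn_integral_cong) (simp add: ennreal_mult[symmetric] power_mult_distrib mult_ac)
  then show ?thesis by (simp add: nn_integral_cmult)
qed

lemma integrable_weighted_product:
  fixes u v w :: "'b \<Rightarrow> real"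
  assumes [measurable]: "u \<in> borel_measurable M" "v \<in> borel_measurable M" "w \<in> borel_measurable M"
    and w: "\<And>x. x \<in> space M \<Longrightarrow> 0 \<le> w x"
    and fin: "(\<integral>\<^sup>+x. ennreal (w x * (u x)\<^sup>2) \<partial>M) < \<infinity>" "(\<integral>\<^sup>+x. ennreal (w x * (v x)\<^sup>2) \<partial>M) < \<infinity>"
  shows "integrable M (\<lambda>x. w x * u x * v x)"
proof -
  have "integrable M (\<lambda>x. w x * (u x)\<^sup>2)" "integrable M (\<lambda>x. w x * (v x)\<^sup>2)"
    using w fin by (auto intro!: integrableI_nonneg AE_I2)
  then have "integrable M (\<lambda>x. w x * (u x)\<^sup>2 + w x * (v x)\<^sup>2)" by auto
  then show ?thesis
  proof (rule Bochner_Integration.integrable_bound)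
    show "AE x in M. norm (w x * u x * v x) \<le> norm (w x * (u x)\<^sup>2 + w x * (v x)\<^sup>2)"
    proof (rule AE_I2)
      fix x assume x: "x \<in> space M"
      have "2 * (\<bar>u x\<bar> * \<bar>v x\<bar>) \<le> (u x)\<^sup>2 + (v x)\<^sup>2"
        using sum_squares_bound[of "\<bar>u x\<bar>" "\<bar>v x\<bar>"] by (simp add: mult.assoc)
      moreover have "0 \<le> \<bar>u x\<bar> * \<bar>v x\<bar>" by simp
      ultimately have "\<bar>u x\<bar> * \<bar>v x\<bar> \<le> (u x)\<^sup>2 + (v x)\<^sup>2" by linarith
      then have "w x * (\<bar>u x\<bar> * \<bar>v x\<bar>) \<le> w x * ((u x)\<^sup>2 + (v x)\<^sup>2)"
        by (intro mult_left_mono w x)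
      then show "norm (w x * u x * v x) \<le> norm (w x * (u x)\<^sup>2 + w x * (v x)\<^sup>2)"
        using w[OF x] by (simp add: abs_mult algebra_simps)
    qed
  qed measurable
qed

text \<open>Expanding \<open>(2^j |D j x| - 1)^2\<close> gives
  \<open>|D| \<le> 2^j D^2 + 2^(-j)\<close>, so the integral of \<open>|D j|\<close> is at most
  \<open>2^(-j)\<close> times one plus the total mass. The sum over \<open>j\<close> has a finite
  integral and hence is finite almost everywhere.\<close>

lemma (in finite_measure) AE_summable_of_square_bound:
  fixes D :: "nat \<Rightarrow> 'a \<Rightarrow> real"
  assumes [measurable]: "\<And>j. D j \<in> borel_measurable M"
    and D: "\<And>j. (\<integral>\<^sup>+x. ennreal ((D j x)\<^sup>2) \<partial>M) \<le> ennreal ((1/4) ^ j)"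
  shows "AE x in M. summable (\<lambda>j. D j x)"
proof -
  let ?m = "measure M (space M)"
  have bound: "(\<integral>\<^sup>+x. ennreal \<bar>D j x\<bar> \<partial>M) \<le> ennreal ((1/2) ^ j * (1 + ?m))" for j
  proof -
    have "(\<integral>\<^sup>+x. ennreal \<bar>D j x\<bar> \<partial>M) \<le> (\<integral>\<^sup>+x. ennreal (2 ^ j) * ennreal ((D j x)\<^sup>2) + ennreal ((1/2) ^ j) \<partial>M)"
    proof (rule nn_integral_mono)
      fix x
      have "0 \<le> (2 ^ j * \<bar>D j x\<bar> - 1)\<^sup>2" by simp
      then have "2 * (2 ^ j * \<bar>D j x\<bar>) \<le> (2 ^ j)\<^sup>2 * (D j x)\<^sup>2 + 1"
        by (simp add: power2_diff power_mult_distrib)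
      moreover have "0 \<le> 2 ^ j * \<bar>D j x\<bar>" by simp
      ultimately have "(2 ^ j * \<bar>D j x\<bar>) \<le> (2 ^ j)\<^sup>2 * (D j x)\<^sup>2 + 1" by linarith
      then have "\<bar>D j x\<bar> \<le> 2 ^ j * (D j x)\<^sup>2 + (1/2) ^ j"
        by (simp add: field_simps power2_eq_square power_divide)
      then show "ennreal \<bar>D j x\<bar> \<le> ennreal (2 ^ j) * ennreal ((D j x)\<^sup>2) + ennreal ((1/2) ^ j)"
        by (simp add: ennreal_mult[symmetric] ennreal_plus[symmetric] del: ennreal_plus)
    qed
    also have "\<dots> = ennreal (2 ^ j) * (\<integral>\<^sup>+x. ennreal ((D j x)\<^sup>2) \<partial>M) + ennreal ((1/2) ^ j) * emeasure M (space M)"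
      by (simp add: nn_integral_add nn_integral_cmult)
    also have "\<dots> \<le> ennreal (2 ^ j) * ennreal ((1/4) ^ j) + ennreal ((1/2) ^ j) * ennreal ?m"
      by (intro add_mono mult_left_mono D) (auto simp: emeasure_eq_measure)
    also have "\<dots> = ennreal ((1/2) ^ j * (1 + ?m))"
      by (simp add: ennreal_mult[symmetric] ennreal_plus[symmetric] power_mult_distrib[symmetric] algebra_simps del: ennreal_plus)
    finally show ?thesis .
  qed
  have "(\<integral>\<^sup>+x. (\<Sum>j. ennreal \<bar>D j x\<bar>) \<partial>M) = (\<Sum>j. \<integral>\<^sup>+x. ennreal \<bar>D j x\<bar> \<partial>M)"
    by (rule nn_integral_suminf) simp
  also have "\<dots> \<le> (\<Sum>j. ennreal ((1/2) ^ j * (1 + ?m)))"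
    by (intro suminf_le bound) auto
  also have "\<dots> < \<infinity>"
  proof -
    have "summable (\<lambda>j. (1/2) ^ j * (1 + ?m) :: real)"
      by (intro summable_mult2 summable_geometric) simp
    then show ?thesis by (subst suminf_ennreal2) auto
  qed
  finally have "(\<integral>\<^sup>+x. (\<Sum>j. ennreal \<bar>D j x\<bar>) \<partial>M) \<noteq> \<infinity>" by simp
  then have "AE x in M. (\<Sum>j. ennreal \<bar>D j x\<bar>) \<noteq> \<infinity>"
    by (intro nn_integral_PInf_AE) auto
  then show ?thesis
  proof eventually_elim
    case (elim x)
    then have "summable (\<lambda>j. \<bar>D j x\<bar>)" by (intro summable_suminf_not_top) auto
    then show ?case by (rule summable_rabs_cancel)
  qed
qed

text \<open>One theory for several kernels on the same domain: \<open>jump_kernel r\<close> for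
  various radii \<open>r\<close>, which gives the norm, and the symmetrized kernel of the nonlocal
  form. Finiteness of the measure is what turns square bounds into almost everywhere
  convergence.\<close>

locale kernel_form = finite_measure M for M :: "'b measure" +
  fixes k :: "'b \<Rightarrow> 'b \<Rightarrow> real"
  assumes kernel_measurable: "(\<lambda>p. k (fst p) (snd p)) \<in> borel_measurable (M \<Otimes>\<^sub>M M)"
    and kernel_nonneg: "x \<in> space M \<Longrightarrow> y \<in> space M \<Longrightarrow> 0 \<le> k x y"
begin

interpretation P: pair_sigma_finite M M ..

text \<open>An iterated Bochner integral, in the shape of \<open>nonlocal_form\<close>. Finiteness
  is read off from the companion \<open>energy_sq\<close>, because a Bochner integral that does not
  exist has the default value 0.\<close>

definition energy :: "('b \<Rightarrow> real) \<Rightarrow> ('b \<Rightarrow> real) \<Rightarrow> real" where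
  "energy u v = (LINT x|M. LINT y|M. k x y * (u x - u y) * (v x - v y))"

definition energy_sq :: "('b \<Rightarrow> real) \<Rightarrow> ennreal" where
  "energy_sq u = (\<integral>\<^sup>+x. (\<integral>\<^sup>+y. ennreal (k x y * (u x - u y)\<^sup>2) \<partial>M) \<partial>M)"

definition norm_sq :: "('b \<Rightarrow> real) \<Rightarrow> ennreal" where
  "norm_sq u = (\<integral>\<^sup>+x. ennreal ((u x)\<^sup>2) \<partial>M) + energy_sq u"

definition inner_form :: "('b \<Rightarrow> real) \<Rightarrow> ('b \<Rightarrow> real) \<Rightarrow> real" where
  "inner_form u v = (LINT x|M. u x * v x) + energy u v"

definition finite_norm :: "('b \<Rightarrow> real) set" where
  "finite_norm = {u \<in> borel_measurable M. norm_sq u < \<infinity>}"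

abbreviation weight :: "'b \<times> 'b \<Rightarrow> real" where
  "weight \<equiv> \<lambda>p. k (fst p) (snd p)"

abbreviation increment :: "('b \<Rightarrow> real) \<Rightarrow> 'b \<times> 'b \<Rightarrow> real" where
  "increment u \<equiv> \<lambda>p. u (fst p) - u (snd p)"

lemma weight_nonneg: "p \<in> space (M \<Otimes>\<^sub>M M) \<Longrightarrow> 0 \<le> weight p"
  by (auto simp: space_pair_measure kernel_nonneg)

lemma increment_measurable:
  assumes [measurable]: "u \<in> borel_measurable M"
  shows "increment u \<in> borel_measurable (M \<Otimes>\<^sub>M M)"
  by measurable

lemma energy_sq_pair:
  assumes [measurable]: "u \<in> borel_measurable M"
  shows "energy_sq u = (\<integral>\<^sup>+p. ennreal (weight p * (increment u p)\<^sup>2) \<partial>(M \<Otimes>\<^sub>M M))"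
proof -
  note kernel_measurable[measurable]
  show ?thesis
    using nn_integral_fst[of "\<lambda>p. ennreal (weight p * (increment u p)\<^sup>2)" M]
    by (simp add: energy_sq_def)
qed

lemma energy_sq_add_le:
  assumes "u \<in> borel_measurable M" "v \<in> borel_measurable M"
  shows "energy_sq (\<lambda>x. u x + v x) \<le> 2 * energy_sq u + 2 * energy_sq v"
proof -
  have "energy_sq (\<lambda>x. u x + v x)
      = (\<integral>\<^sup>+p. ennreal (weight p * (increment u p + increment v p)\<^sup>2) \<partial>(M \<Otimes>\<^sub>M M))"
    using assms by (simp add: energy_sq_pair algebra_simps)
  then show ?thesis
    using nn_integral_square_add_le[OF increment_measurable[OF assms(1)] increment_measurable[OF assms(2)]
        kernel_measurable weight_nonneg] assms
    by (simp add: energy_sq_pair)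
qed

lemma energy_sq_scale:
  assumes "u \<in> borel_measurable M"
  shows "energy_sq (\<lambda>x. c * u x) = ennreal (c\<^sup>2) * energy_sq u"
proof -
  have "energy_sq (\<lambda>x. c * u x) = (\<integral>\<^sup>+p. ennreal (weight p * (c * increment u p)\<^sup>2) \<partial>(M \<Otimes>\<^sub>M M))"
    using assms by (simp add: energy_sq_pair algebra_simps)
  then show ?thesis
    using nn_integral_square_scale[OF increment_measurable[OF assms] kernel_measurable weight_nonneg] assms
    by (simp add: energy_sq_pair)
qed

lemma norm_sq_add_le:
  assumes "u \<in> borel_measurable M" "v \<in> borel_measurable M"
  shows "norm_sq (\<lambda>x. u x + v x) \<le> 2 * norm_sq u + 2 * norm_sq v"
proof -
  have "(\<integral>\<^sup>+x. ennreal ((u x + v x)\<^sup>2) \<partial>M) + energy_sq (\<lambda>x. u x + v x)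
    \<le> (2 * (\<integral>\<^sup>+x. ennreal ((u x)\<^sup>2) \<partial>M) + 2 * (\<integral>\<^sup>+x. ennreal ((v x)\<^sup>2) \<partial>M))
      + (2 * energy_sq u + 2 * energy_sq v)"
    using nn_integral_square_add_le[OF assms, of "\<lambda>_. 1"] energy_sq_add_le[OF assms]
    by (intro add_mono) auto
  then show ?thesis by (simp add: norm_sq_def algebra_simps)
qed

lemma norm_sq_scale:
  assumes "u \<in> borel_measurable M"
  shows "norm_sq (\<lambda>x. c * u x) = ennreal (c\<^sup>2) * norm_sq u"
  using nn_integral_square_scale[OF assms, of "\<lambda>_. 1" c] energy_sq_scale[OF assms, of c]
  by (simp add: norm_sq_def algebra_simps)

lemma norm_sq_diff_le:
  assumes "u \<in> borel_measurable M" "v \<in> borel_measurable M"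
  shows "norm_sq (\<lambda>x. u x - v x) \<le> 2 * norm_sq u + 2 * norm_sq v"
  using norm_sq_add_le[OF assms(1), of "\<lambda>x. -1 * v x"] norm_sq_scale[OF assms(2), of "-1"] assms by simp

lemma norm_sq_minus_commute: "norm_sq (\<lambda>x. u x - v x) = norm_sq (\<lambda>x. v x - u x)"
proof -
  have "(u x - v x)\<^sup>2 = (v x - u x)\<^sup>2" "((u x - v x) - (u y - v y))\<^sup>2 = ((v x - u x) - (v y - u y))\<^sup>2" for x y
    by (simp_all add: power2_eq_square algebra_simps)
  then show ?thesis by (simp only: norm_sq_def energy_sq_def)
qed

lemma function_subspace_finite_norm: "function_subspace finite_norm"
  unfolding function_subspace_def finite_norm_def
proof (safe)
  show "norm_sq (\<lambda>x. 0) < \<infinity>" by (simp add: norm_sq_def energy_sq_def)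
next
  fix u v assume *: "u \<in> borel_measurable M" "v \<in> borel_measurable M" "norm_sq u < \<infinity>" "norm_sq v < \<infinity>"
  have "2 * norm_sq u + 2 * norm_sq v < \<infinity>" using * by (auto simp: ennreal_mult_less_top)
  then show "norm_sq (\<lambda>x. u x + v x) < \<infinity>" using norm_sq_add_le[OF *(1,2)] by (rule le_less_trans[rotated])
next
  fix c u assume *: "u \<in> borel_measurable M" "norm_sq u < \<infinity>"
  then show "norm_sq (\<lambda>x. c * u x) < \<infinity>" by (simp add: norm_sq_scale ennreal_mult_less_top)
qed auto

lemma finite_normD:
  assumes "u \<in> finite_norm"
  shows "u \<in> borel_measurable M" "(\<integral>\<^sup>+x. ennreal ((u x)\<^sup>2) \<partial>M) < \<infinity>" "energy_sq u < \<infinity>"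
  using assms by (auto simp: finite_norm_def norm_sq_def)

lemma integrable_energy:
  assumes "u \<in> borel_measurable M" "v \<in> borel_measurable M" "energy_sq u < \<infinity>" "energy_sq v < \<infinity>"
  shows "integrable (M \<Otimes>\<^sub>M M) (\<lambda>p. weight p * increment u p * increment v p)"
  using integrable_weighted_product[OF increment_measurable[OF assms(1)] increment_measurable[OF assms(2)]
      kernel_measurable weight_nonneg] assms
  by (simp add: energy_sq_pair)

text \<open>Fubini for the integrable product of increments. Additivity of \<open>energy\<close> is
  derived on the product space, where integrability can be stated once instead of section by
  section.\<close>

lemma energy_pair:
  assumes "u \<in> borel_measurable M" "v \<in> borel_measurable M" "energy_sq u < \<infinity>" "energy_sq v < \<infinity>"
  shows "energy u v = (LINT p|(M \<Otimes>\<^sub>M M). weight p * increment u p * increment v p)"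
  using P.integral_fst'[OF integrable_energy[OF assms]] by (simp add: energy_def)

lemma energy_commute: "energy u v = energy v u"
  by (simp add: energy_def mult_ac)

lemma energy_add:
  assumes "u \<in> finite_norm" "v \<in> finite_norm" "w \<in> finite_norm"
  shows "energy (\<lambda>x. u x + v x) w = energy u w + energy v w"
proof -
  have "(\<lambda>x. u x + v x) \<in> finite_norm"
    using assms function_subspace_add[OF function_subspace_finite_norm] by auto
  then have "energy (\<lambda>x. u x + v x) w
      = (LINT p|(M \<Otimes>\<^sub>M M). weight p * increment u p * increment w p + weight p * increment v p * increment w p)"
    using assms by (subst energy_pair) (auto dest: finite_normD simp: algebra_simps)
  also have "\<dots> = energy u w + energy v w"
    using finite_normD[OF assms(1)] finite_normD[OF assms(2)] finite_normD[OF assms(3)]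
    by (simp add: integrable_energy energy_pair)
  finally show ?thesis .
qed

text \<open>Constant real factors leave a Bochner integral even where it is not defined, since both
  sides are then 0; no finiteness has to be assumed.\<close>

lemma energy_scale: "energy (\<lambda>x. c * u x) w = c * energy u w"
proof -
  have "k x y * (c * u x - c * u y) * (w x - w y) = c * (k x y * (u x - u y) * (w x - w y))" for x y
    by (simp add: algebra_simps)
  then show ?thesis unfolding energy_def by (simp only: integral_mult_right_zero)
qed

lemma ennreal_energy:
  assumes "u \<in> finite_norm"
  shows "ennreal (energy u u) = energy_sq u"
proof -
  note u = finite_normD[OF assms]
  have "energy_sq u = (\<integral>\<^sup>+p. ennreal (weight p * increment u p * increment u p) \<partial>(M \<Otimes>\<^sub>M M))"
    using u by (simp add: energy_sq_pair power2_eq_square mult_ac)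
  also have "\<dots> = ennreal (LINT p|(M \<Otimes>\<^sub>M M). weight p * increment u p * increment u p)"
    using u weight_nonneg
    by (intro nn_integral_eq_integral integrable_energy AE_I2) (auto simp: mult.assoc)
  finally show ?thesis using u by (simp add: energy_pair)
qed

lemma energy_nonneg: "0 \<le> energy u u"
  unfolding energy_def
  by (intro Bochner_Integration.integral_nonneg) (auto simp: mult.assoc kernel_nonneg)

lemma inner_form_commute: "inner_form u v = inner_form v u"
  by (simp add: inner_form_def energy_commute[of u v] mult.commute[of "u _" "v _"])

lemma integrable_product:
  assumes "u \<in> finite_norm" "v \<in> finite_norm"
  shows "integrable M (\<lambda>x. u x * v x)"
  using integrable_weighted_product[of u M v "\<lambda>_. 1"] finite_normD[OF assms(1)] finite_normD[OF assms(2)]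
  by simp

lemma inner_form_add:
  assumes "u \<in> finite_norm" "v \<in> finite_norm" "w \<in> finite_norm"
  shows "inner_form (\<lambda>x. u x + v x) w = inner_form u w + inner_form v w"
  using assms by (simp add: inner_form_def energy_add distrib_right integrable_product)

lemma inner_form_scale: "inner_form (\<lambda>x. c * u x) w = c * inner_form u w"
  by (simp add: inner_form_def energy_scale mult.assoc distrib_left)

lemma inner_form_nonneg: "0 \<le> inner_form u u"
  by (simp add: inner_form_def energy_nonneg)

lemma ennreal_inner_form:
  assumes "u \<in> finite_norm"
  shows "ennreal (inner_form u u) = norm_sq u"
  using ennreal_energy[OF assms] nn_integral_eq_integral[OF integrable_product[OF assms assms]]
  by (simp add: inner_form_def norm_sq_def power2_eq_square energy_nonneg)

text \<open>Fatou is applied twice: to the inner integral for almost every \<open>x\<close>, and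
  then to the outer one.\<close>

lemma norm_sq_fatou:
  assumes [measurable]: "\<And>n. U n \<in> borel_measurable M" "u \<in> borel_measurable M"
    and lim: "AE x in M. (\<lambda>n. U n x) \<longlonglongrightarrow> u x"
    and bound: "\<And>n. norm_sq (U n) \<le> c"
  shows "norm_sq u \<le> c"
proof -
  note kernel_measurable[measurable]
  have k_sections: "(\<lambda>y. k x y) \<in> borel_measurable M" if "x \<in> space M" for x
    using measurable_compose[OF measurable_Pair1'[OF that] kernel_measurable] by simp
  \<comment> \<open>The local and the nonlocal part are merged into one integrand in
    \<open>x\<close>, so that a single outer application of Fatou treats both.\<close>
  define g where "g n x = ennreal ((U n x)\<^sup>2) + (\<integral>\<^sup>+y. ennreal (k x y * (U n x - U n y)\<^sup>2) \<partial>M)" for n x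
  define g' where "g' x = ennreal ((u x)\<^sup>2) + (\<integral>\<^sup>+y. ennreal (k x y * (u x - u y)\<^sup>2) \<partial>M)" for x
  have inner: "(\<lambda>x. \<integral>\<^sup>+y. ennreal (k x y * (w x - w y)\<^sup>2) \<partial>M) \<in> borel_measurable M"
    if [measurable]: "w \<in> borel_measurable M" for w
    using borel_measurable_nn_integral_fst[of "\<lambda>p. ennreal (weight p * (increment w p)\<^sup>2)" M] by simp
  have norm_g: "norm_sq (U n) = (\<integral>\<^sup>+x. g n x \<partial>M)" for n
    by (simp add: norm_sq_def energy_sq_def g_def nn_integral_add inner)
  have norm_g': "norm_sq u = (\<integral>\<^sup>+x. g' x \<partial>M)"
    by (simp add: norm_sq_def energy_sq_def g'_def nn_integral_add inner)
  have "AE x in M. g' x \<le> liminf (\<lambda>n. g n x)"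
    using lim AE_space
  proof eventually_elim
    case (elim x)
    note k_sections[OF elim(2), measurable]
    have "(\<integral>\<^sup>+y. ennreal (k x y * (u x - u y)\<^sup>2) \<partial>M)
        \<le> (\<integral>\<^sup>+y. liminf (\<lambda>n. ennreal (k x y * (U n x - U n y)\<^sup>2)) \<partial>M)"
    proof (rule nn_integral_mono_AE)
      show "AE y in M. ennreal (k x y * (u x - u y)\<^sup>2) \<le> liminf (\<lambda>n. ennreal (k x y * (U n x - U n y)\<^sup>2))"
        using lim
      proof eventually_elim
        case (elim y)
        have "(\<lambda>n. ennreal (k x y * (U n x - U n y)\<^sup>2)) \<longlonglongrightarrow> ennreal (k x y * (u x - u y)\<^sup>2)"
          by (intro tendsto_intros elim \<open>(\<lambda>n. U n x) \<longlonglongrightarrow> u x\<close>)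
        then show ?case by (simp add: lim_imp_Liminf)
      qed
    qed
    also have "\<dots> \<le> liminf (\<lambda>n. \<integral>\<^sup>+y. ennreal (k x y * (U n x - U n y)\<^sup>2) \<partial>M)"
      by (rule nn_integral_liminf) measurable
    finally have 1: "(\<integral>\<^sup>+y. ennreal (k x y * (u x - u y)\<^sup>2) \<partial>M)
      \<le> liminf (\<lambda>n. \<integral>\<^sup>+y. ennreal (k x y * (U n x - U n y)\<^sup>2) \<partial>M)" .
    have "(\<lambda>n. ennreal ((U n x)\<^sup>2)) \<longlonglongrightarrow> ennreal ((u x)\<^sup>2)"
      by (intro tendsto_intros elim)
    then have "liminf (\<lambda>n. ennreal ((U n x)\<^sup>2)) = ennreal ((u x)\<^sup>2)"
      by (simp add: lim_imp_Liminf)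
    with 1 have "g' x \<le> liminf (\<lambda>n. ennreal ((U n x)\<^sup>2))
        + liminf (\<lambda>n. \<integral>\<^sup>+y. ennreal (k x y * (U n x - U n y)\<^sup>2) \<partial>M)"
      by (simp add: g'_def add_left_mono)
    also have "\<dots> \<le> liminf (\<lambda>n. g n x)"
      unfolding g_def by (rule liminf_add_ennreal_le)
    finally show ?case .
  qed
  then have "norm_sq u \<le> (\<integral>\<^sup>+x. liminf (\<lambda>n. g n x) \<partial>M)"
    unfolding norm_g' by (rule nn_integral_mono_AE)
  also have "\<dots> \<le> liminf (\<lambda>n. \<integral>\<^sup>+x. g n x \<partial>M)"
    using inner by (intro nn_integral_liminf) (simp add: g_def)
  also have "\<dots> \<le> liminf (\<lambda>n. c)"
    using bound by (intro Liminf_mono always_eventually) (simp add: norm_g)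
  finally show ?thesis by (simp add: Liminf_const)
qed

text \<open>A constant sequence converges almost everywhere to any function that agrees with it
  almost everywhere, so Fatou gives both inequalities.\<close>

lemma norm_sq_cong_AE:
  assumes "u \<in> borel_measurable M" "v \<in> borel_measurable M" "AE x in M. u x = v x"
  shows "norm_sq u = norm_sq v"
proof (rule antisym)
  show "norm_sq u \<le> norm_sq v"
    using assms(3) by (intro norm_sq_fatou[of "\<lambda>_. v" u]) (use assms in auto)
  show "norm_sq v \<le> norm_sq u"
    using assms(3) by (intro norm_sq_fatou[of "\<lambda>_. u" v]) (use assms in auto)
qed

text \<open>Riesz-Fischer: a rapidly converging subsequence has an almost everywhere limit, and
  Fatou along that subsequence bounds the distance of every late \<open>X n\<close> to the limit.
  Convergence of the energy is thus never shown directly.\<close>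

theorem complete:
  fixes X :: "nat \<Rightarrow> 'b \<Rightarrow> real"
  assumes X: "\<And>n. X n \<in> finite_norm"
    and cauchy: "\<And>\<epsilon>::real. 0 < \<epsilon> \<Longrightarrow> \<exists>N. \<forall>m\<ge>N. \<forall>n\<ge>N. norm_sq (\<lambda>x. X m x - X n x) \<le> ennreal \<epsilon>"
  shows "\<exists>u\<in>finite_norm. \<forall>\<epsilon>::real. 0 < \<epsilon> \<longrightarrow> (\<exists>N. \<forall>n\<ge>N. norm_sq (\<lambda>x. X n x - u x) \<le> ennreal \<epsilon>)"
proof -
  have [measurable]: "X n \<in> borel_measurable M" for n using X finite_normD by auto
  have "\<exists>N. \<forall>m\<ge>N. \<forall>n\<ge>N. norm_sq (\<lambda>x. X m x - X n x) \<le> ennreal ((1/4) ^ j)" for j :: nat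
    by (rule cauchy) simp
  then obtain N :: "nat \<Rightarrow> nat" where N: "\<And>j m n. N j \<le> m \<Longrightarrow> N j \<le> n \<Longrightarrow> norm_sq (\<lambda>x. X m x - X n x) \<le> ennreal ((1/4) ^ j)"
    by metis
  \<comment> \<open>The sum makes \<open>r\<close> nondecreasing and at least \<open>N j\<close>;
    the extra \<open>j\<close> gives \<open>j \<le> r j\<close>.\<close>
  define r where "r j = (\<Sum>i\<le>j. N i) + j" for j :: nat
  have r_N: "N j \<le> r j" for j
    using member_le_sum[of j "{..j}" N] by (simp add: r_def)
  have r_Suc: "r j \<le> r (Suc j)" and r_ge: "j \<le> r j" for j by (auto simp: r_def)
  define D where "D j x = X (r (Suc j)) x - X (r j) x" for j x
  have D_meas[measurable]: "D j \<in> borel_measurable M" for j unfolding D_def by measurable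
  have "(\<integral>\<^sup>+x. ennreal ((D j x)\<^sup>2) \<partial>M) \<le> ennreal ((1/4) ^ j)" for j
  proof -
    have "(\<integral>\<^sup>+x. ennreal ((D j x)\<^sup>2) \<partial>M) \<le> norm_sq (D j)" by (simp add: norm_sq_def)
    also have "\<dots> \<le> ennreal ((1/4) ^ j)"
      unfolding D_def using N[of j "r (Suc j)" "r j"] r_N[of j] r_Suc[of j] by simp
    finally show ?thesis .
  qed
  from AE_summable_of_square_bound[OF D_meas this]
  have AE_conv: "AE x in M. convergent (\<lambda>j. X (r j) x)"
  proof eventually_elim
    case (elim x)
    have "(\<Sum>i<j. D i x) = X (r j) x - X (r 0) x" for j
      unfolding D_def by (rule sum_lessThan_telescope)
    then have "(\<lambda>j. X (r j) x) = (\<lambda>j. (\<Sum>i<j. D i x) + X (r 0) x)" by auto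
    moreover have "convergent (\<lambda>j. (\<Sum>i<j. D i x))"
      using elim by (simp add: summable_iff_convergent)
    ultimately show ?case using convergent_add[OF _ convergent_const] by simp
  qed
  \<comment> \<open>\<open>lim\<close> is total and measurable; its values on the null set without
    convergence are irrelevant.\<close>
  define u where "u x = lim (\<lambda>j. X (r j) x)" for x
  have u_meas[measurable]: "u \<in> borel_measurable M" unfolding u_def by measurable
  have lim: "AE x in M. (\<lambda>j. X (r j) x) \<longlonglongrightarrow> u x"
    using AE_conv by eventually_elim (simp add: u_def convergent_LIMSEQ_iff)
  have conv: "\<exists>N. \<forall>n\<ge>N. norm_sq (\<lambda>x. X n x - u x) \<le> ennreal \<epsilon>" if \<epsilon>: "0 < \<epsilon>" for \<epsilon> :: real
  proof -
    from cauchy[OF \<epsilon>] obtain K where K: "\<And>m n. K \<le> m \<Longrightarrow> K \<le> n \<Longrightarrow> norm_sq (\<lambda>x. X m x - X n x) \<le> ennreal \<epsilon>"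
      by blast
    have "norm_sq (\<lambda>x. X n x - u x) \<le> ennreal \<epsilon>" if "K \<le> n" for n
    proof (rule norm_sq_fatou)
      show "AE x in M. (\<lambda>j. X n x - X (r (K + j)) x) \<longlonglongrightarrow> X n x - u x"
        using lim
      proof eventually_elim
        case (elim x)
        show ?case
          using LIMSEQ_ignore_initial_segment[OF elim, of K] by (intro tendsto_intros) (simp add: add.commute)
      qed
      show "norm_sq (\<lambda>x. X n x - X (r (K + j)) x) \<le> ennreal \<epsilon>" for j
        using K[OF that] r_ge[of "K + j"] by simp
    qed measurable
    then show ?thesis by blast
  qed
  have "u \<in> finite_norm"
  proof -
    obtain n where n: "norm_sq (\<lambda>x. X n x - u x) \<le> ennreal 1" using conv[of 1] by auto
    have "norm_sq u = norm_sq (\<lambda>x. X n x - (X n x - u x))" by simp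
    also have "\<dots> \<le> 2 * norm_sq (X n) + 2 * norm_sq (\<lambda>x. X n x - u x)"
      by (rule norm_sq_diff_le) measurable
    also have "\<dots> < \<infinity>"
      using X[of n] le_less_trans[OF n ennreal_less_top] by (auto simp: finite_norm_def ennreal_mult_less_top)
    finally show ?thesis by (simp add: finite_norm_def)
  qed
  with conv show ?thesis by blast
qed

end

section \<open>Jumps along a localization function\<close>

lemma nn_integral_inj_substitution_le:
  fixes g g' F :: "real \<Rightarrow> real"
  assumes S: "open S" and g: "\<And>s. s \<in> S \<Longrightarrow> (g has_real_derivative g' s) (at s)"
    and inj: "inj_on g S" and into: "g ` S \<subseteq> S"
    and nonneg: "\<And>s. s \<in> S \<Longrightarrow> 0 \<le> g' s" "\<And>s. 0 \<le> F s"
    and [measurable]: "F \<in> borel_measurable borel"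
  shows "(\<integral>\<^sup>+s. ennreal (g' s * F (g s)) * indicator S s \<partial>lborel)
    \<le> (\<integral>\<^sup>+s. ennreal (F s) * indicator S s \<partial>lborel)"
proof (cases "(\<integral>\<^sup>+s. ennreal (F s) * indicator S s \<partial>lborel) < \<infinity>")
  case True
  have [measurable]: "S \<in> sets borel" using S by auto
  have "(\<integral>\<^sup>+s. ennreal (F s) * indicator S s \<partial>lborel) = (\<integral>\<^sup>+s. ennreal (indicator S s *\<^sub>R F s) \<partial>lborel)"
    by (intro nn_integral_cong) (auto split: split_indicator)
  then have "integrable lborel (\<lambda>s. indicator S s *\<^sub>R F s)"
    using True nonneg by (intro integrableI_nonneg) (auto split: split_indicator)
  then have F_S: "F absolutely_integrable_on S"
    unfolding set_integrable_def by (rule integrable_completion[THEN iffD2, rotated]) measurable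
  have "continuous_on S g"
    using g by (intro continuous_at_imp_continuous_on ballI DERIV_isCont) auto
  \<comment> \<open>Invariance of domain gives measurability of the image.\<close>
  then have "open (g ` S)" using S inj by (intro invariance_of_domain_gen) auto
  then have F_gS: "F absolutely_integrable_on (g ` S)"
    using F_S into by (intro set_integrable_subset[OF F_S]) auto
  have *: "(\<lambda>s. \<bar>g' s\<bar> * F (g s)) absolutely_integrable_on S \<and>
      integral S (\<lambda>s. \<bar>g' s\<bar> * F (g s)) = integral (g ` S) F"
    using S g inj F_gS
    by (subst has_absolute_integral_change_of_variables_1') (auto intro: has_field_derivative_at_within)
  have "(\<integral>\<^sup>+s. ennreal (g' s * F (g s)) * indicator S s \<partial>lborel)
      = (\<integral>\<^sup>+s. ennreal (\<bar>g' s\<bar> * F (g s)) * indicator S s \<partial>lborel)"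
    using nonneg by (intro nn_integral_cong) (auto split: split_indicator)
  also have "\<dots> = ennreal (integral (g ` S) F)"
    using * nonneg
    by (intro nn_integral_has_integral_lebesgue') (auto simp: absolutely_integrable_on_def has_integral_integral)
  also have "\<dots> = (\<integral>\<^sup>+s. ennreal (F s) * indicator (g ` S) s \<partial>lborel)"
    using F_gS nonneg
    by (intro nn_integral_has_integral_lebesgue'[symmetric]) (auto simp: absolutely_integrable_on_def has_integral_integral)
  also have "\<dots> \<le> (\<integral>\<^sup>+s. ennreal (F s) * indicator S s \<partial>lborel)"
    using into by (intro nn_integral_mono) (auto split: split_indicator)
  finally show ?thesis .
qed (simp add: not_less top.extremum_unique)

section \<open>Affine substitution, exchange of integrals and slicing by parallel lines\<close>

lemma nn_integral_lborel_affine: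
  fixes f :: "'a::euclidean_space \<Rightarrow> ennreal"
  assumes [measurable]: "f \<in> borel_measurable borel" and c: "c \<noteq> 0"
  shows "(\<integral>\<^sup>+y. f y \<partial>lborel) = ennreal (\<bar>c\<bar> ^ DIM('a)) * (\<integral>\<^sup>+z. f (t + c *\<^sub>R z) \<partial>lborel)"
  by (subst lborel_affine[OF c, of t])
    (simp add: nn_integral_density nn_integral_distr nn_integral_cmult)

lemma nn_integral_lborel_swap:
  fixes f :: "'a::euclidean_space \<Rightarrow> 'b::euclidean_space \<Rightarrow> ennreal"
  assumes "(\<lambda>p. f (fst p) (snd p)) \<in> borel_measurable (borel \<Otimes>\<^sub>M borel)"
  shows "(\<integral>\<^sup>+x. (\<integral>\<^sup>+y. f x y \<partial>lborel) \<partial>lborel) = (\<integral>\<^sup>+y. (\<integral>\<^sup>+x. f x y \<partial>lborel) \<partial>lborel)"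
proof -
  have "(\<lambda>(x, y). f x y) \<in> borel_measurable (lborel \<Otimes>\<^sub>M lborel)"
    using assms by (simp add: case_prod_beta' cong: measurable_cong_sets)
  then show ?thesis using lborel_pair.Fubini'[of f] by simp
qed

text \<open>No rotation and no orthogonal splitting is needed: a line parallel to \<open>z\<close>
  meets the slab \<open>0 \<le> x \<bullet> z < z \<bullet> z\<close> in a segment of parameter
  length one. Starting points in the slab, each integrated along its whole line, therefore count
  every point exactly once.\<close>

lemma nn_integral_lines:
  fixes G :: "'a::euclidean_space \<Rightarrow> ennreal"
  assumes [measurable]: "G \<in> borel_measurable borel" and z: "z \<noteq> 0"
  shows "(\<integral>\<^sup>+x. G x \<partial>lborel)
    = (\<integral>\<^sup>+x. indicator {x. 0 \<le> x \<bullet> z \<and> x \<bullet> z < z \<bullet> z} x * (\<integral>\<^sup>+(s::real). G (x + s *\<^sub>R z) \<partial>lborel) \<partial>lborel)"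
proof -
  let ?A = "{x. 0 \<le> x \<bullet> z \<and> x \<bullet> z < z \<bullet> z}"
  have [measurable]: "?A \<in> sets borel" by measurable
  have zz: "0 < z \<bullet> z" using z by simp
  have "(\<integral>\<^sup>+x. indicator ?A x * (\<integral>\<^sup>+(s::real). G (x + s *\<^sub>R z) \<partial>lborel) \<partial>lborel)
      = (\<integral>\<^sup>+x. \<integral>\<^sup>+(s::real). indicator ?A x * G (x + s *\<^sub>R z) \<partial>lborel \<partial>lborel)"
    by (simp add: nn_integral_cmult)
  also have "\<dots> = (\<integral>\<^sup>+(s::real). \<integral>\<^sup>+x. indicator ?A x * G (x + s *\<^sub>R z) \<partial>lborel \<partial>lborel)"
    by (rule nn_integral_lborel_swap) measurable
  also have "\<dots> = (\<integral>\<^sup>+(s::real). \<integral>\<^sup>+x. indicator ?A (x - s *\<^sub>R z) * G x \<partial>lborel \<partial>lborel)"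
  proof (rule nn_integral_cong)
    fix s :: real
    show "(\<integral>\<^sup>+x. indicator ?A x * G (x + s *\<^sub>R z) \<partial>lborel) = (\<integral>\<^sup>+x. indicator ?A (x - s *\<^sub>R z) * G x \<partial>lborel)"
      by (subst nn_integral_lborel_affine[where c = 1 and t = "- s *\<^sub>R z"]) (auto simp: add.commute)
  qed
  also have "\<dots> = (\<integral>\<^sup>+x. \<integral>\<^sup>+(s::real). indicator ?A (x - s *\<^sub>R z) * G x \<partial>lborel \<partial>lborel)"
    by (rule nn_integral_lborel_swap) measurable
  also have "\<dots> = (\<integral>\<^sup>+x. (\<integral>\<^sup>+(s::real). indicator ?A (x - s *\<^sub>R z) \<partial>lborel) * G x \<partial>lborel)"
    by (simp add: nn_integral_multc)
  also have "\<dots> = (\<integral>\<^sup>+x. G x \<partial>lborel)"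
  proof (rule nn_integral_cong)
    fix x
    let ?b = "x \<bullet> z / (z \<bullet> z)"
    have "indicator ?A (x - s *\<^sub>R z) = (indicator {?b - 1 <.. ?b} s :: ennreal)" for s
      using zz by (auto simp: inner_diff_left field_simps split: split_indicator)
    then show "(\<integral>\<^sup>+(s::real). indicator ?A (x - s *\<^sub>R z) \<partial>lborel) * G x = G x" by simp
  qed
  finally show ?thesis by simp
qed

text \<open>The last assumption is all that is used of the bound on the second derivatives.\<close>

locale horizon =
  fixes \<Omega> :: "'a::euclidean_space set" and e :: "'a \<Rightarrow> real" and e' :: "'a \<Rightarrow> 'a" and K :: real
  assumes open_domain: "open \<Omega>" and bounded_domain: "bounded \<Omega>"
    and pos: "x \<in> \<Omega> \<Longrightarrow> 0 < e x" and le_1: "x \<in> \<Omega> \<Longrightarrow> e x \<le> 1"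
    and gradient: "x \<in> \<Omega> \<Longrightarrow> (e has_derivative (\<lambda>v. e' x \<bullet> v)) (at x)"
    and gradient_continuous: "continuous_on \<Omega> e'"
    and gradient_le: "x \<in> \<Omega> \<Longrightarrow> norm (e' x) \<le> 1/3"
    and reach: "x \<in> \<Omega> \<Longrightarrow> norm (y - x) \<le> e x \<Longrightarrow> y \<in> \<Omega>"
    and K_nonneg: "0 \<le> K"
    and second_order: "x \<in> \<Omega> \<Longrightarrow> norm z \<le> 1 \<Longrightarrow>
      e (x + e x *\<^sub>R z) \<le> e x + e x * (e' x \<bullet> z) + K * (e x)\<^sup>2 * (norm z)\<^sup>2"
begin

lemma domain_measurable[measurable]: "\<Omega> \<in> sets borel"
  using open_domain by auto

lemma continuous_horizon: "continuous_on \<Omega> e"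
  using gradient by (meson continuous_at_imp_continuous_on has_derivative_continuous)

text \<open>Outside \<open>\<Omega>\<close> nothing is known about \<open>e\<close>, so only the
  cut-off function is measurable. This is why \<open>e x\<close> is replaced by
  \<open>indicator \<Omega> x * e x\<close> wherever measurability is at stake.\<close>

lemma horizon_measurable[measurable]: "(\<lambda>x. indicator \<Omega> x * e x) \<in> borel_measurable borel"
  using borel_measurable_continuous_on_indicator[OF domain_measurable continuous_horizon] by simp

lemma gradient_measurable[measurable]: "(\<lambda>x. indicator \<Omega> x *\<^sub>R e' x) \<in> borel_measurable borel"
  using borel_measurable_continuous_on_indicator[OF domain_measurable gradient_continuous] by simp

text \<open>The gradient bound integrates along segments, but \<open>\<Omega>\<close> is not convex.
  The ball of radius \<open>e x\<close> is, and by \<open>reach\<close> it lies in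
  \<open>\<Omega>\<close>; hence the restriction to nearby \<open>y\<close>.\<close>

lemma lipschitz:
  assumes "x \<in> \<Omega>" "norm (y - x) \<le> e x"
  shows "\<bar>e y - e x\<bar> \<le> norm (y - x) / 3"
proof -
  have sub: "cball x (e x) \<subseteq> \<Omega>"
    using reach[OF assms(1)] by (auto simp: dist_norm norm_minus_commute)
  have "norm (e y - e x) \<le> 1/3 * norm (y - x)"
  proof (rule differentiable_bound[of "cball x (e x)" e "\<lambda>u v. e' u \<bullet> v"])
    fix u assume "u \<in> cball x (e x)"
    then have u: "u \<in> \<Omega>" using sub by auto
    show "(e has_derivative (\<lambda>v. e' u \<bullet> v)) (at u within cball x (e x))"
      using gradient[OF u] by (rule has_derivative_at_withinI)
    show "onorm (\<lambda>v. e' u \<bullet> v) \<le> 1/3"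
    proof (rule onorm_le)
      fix v
      have "norm (e' u \<bullet> v) \<le> norm (e' u) * norm v" using Cauchy_Schwarz_ineq2[of "e' u" v] by simp
      also have "\<dots> \<le> 1/3 * norm v" using gradient_le[OF u] by (intro mult_right_mono) auto
      finally show "norm (e' u \<bullet> v) \<le> 1/3 * norm v" .
    qed
  qed (use assms pos[OF assms(1)] in \<open>auto simp: dist_norm norm_minus_commute\<close>)
  then show ?thesis by simp
qed

lemma jump_in_domain:
  assumes "x \<in> \<Omega>" "norm z \<le> 1"
  shows "x + e x *\<^sub>R z \<in> \<Omega>"
proof (rule reach[OF assms(1)])
  show "norm (x + e x *\<^sub>R z - x) \<le> e x"
    using pos[OF assms(1)] assms(2) mult_left_mono[of "norm z" 1 "e x"] by simp
qed

lemma jacobian_bounds: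
  assumes "x \<in> \<Omega>" "norm z \<le> 1"
  shows "2/3 \<le> 1 + e' x \<bullet> z"
proof -
  have "\<bar>e' x \<bullet> z\<bar> \<le> norm (e' x) * norm z" by (rule Cauchy_Schwarz_ineq2)
  also have "\<dots> \<le> 1/3 * 1" using assms gradient_le by (intro mult_mono) auto
  finally show ?thesis by linarith
qed

lemma nn_integral_jump_le:
  fixes F :: "'a \<Rightarrow> real"
  assumes [measurable]: "F \<in> borel_measurable borel" and F: "\<And>x. 0 \<le> F x" and z: "norm z \<le> 1"
  shows "(\<integral>\<^sup>+x. ennreal ((1 + e' x \<bullet> z) * F (x + e x *\<^sub>R z)) * indicator \<Omega> x \<partial>lborel)
    \<le> (\<integral>\<^sup>+x. ennreal (F x) * indicator \<Omega> x \<partial>lborel)"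
proof (cases "z = 0")
  case False
  let ?A = "{x. 0 \<le> x \<bullet> z \<and> x \<bullet> z < z \<bullet> z}"
  let ?L = "\<lambda>x. ennreal ((1 + e' x \<bullet> z) * F (x + e x *\<^sub>R z)) * indicator \<Omega> x"
  have "?L = (\<lambda>x. ennreal ((1 + (indicator \<Omega> x *\<^sub>R e' x) \<bullet> z) * F (x + (indicator \<Omega> x * e x) *\<^sub>R z)) * indicator \<Omega> x)"
    by (auto split: split_indicator)
  also have "\<dots> \<in> borel_measurable borel" by measurable
  finally have L[measurable]: "?L \<in> borel_measurable borel" .
  have line: "(\<integral>\<^sup>+(s::real). ?L (x + s *\<^sub>R z) \<partial>lborel)
      \<le> (\<integral>\<^sup>+(s::real). ennreal (F (x + s *\<^sub>R z)) * indicator \<Omega> (x + s *\<^sub>R z) \<partial>lborel)" for x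
  proof -
    let ?S = "{s::real. x + s *\<^sub>R z \<in> \<Omega>}"
    define g where "g s = s + e (x + s *\<^sub>R z)" for s :: real
    define g' where "g' s = 1 + e' (x + s *\<^sub>R z) \<bullet> z" for s :: real
    have "open ((\<lambda>s::real. x + s *\<^sub>R z) -` \<Omega>)"
      by (intro open_vimage open_domain continuous_intros)
    then have openS: "open ?S" by (simp add: vimage_def)
    have step: "x + g s *\<^sub>R z = (x + s *\<^sub>R z) + e (x + s *\<^sub>R z) *\<^sub>R z" for s
      by (simp add: g_def algebra_simps)
    have "(\<integral>\<^sup>+s. ennreal (g' s * F (x + g s *\<^sub>R z)) * indicator ?S s \<partial>lborel)
      \<le> (\<integral>\<^sup>+s. ennreal (F (x + s *\<^sub>R z)) * indicator ?S s \<partial>lborel)"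
    proof (rule nn_integral_inj_substitution_le[OF openS, where F = "\<lambda>s. F (x + s *\<^sub>R z)"])
      show "(g has_real_derivative g' s) (at s)" if "s \<in> ?S" for s
      proof -
        have 1: "((\<lambda>s. x + s *\<^sub>R z) has_derivative (\<lambda>h. h *\<^sub>R z)) (at s)"
          by (auto intro!: derivative_eq_intros)
        have "((\<lambda>s. e (x + s *\<^sub>R z)) has_derivative (\<lambda>h. e' (x + s *\<^sub>R z) \<bullet> (h *\<^sub>R z))) (at s)"
          using has_derivative_compose[OF 1 gradient] that by simp
        then have "((\<lambda>s. e (x + s *\<^sub>R z)) has_real_derivative (e' (x + s *\<^sub>R z) \<bullet> z)) (at s)"
          by (simp add: has_field_derivative_def mult_commute_abs)
        then show ?thesis unfolding g_def g'_def by (auto intro!: derivative_eq_intros)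
      qed
      \<comment> \<open>Positivity of the derivative would not suffice, because the line may meet
        \<open>\<Omega>\<close> in several intervals. If two parameters had the same image, their
        distance would be a difference of two positive values of \<open>e\<close>, hence less than
        the value of \<open>e\<close> at the first point; then the Lipschitz bound with constant 1/3
        applies and contradicts that equality.\<close>
      show "inj_on g ?S"
      proof (rule linorder_inj_onI)
        fix s t :: real
        assume st: "s < t" "s \<in> ?S" "t \<in> ?S"
        show "g s \<noteq> g t"
        proof
          assume eq: "g s = g t"
          have d: "norm ((x + t *\<^sub>R z) - (x + s *\<^sub>R z)) = (t - s) * norm z"
            using st by (simp add: algebra_simps flip: scaleR_diff_left)
          have "(t - s) * norm z \<le> (t - s) * 1"
            using st z by (intro mult_left_mono) auto
          then have near: "norm ((x + t *\<^sub>R z) - (x + s *\<^sub>R z)) \<le> t - s"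
            unfolding d by simp
          have diff: "t - s = e (x + s *\<^sub>R z) - e (x + t *\<^sub>R z)" using eq by (simp add: g_def)
          also have "\<dots> < e (x + s *\<^sub>R z)" using pos st by simp
          finally have lt: "t - s < e (x + s *\<^sub>R z)" .
          have "\<bar>e (x + t *\<^sub>R z) - e (x + s *\<^sub>R z)\<bar> \<le> norm ((x + t *\<^sub>R z) - (x + s *\<^sub>R z)) / 3"
            using st(2) near lt by (intro lipschitz) auto
          also have "\<dots> \<le> (t - s) / 3" using near by simp
          finally have "\<bar>s - t\<bar> \<le> (t - s) / 3" using diff by (simp add: abs_if split: if_splits)
          then show False using \<open>s < t\<close> by simp
        qed
      qed auto
      show "g ` ?S \<subseteq> ?S"
      proof safe
        fix s assume "x + s *\<^sub>R z \<in> \<Omega>"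
        then show "x + g s *\<^sub>R z \<in> \<Omega>" unfolding step by (rule jump_in_domain[OF _ z])
      qed
      show "0 \<le> g' s" if "s \<in> ?S" for s
        using jacobian_bounds[OF _ z, of "x + s *\<^sub>R z"] that by (simp add: g'_def)
    qed (use F in auto)
    then show ?thesis
      by (simp add: step g'_def indicator_def)
  qed
  have "(\<integral>\<^sup>+x. ?L x \<partial>lborel) = (\<integral>\<^sup>+x. indicator ?A x * (\<integral>\<^sup>+(s::real). ?L (x + s *\<^sub>R z) \<partial>lborel) \<partial>lborel)"
    using False by (rule nn_integral_lines[OF L])
  also have "\<dots> \<le> (\<integral>\<^sup>+x. indicator ?A x
      * (\<integral>\<^sup>+(s::real). ennreal (F (x + s *\<^sub>R z)) * indicator \<Omega> (x + s *\<^sub>R z) \<partial>lborel) \<partial>lborel)"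
    by (intro nn_integral_mono mult_left_mono line) auto
  also have "\<dots> = (\<integral>\<^sup>+x. ennreal (F x) * indicator \<Omega> x \<partial>lborel)"
    using False by (intro nn_integral_lines[symmetric]) auto
  finally show ?thesis .
qed simp

end

section \<open>Elementary estimates for a single jump and a single increment\<close>

lemma emeasure_lborel_cball_pos: "0 < r \<Longrightarrow> 0 < emeasure lborel (cball (a::'a::euclidean_space) r)"
  by (simp add: emeasure_cball unit_ball_vol_pos ennreal_zero_less_mult_iff zero_less_iff_neq_zero[symmetric])

text \<open>This number is the factor in front of the squared \<open>L2\<close> norm after the
  directional inequality has been integrated over \<open>z\<close>. It has to be finite and positive
  to be divided out, and it depends only on the dimension and on \<open>r\<close>.\<close>

lemma ball_second_moment:
  assumes r: "0 < r"
  shows "\<exists>m>0. (\<integral>\<^sup>+z. ennreal ((norm z)\<^sup>2) * indicator (cball (0::'a::euclidean_space) r) z \<partial>lborel) = ennreal m"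
proof -
  have [measurable]: "cball (0::'a) r \<in> sets borel" by simp
  let ?I = "\<integral>\<^sup>+z. ennreal ((norm z)\<^sup>2) * indicator (cball (0::'a) r) z \<partial>lborel"
  have "?I \<le> (\<integral>\<^sup>+z. ennreal (r\<^sup>2) * indicator (cball (0::'a) r) z \<partial>lborel)"
    by (intro nn_integral_mono) (auto intro!: ennreal_leI power_mono split: split_indicator)
  also have "\<dots> = ennreal (r\<^sup>2) * emeasure lborel (cball (0::'a) r)"
    by (rule nn_integral_cmult_indicator) simp
  also have "\<dots> < \<infinity>"
    using emeasure_lborel_cball_finite[of "0::'a" r] by (auto simp: ennreal_mult_less_top)
  finally have fin: "?I < \<infinity>" .
  have "?I \<noteq> 0"
  proof
    assume "?I = 0"
    then have "AE z in lborel. ennreal ((norm z)\<^sup>2) * indicator (cball (0::'a) r) z = 0"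
      by (subst (asm) nn_integral_0_iff_AE) auto
    moreover have "AE z in lborel. z \<noteq> (0::'a)" by (rule AE_lborel_singleton)
    ultimately have "AE z in lborel. z \<notin> cball (0::'a) r"
      by eventually_elim (auto split: split_indicator_asm)
    then have "emeasure lborel (cball (0::'a) r) = 0"
      by (subst (asm) AE_iff_measurable[OF _ refl]) (auto simp: cball_def)
    then show False using emeasure_lborel_cball_pos[OF r, of "0::'a"] by simp
  qed
  then show ?thesis
    using fin by (intro exI[of _ "enn2real ?I"]) (auto simp: enn2real_positive_iff zero_less_iff_neq_zero)
qed

text \<open>Dictionary for a jump from \<open>x\<close> to \<open>y\<close>: \<open>e\<close>,
  \<open>e1\<close> are the horizons, \<open>a\<close> is the Jacobian, \<open>h = |z|\<close>,
  \<open>l\<close>, \<open>l1\<close> are the weights and \<open>q\<close>, \<open>p\<close> the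
  values of the function at \<open>x\<close> and \<open>y\<close>. The growth of the weight yields
  \<open>h^2/2 * p^2\<close>. Half of this is spent on replacing \<open>p\<close> by
  \<open>q\<close> in the term with \<open>l\<close>, the other half produces
  \<open>h^2/8 * q^2\<close>; both exchanges cost a multiple of the squared difference
  quotient.\<close>

lemma poincare_pointwise:
  fixes e e1 a K M h l l1 p q :: real
  assumes e: "0 < e" "e \<le> 1" and a: "2/3 \<le> a" and e1: "0 < e1" "e1 \<le> e * a + K * e\<^sup>2 * h\<^sup>2"
    and K: "0 \<le> K" and h: "0 \<le> h" "h \<le> 1" and M: "0 < M" "6 * K * M * h \<le> 1"
    and l: "0 \<le> l" "l \<le> 2 * M * h" and l1: "l1 = l + e * h\<^sup>2" "l1 \<le> 2 * M * h"
  shows "l * q\<^sup>2 / e + h\<^sup>2 / 8 * q\<^sup>2 \<le> a * (l1 * p\<^sup>2 / e1) + (2 * M + 16 * M\<^sup>2 + 1) * ((q - p)\<^sup>2 / e\<^sup>2)"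
proof -
  have l1_nonneg: "0 \<le> l1" using l l1 e by simp
  \<comment> \<open>Chosen so that \<open>a \<ge> 2/3\<close> turns the bound for \<open>e1\<close>
    into the product \<open>e * a * (1 + t)\<close>; its reciprocal is then handled by
    \<open>1 - t \<le> 1/(1 + t)\<close>.\<close>
  define t where "t = 3/2 * K * e * h\<^sup>2"
  have t: "0 \<le> t" using K e h by (simp add: t_def)
  have "K * e\<^sup>2 * h\<^sup>2 = 2/3 * (e * t)" by (simp add: t_def power2_eq_square)
  also have "\<dots> \<le> a * (e * t)" using a e t by (intro mult_right_mono) auto
  finally have e1_le: "e1 \<le> e * a * (1 + t)" using e1 by (simp add: algebra_simps)
  have "1 - t \<le> 1 / (1 + t)" using t by (simp add: field_simps)
  then have "(1 - t) / e \<le> (1 / (1 + t)) / e" using e by (intro divide_right_mono) auto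
  also have "\<dots> = a / (e * a * (1 + t))" using a by (simp add: mult.commute)
  also have "\<dots> \<le> a / e1" using a e1 e1_le by (intro divide_left_mono) auto
  finally have ratio: "1 / e - 3/2 * K * h\<^sup>2 \<le> a / e1"
    using e by (simp add: t_def diff_divide_distrib)
  \<comment> \<open>The error of the horizon ratio is quadratic in \<open>h\<close> and the weight
    is linear in \<open>h\<close>, so their product is cubic; \<open>6 * K * M * h \<le> 1\<close>
    reduces it to half of the gain \<open>h^2\<close>.\<close>
  have "l1 * (3 * K * h\<^sup>2) \<le> (2 * M * h) * (3 * K * h\<^sup>2)"
    using l1 K by (intro mult_right_mono) auto
  also have "\<dots> = (6 * K * M * h) * h\<^sup>2" by (simp add: algebra_simps)
  also have "\<dots> \<le> 1 * h\<^sup>2" using M by (intro mult_right_mono) auto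
  finally have small: "l1 * (3/2 * K * h\<^sup>2) \<le> h\<^sup>2 / 2" by (simp add: field_simps)
  have "l / e + h\<^sup>2 / 2 \<le> l / e + h\<^sup>2 - l1 * (3/2 * K * h\<^sup>2)" using small by simp
  also have "\<dots> = l1 * (1 / e - 3/2 * K * h\<^sup>2)"
    using e by (simp add: l1 field_simps)
  also have "\<dots> \<le> l1 * (a / e1)" by (intro mult_left_mono ratio l1_nonneg)
  finally have "(l / e + h\<^sup>2 / 2) * p\<^sup>2 \<le> l1 * (a / e1) * p\<^sup>2" by (intro mult_right_mono) auto
  then have A: "l / e * p\<^sup>2 + h\<^sup>2 / 2 * p\<^sup>2 \<le> a * (l1 * p\<^sup>2 / e1)" by (simp add: algebra_simps)
  define D where "D = (q - p) / e"
  have q: "q = p + e * D" using e by (simp add: D_def)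
  have D2: "(q - p)\<^sup>2 / e\<^sup>2 = D\<^sup>2" by (simp add: D_def power_divide)
  have "l / e * q\<^sup>2 - l / e * p\<^sup>2 = l * (2 * p * D) + l * (e * D\<^sup>2)"
    using e by (simp add: q field_simps power2_eq_square)
  also have "\<dots> \<le> (h\<^sup>2 / 4 * p\<^sup>2 + 16 * M\<^sup>2 * D\<^sup>2) + 2 * M * D\<^sup>2"
  proof (intro add_mono)
    have "l * (2 * p * D) \<le> l * (2 * (\<bar>p\<bar> * \<bar>D\<bar>))"
      using l by (intro mult_left_mono) (auto simp: abs_mult[symmetric])
    also have "\<dots> \<le> (2 * M * h) * (2 * (\<bar>p\<bar> * \<bar>D\<bar>))" using l by (intro mult_right_mono) auto
    \<comment> \<open>Young's inequality, with factors balanced so that exactly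
      \<open>h^2/4 * p^2\<close> is used up.\<close>
    also have "\<dots> = 2 * (h * \<bar>p\<bar> / 2) * (4 * M * \<bar>D\<bar>)" by simp
    also have "\<dots> \<le> (h * \<bar>p\<bar> / 2)\<^sup>2 + (4 * M * \<bar>D\<bar>)\<^sup>2" by (rule sum_squares_bound)
    also have "\<dots> = h\<^sup>2 / 4 * p\<^sup>2 + 16 * M\<^sup>2 * D\<^sup>2" by (simp add: power_mult_distrib power_divide)
    finally show "l * (2 * p * D) \<le> h\<^sup>2 / 4 * p\<^sup>2 + 16 * M\<^sup>2 * D\<^sup>2" .
    have "l * (e * D\<^sup>2) \<le> (2 * M * 1) * (1 * D\<^sup>2)"
    proof (intro mult_mono)
      show "l \<le> 2 * M * 1" using l h M mult_left_mono[of h 1 "2 * M"] by linarith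
    qed (use e l M in auto)
    then show "l * (e * D\<^sup>2) \<le> 2 * M * D\<^sup>2" by simp
  qed
  finally have B: "l / e * q\<^sup>2 \<le> l / e * p\<^sup>2 + h\<^sup>2 / 4 * p\<^sup>2 + (2 * M + 16 * M\<^sup>2) * D\<^sup>2"
    by (simp add: algebra_simps)
  have "q\<^sup>2 \<le> 2 * p\<^sup>2 + 2 * (e * D)\<^sup>2" unfolding q by (rule square_sum_le)
  then have "h\<^sup>2 / 8 * q\<^sup>2 \<le> h\<^sup>2 / 8 * (2 * p\<^sup>2 + 2 * (e * D)\<^sup>2)" by (intro mult_left_mono) auto
  also have "\<dots> = h\<^sup>2 / 4 * p\<^sup>2 + (h\<^sup>2 * e\<^sup>2 / 4) * D\<^sup>2" by (simp add: power_mult_distrib algebra_simps)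
  also have "\<dots> \<le> h\<^sup>2 / 4 * p\<^sup>2 + 1 * D\<^sup>2"
  proof (intro add_left_mono mult_right_mono)
    have "h\<^sup>2 * e\<^sup>2 \<le> 1 * 1" using h e by (intro mult_mono power_le_one) auto
    then show "h\<^sup>2 * e\<^sup>2 / 4 \<le> 1" by simp
  qed simp
  finally have C: "h\<^sup>2 / 8 * q\<^sup>2 \<le> h\<^sup>2 / 4 * p\<^sup>2 + D\<^sup>2" by simp
  show ?thesis using A B C unfolding D2 by (simp add: algebra_simps)
qed

text \<open>The increment \<open>c\<close> is the mean over \<open>[0,1]\<close> of the derivative
  \<open>h\<close> along the segment, and the integral of \<open>(h - c)^2\<close> is nonnegative,
  so \<open>c^2\<close> is at most the mean of \<open>h^2\<close>. The bound is kept as an integral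
  over \<open>t\<close> so that it can be exchanged with the integral over \<open>x\<close>.\<close>

lemma increment_square_le:
  fixes \<phi> :: "'a::euclidean_space \<Rightarrow> real" and g :: "'a \<Rightarrow> 'a"
  assumes \<phi>: "\<And>x. (\<phi> has_derivative (\<lambda>v. g x \<bullet> v)) (at x)" and g: "continuous_on UNIV g"
  shows "ennreal ((\<phi> (x + w) - \<phi> x)\<^sup>2)
    \<le> ennreal ((norm w)\<^sup>2) * (\<integral>\<^sup>+t. ennreal ((norm (g (x + t *\<^sub>R w)))\<^sup>2) * indicator {0..1::real} t \<partial>lborel)"
proof -
  define h where "h t = g (x + t *\<^sub>R w) \<bullet> w" for t :: real
  define c where "c = \<phi> (x + w) - \<phi> x"
  have cont_g: "continuous_on T (\<lambda>t. g (x + t *\<^sub>R w))" for T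
    by (rule continuous_on_compose2[OF g]) (auto intro!: continuous_intros)
  have cont_h: "continuous_on T h" for T unfolding h_def by (intro continuous_intros cont_g)
  have "(h has_integral (\<phi> (x + 1 *\<^sub>R w) - \<phi> (x + 0 *\<^sub>R w))) {0..1}"
  proof (rule fundamental_theorem_of_calculus)
    fix t :: real
    have 1: "((\<lambda>s. x + s *\<^sub>R w) has_derivative (\<lambda>s. s *\<^sub>R w)) (at t within {0..1})"
      by (auto intro!: derivative_eq_intros)
    have "((\<lambda>s. \<phi> (x + s *\<^sub>R w)) has_derivative (\<lambda>s. g (x + t *\<^sub>R w) \<bullet> (s *\<^sub>R w))) (at t within {0..1})"
      using has_derivative_compose[OF 1 \<phi>] by simp
    then show "((\<lambda>s. \<phi> (x + s *\<^sub>R w)) has_vector_derivative h t) (at t within {0..1})"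
      by (simp add: has_vector_derivative_def h_def)
  qed simp
  then have h: "(h has_integral c) {0..1}" by (simp add: c_def)
  have h2: "(\<lambda>t. (h t)\<^sup>2) integrable_on {0..1}" and n2: "(\<lambda>t. (norm (g (x + t *\<^sub>R w)))\<^sup>2) integrable_on {0..1}"
    by (auto intro!: integrable_continuous_real continuous_intros cont_h cont_g)
  let ?N = "integral {0..1} (\<lambda>t. (norm (g (x + t *\<^sub>R w)))\<^sup>2)"
  have "((\<lambda>t. (h t)\<^sup>2 - 2 * c * h t + c\<^sup>2) has_integral (integral {0..1} (\<lambda>t. (h t)\<^sup>2) - 2 * c * c + c\<^sup>2)) {0..1}"
    using has_integral_add[OF has_integral_diff[OF integrable_integral[OF h2] has_integral_mult_right[OF h, of "2 * c"]]
      has_integral_const_real[of "c\<^sup>2" 0 1]] by simp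
  then have "0 \<le> integral {0..1} (\<lambda>t. (h t)\<^sup>2) - 2 * c * c + c\<^sup>2"
  proof (rule has_integral_nonneg)
    fix t
    have "(h t)\<^sup>2 - 2 * c * h t + c\<^sup>2 = (h t - c)\<^sup>2" by (simp add: power2_diff)
    then show "0 \<le> (h t)\<^sup>2 - 2 * c * h t + c\<^sup>2" by simp
  qed
  then have "c\<^sup>2 \<le> integral {0..1} (\<lambda>t. (h t)\<^sup>2)" by (simp add: power2_eq_square)
  also have "\<dots> \<le> integral {0..1} (\<lambda>t. (norm w)\<^sup>2 * (norm (g (x + t *\<^sub>R w)))\<^sup>2)"
  proof (rule integral_le[OF h2])
    fix t
    have "\<bar>h t\<bar> \<le> norm (g (x + t *\<^sub>R w)) * norm w" unfolding h_def by (rule Cauchy_Schwarz_ineq2)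
    then have "\<bar>h t\<bar>\<^sup>2 \<le> (norm (g (x + t *\<^sub>R w)) * norm w)\<^sup>2" by (rule power_mono) simp
    then show "(h t)\<^sup>2 \<le> (norm w)\<^sup>2 * (norm (g (x + t *\<^sub>R w)))\<^sup>2" by (simp add: power_mult_distrib mult.commute)
  qed (auto intro!: integrable_continuous_real continuous_intros cont_g)
  finally have "c\<^sup>2 \<le> (norm w)\<^sup>2 * ?N" by simp
  then have "ennreal (c\<^sup>2) \<le> ennreal ((norm w)\<^sup>2) * ennreal ?N"
    by (simp add: ennreal_mult[symmetric] integral_nonneg[OF n2] ennreal_leI)
  also have "ennreal ?N = (\<integral>\<^sup>+t. ennreal ((norm (g (x + t *\<^sub>R w)))\<^sup>2) * indicator {0..1::real} t \<partial>lborel)"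
    using n2 by (intro nn_integral_has_integral_lebesgue'[symmetric]) (auto simp: has_integral_integral)
  finally show ?thesis by (simp add: c_def)
qed

text \<open>The cost of halving the jumps once: 2 from \<open>(a + b)^2 \<le> 2 a^2 + 2 b^2\<close>,
  a power \<open>2^d\<close> from taking the midpoint as integration variable, and 1 or
  \<open>2^(d+2)\<close> from comparing kernels on the first or second half of the jump.\<close>

definition shrink_constant :: "'b::euclidean_space itself \<Rightarrow> real" where
  "shrink_constant _ = 2 * 2 ^ DIM('b) * (1 + 2 ^ (DIM('b) + 2))"

section \<open>The jump energy: change of horizon, Poincare inequality, gradient bound\<close>

context horizon
begin

text \<open>The kernel of the seminorm, set to zero when the first point is outside
  \<open>\<Omega>\<close>, so that integrals run over the whole space and affine substitutions are
  free. The second point is left unrestricted; for \<open>r \<le> 1\<close> it lies in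
  \<open>\<Omega>\<close> anyway.\<close>

definition jump_kernel :: "real \<Rightarrow> 'a \<Rightarrow> 'a \<Rightarrow> real" where
  "jump_kernel r x y = (if x \<in> \<Omega> \<and> norm (y - x) \<le> r * e x then 1 / e x ^ (DIM('a) + 2) else 0)"

definition jump_energy :: "real \<Rightarrow> ('a \<Rightarrow> real) \<Rightarrow> ennreal" where
  "jump_energy r u = (\<integral>\<^sup>+x. (\<integral>\<^sup>+y. ennreal (jump_kernel r x y * (u x - u y)\<^sup>2) \<partial>lborel) \<partial>lborel)"

lemma jump_kernel_nonneg: "0 \<le> jump_kernel r x y"
  using pos[of x] by (auto simp: jump_kernel_def simp del: add_2_eq_Suc')

lemma jump_kernel_mono:
  assumes "r \<le> s"
  shows "jump_kernel r x y \<le> jump_kernel s x y"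
proof -
  have "norm (y - x) \<le> s * e x" if "x \<in> \<Omega>" "norm (y - x) \<le> r * e x"
    using that(2) pos[OF that(1)] assms by (elim order_trans) (intro mult_right_mono, auto)
  then show ?thesis
    using pos[of x] by (auto simp: jump_kernel_def simp del: add_2_eq_Suc')
qed

lemma jump_kernel_measurable: "(\<lambda>p. jump_kernel r (fst p) (snd p)) \<in> borel_measurable (borel \<Otimes>\<^sub>M borel)"
proof -
  have "(\<lambda>p. jump_kernel r (fst p) (snd p)) = (\<lambda>p. if fst p \<in> \<Omega> \<and>
      norm (snd p - fst p) \<le> r * (indicator \<Omega> (fst p) * e (fst p))
      then 1 / (indicator \<Omega> (fst p) * e (fst p)) ^ (DIM('a) + 2) else 0)"
    by (simp add: fun_eq_iff jump_kernel_def indicator_def)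
  also have "\<dots> \<in> borel_measurable (borel \<Otimes>\<^sub>M borel)" by measurable
  finally show ?thesis .
qed

lemma jump_kernel_compose_measurable[measurable (raw)]:
  assumes [measurable]: "f \<in> borel_measurable M" "g \<in> borel_measurable M"
  shows "(\<lambda>p. jump_kernel r (f p) (g p)) \<in> borel_measurable M"
proof -
  have "(\<lambda>p. (f p, g p)) \<in> M \<rightarrow>\<^sub>M borel \<Otimes>\<^sub>M borel" by measurable
  from measurable_compose[OF this jump_kernel_measurable] show ?thesis by simp
qed

lemma jump_energy_mono: "r \<le> s \<Longrightarrow> jump_energy r u \<le> jump_energy s u"
  unfolding jump_energy_def
  by (intro nn_integral_mono ennreal_leI mult_right_mono jump_kernel_mono) auto

text \<open>Substituting \<open>y = x + e x *\<^sub>R z\<close> moves the variable horizon into the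
  integrand: \<open>z\<close> ranges over a fixed ball, and of the power \<open>d + 2\<close> in the
  kernel only the square of the difference quotient remains.\<close>

lemma jump_energy_polar:
  assumes [measurable]: "u \<in> borel_measurable borel"
  shows "jump_energy r u = (\<integral>\<^sup>+x. (\<integral>\<^sup>+z. ennreal ((u x - u (x + e x *\<^sub>R z))\<^sup>2 / (e x)\<^sup>2)
    * indicator (cball 0 r) z \<partial>lborel) * indicator \<Omega> x \<partial>lborel)"
  unfolding jump_energy_def
proof (rule nn_integral_cong)
  fix x
  show "(\<integral>\<^sup>+y. ennreal (jump_kernel r x y * (u x - u y)\<^sup>2) \<partial>lborel)
    = (\<integral>\<^sup>+z. ennreal ((u x - u (x + e x *\<^sub>R z))\<^sup>2 / (e x)\<^sup>2) * indicator (cball 0 r) z \<partial>lborel) * indicator \<Omega> x"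
  proof (cases "x \<in> \<Omega>")
    case True
    note ex = pos[OF True]
    have "(\<integral>\<^sup>+y. ennreal (jump_kernel r x y * (u x - u y)\<^sup>2) \<partial>lborel)
      = ennreal (\<bar>e x\<bar> ^ DIM('a)) * (\<integral>\<^sup>+z. ennreal (jump_kernel r x (x + e x *\<^sub>R z) * (u x - u (x + e x *\<^sub>R z))\<^sup>2) \<partial>lborel)"
      using ex by (intro nn_integral_lborel_affine) auto
    also have "\<dots> = (\<integral>\<^sup>+z. ennreal (e x ^ DIM('a)) * ennreal (jump_kernel r x (x + e x *\<^sub>R z) * (u x - u (x + e x *\<^sub>R z))\<^sup>2) \<partial>lborel)"
      using ex by (simp add: nn_integral_cmult)
    also have "\<dots> = (\<integral>\<^sup>+z. ennreal ((u x - u (x + e x *\<^sub>R z))\<^sup>2 / (e x)\<^sup>2) * indicator (cball 0 r) z \<partial>lborel)"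
    proof (rule nn_integral_cong)
      fix z :: 'a
      have "norm (x + e x *\<^sub>R z - x) \<le> r * e x \<longleftrightarrow> z \<in> cball 0 r"
        using ex by (simp add: mult.commute)
      then show "ennreal (e x ^ DIM('a)) * ennreal (jump_kernel r x (x + e x *\<^sub>R z) * (u x - u (x + e x *\<^sub>R z))\<^sup>2)
        = ennreal ((u x - u (x + e x *\<^sub>R z))\<^sup>2 / (e x)\<^sup>2) * indicator (cball 0 r) z"
        using True ex unfolding jump_kernel_def
        by (simp add: ennreal_mult[symmetric] power_add power2_eq_square split: split_indicator)
    qed
    finally show ?thesis using True by simp
  qed (simp add: jump_kernel_def)
qed

text \<open>The second half of the jump starts at \<open>m\<close>, where the horizon may be
  shorter: \<open>m\<close> has distance at most \<open>e x / 2\<close> from \<open>x\<close>, so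
  the Lipschitz constant 1/3 gives \<open>e m \<ge> 5/6 * e x\<close>. The factor 3/5 is 1/2 divided
  by 5/6. The crude bound \<open>e m \<le> 2 * e x\<close> accounts for the power of 2.\<close>

lemma jump_kernel_midpoint:
  assumes s: "0 < s" "s \<le> 1"
  shows "jump_kernel s x (- x + 2 *\<^sub>R m) \<le> jump_kernel (3/5 * s) x m"
    and "jump_kernel s (- y + 2 *\<^sub>R m) y \<le> 2 ^ (DIM('a) + 2) * jump_kernel (3/5 * s) m y"
proof -
  have "norm (m - x) \<le> 3/5 * s * e x" if "x \<in> \<Omega>" "norm (- x + 2 *\<^sub>R m - x) \<le> s * e x"
  proof -
    have "- x + 2 *\<^sub>R m - x = 2 *\<^sub>R (m - x)" by (simp add: algebra_simps scaleR_2)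
    then have "2 * norm (m - x) \<le> s * e x" using that by simp
    moreover have "0 < s * e x" using s pos[OF that(1)] by simp
    ultimately show ?thesis by simp
  qed
  then show "jump_kernel s x (- x + 2 *\<^sub>R m) \<le> jump_kernel (3/5 * s) x m"
    using pos[of x] by (auto simp: jump_kernel_def)
  show "jump_kernel s (- y + 2 *\<^sub>R m) y \<le> 2 ^ (DIM('a) + 2) * jump_kernel (3/5 * s) m y"
  proof (cases "- y + 2 *\<^sub>R m \<in> \<Omega> \<and> norm (y - (- y + 2 *\<^sub>R m)) \<le> s * e (- y + 2 *\<^sub>R m)")
    case True
    define x where "x = - y + 2 *\<^sub>R m"
    have x: "x \<in> \<Omega>" "norm (y - x) \<le> s * e x" using True by (simp_all add: x_def)
    note ex = pos[OF x(1)]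
    have "y - x = 2 *\<^sub>R (m - x)" "y - x = 2 *\<^sub>R (y - m)" by (simp_all add: x_def algebra_simps scaleR_2)
    then have n: "norm (m - x) = norm (y - x) / 2" "norm (y - m) = norm (y - x) / 2" by simp_all
    have "s * e x \<le> 1 * e x" using ex s by (intro mult_right_mono) auto
    then have half: "norm (m - x) \<le> e x / 2" using x n by simp
    then have m: "m \<in> \<Omega>" using ex by (intro reach[OF x(1)]) simp
    have "\<bar>e m - e x\<bar> \<le> e x / 6"
      using lipschitz[OF x(1), of m] half ex by simp
    from abs_le_D1[OF this] abs_le_D2[OF this] have em: "5/6 * e x \<le> e m" "e m \<le> 2 * e x"
      using ex by simp_all
    have "norm (y - m) \<le> s * e x / 2" using n x by simp
    also have "\<dots> = 3/5 * s * (5/6 * e x)" by simp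
    also have "\<dots> \<le> 3/5 * s * e m" using em s by (intro mult_left_mono) auto
    finally have near: "norm (y - m) \<le> 3/5 * s * e m" .
    have "e m ^ (DIM('a) + 2) \<le> (2 * e x) ^ (DIM('a) + 2)"
      using em pos[OF m] by (intro power_mono) auto
    then have "1 / e x ^ (DIM('a) + 2) \<le> 2 ^ (DIM('a) + 2) * (1 / e m ^ (DIM('a) + 2))"
      using ex pos[OF m] by (simp add: power_mult_distrib field_simps)
    moreover have "jump_kernel s x y = 1 / e x ^ (DIM('a) + 2)"
      unfolding jump_kernel_def using x by (simp only: if_True simp_thms)
    moreover have "jump_kernel (3/5 * s) m y = 1 / e m ^ (DIM('a) + 2)"
      unfolding jump_kernel_def using m near by (simp only: if_True simp_thms)
    ultimately show ?thesis unfolding x_def[symmetric] by (simp only:)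
  next
    case False
    then have "jump_kernel s (- y + 2 *\<^sub>R m) y = 0" unfolding jump_kernel_def by (simp only: if_False)
    then show ?thesis using jump_kernel_nonneg[of "3/5 * s" m y] by simp
  qed
qed

lemma jump_energy_shrink:
  assumes [measurable]: "u \<in> borel_measurable borel" and s: "0 < s" "s \<le> 1"
  shows "jump_energy s u \<le> ennreal (shrink_constant TYPE('a)) * jump_energy (3/5 * s) u"
proof -
  let ?m = "\<lambda>x y. (1/2) *\<^sub>R (x + y)" and ?d = "2 ^ DIM('a) :: real"
  let ?f = "\<lambda>x y. ennreal (jump_kernel s x y * (u x - u (?m x y))\<^sup>2)"
    and ?g = "\<lambda>x y. ennreal (jump_kernel s x y * (u (?m x y) - u y)\<^sup>2)"
    and ?h = "\<lambda>x y. ennreal (jump_kernel (3/5 * s) x y * (u x - u y)\<^sup>2)"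
  let ?J = "jump_energy (3/5 * s) u"
  have "jump_energy s u \<le> (\<integral>\<^sup>+x. (\<integral>\<^sup>+y. 2 * ?f x y
      + 2 * ?g x y \<partial>lborel) \<partial>lborel)"
    unfolding jump_energy_def
  proof (intro nn_integral_mono)
    fix x y
    have "jump_kernel s x y * (u x - u y)\<^sup>2
        \<le> jump_kernel s x y * (2 * (u x - u (?m x y))\<^sup>2 + 2 * (u (?m x y) - u y)\<^sup>2)"
      using square_sum_le[of "u x - u (?m x y)" "u (?m x y) - u y"]
      by (intro mult_left_mono jump_kernel_nonneg) simp
    then have "ennreal (jump_kernel s x y * (u x - u y)\<^sup>2)
        \<le> ennreal (2 * (jump_kernel s x y * (u x - u (?m x y))\<^sup>2) + 2 * (jump_kernel s x y * (u (?m x y) - u y)\<^sup>2))"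
      by (intro ennreal_leI) (simp add: algebra_simps)
    also have "\<dots> = 2 * ?f x y
      + 2 * ?g x y"
      using jump_kernel_nonneg[of s x y] by (simp add: ennreal_plus ennreal_mult)
    finally show "ennreal (jump_kernel s x y * (u x - u y)\<^sup>2)
      \<le> 2 * ?f x y
      + 2 * ?g x y" .
  qed
  also have "\<dots> = 2 * (\<integral>\<^sup>+x. (\<integral>\<^sup>+y. ?f x y \<partial>lborel) \<partial>lborel)
      + 2 * (\<integral>\<^sup>+x. (\<integral>\<^sup>+y. ?g x y \<partial>lborel) \<partial>lborel)"
    by (simp add: nn_integral_add nn_integral_cmult)
  also have "\<dots> \<le> 2 * (ennreal ?d * ?J) + 2 * (ennreal (?d * 2 ^ (DIM('a) + 2)) * ?J)"
  proof (intro add_mono mult_left_mono)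
    have "(\<integral>\<^sup>+y. ?f x y \<partial>lborel)
      \<le> ennreal ?d * (\<integral>\<^sup>+m. ?h x m \<partial>lborel)" for x
    proof -
      have "(\<integral>\<^sup>+y. ?f x y \<partial>lborel)
        = ennreal ?d * (\<integral>\<^sup>+m. ?f x (- x + 2 *\<^sub>R m) \<partial>lborel)"
        using nn_integral_lborel_affine[of "?f x" 2 "- x"] by simp
      also have "\<dots> \<le> ennreal ?d * (\<integral>\<^sup>+m. ?h x m \<partial>lborel)"
        using jump_kernel_midpoint(1)[OF s]
        by (intro mult_left_mono nn_integral_mono ennreal_leI) (auto intro!: mult_right_mono)
      finally show ?thesis .
    qed
    then have "(\<integral>\<^sup>+x. (\<integral>\<^sup>+y. ?f x y \<partial>lborel) \<partial>lborel)
      \<le> (\<integral>\<^sup>+x. ennreal ?d * (\<integral>\<^sup>+m. ?h x m \<partial>lborel) \<partial>lborel)"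
      by (intro nn_integral_mono) auto
    also have "\<dots> = ennreal ?d * ?J" by (simp add: jump_energy_def nn_integral_cmult)
    finally show "(\<integral>\<^sup>+x. (\<integral>\<^sup>+y. ?f x y \<partial>lborel) \<partial>lborel) \<le> ennreal ?d * ?J" .
  next
    \<comment> \<open>For the half that ends at \<open>y\<close> the roles change: \<open>y\<close>
      is held fixed and \<open>x\<close> is expressed through the midpoint, which requires
      exchanging the integrals first.\<close>
    have "(\<integral>\<^sup>+x. (\<integral>\<^sup>+y. ?g x y \<partial>lborel) \<partial>lborel)
      = (\<integral>\<^sup>+y. (\<integral>\<^sup>+x. ?g x y \<partial>lborel) \<partial>lborel)"
      by (rule nn_integral_lborel_swap) measurable
    also have "\<dots> \<le> (\<integral>\<^sup>+y. ennreal (?d * 2 ^ (DIM('a) + 2))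
        * (\<integral>\<^sup>+m. ?h m y \<partial>lborel) \<partial>lborel)"
    proof (rule nn_integral_mono)
      fix y
      have "(\<integral>\<^sup>+x. ?g x y \<partial>lborel)
        = ennreal ?d * (\<integral>\<^sup>+m. ?g (- y + 2 *\<^sub>R m) y \<partial>lborel)"
        using nn_integral_lborel_affine[of "\<lambda>x. ?g x y" 2 "- y"] by simp
      also have "\<dots> \<le> ennreal ?d * (\<integral>\<^sup>+m. ennreal (2 ^ (DIM('a) + 2)) * ?h m y \<partial>lborel)"
      proof (intro mult_left_mono nn_integral_mono)
        fix m
        have "jump_kernel s (- y + 2 *\<^sub>R m) y * (u (?m (- y + 2 *\<^sub>R m) y) - u y)\<^sup>2
          \<le> (2 ^ (DIM('a) + 2) * jump_kernel (3/5 * s) m y) * (u m - u y)\<^sup>2"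
          using jump_kernel_midpoint(2)[OF s, of y m] by (auto intro!: mult_right_mono)
        then have "?g (- y + 2 *\<^sub>R m) y
          \<le> ennreal (2 ^ (DIM('a) + 2) * (jump_kernel (3/5 * s) m y * (u m - u y)\<^sup>2))"
          by (intro ennreal_leI) (simp only: mult.assoc)
        also have "\<dots> = ennreal (2 ^ (DIM('a) + 2)) * ?h m y"
          using jump_kernel_nonneg[of "3/5 * s" m y] by (intro ennreal_mult) auto
        finally show "?g (- y + 2 *\<^sub>R m) y
          \<le> ennreal (2 ^ (DIM('a) + 2)) * ?h m y" .
      qed simp
      also have "\<dots> = ennreal (?d * 2 ^ (DIM('a) + 2)) * (\<integral>\<^sup>+m. ?h m y \<partial>lborel)"
        by (subst nn_integral_cmult) (measurable, simp add: ennreal_mult mult.assoc)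
      finally show "(\<integral>\<^sup>+x. ?g x y \<partial>lborel)
        \<le> ennreal (?d * 2 ^ (DIM('a) + 2)) * (\<integral>\<^sup>+m. ?h m y \<partial>lborel)" .
    qed
    also have "\<dots> = ennreal (?d * 2 ^ (DIM('a) + 2))
        * (\<integral>\<^sup>+y. (\<integral>\<^sup>+m. ?h m y \<partial>lborel) \<partial>lborel)"
      by (rule nn_integral_cmult) measurable
    also have "(\<integral>\<^sup>+y. (\<integral>\<^sup>+m. ?h m y \<partial>lborel) \<partial>lborel) = ?J"
      unfolding jump_energy_def by (rule nn_integral_lborel_swap) measurable
    finally show "(\<integral>\<^sup>+x. (\<integral>\<^sup>+y. ?g x y \<partial>lborel) \<partial>lborel)
      \<le> ennreal (?d * 2 ^ (DIM('a) + 2)) * ?J" .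
  qed auto
  also have "\<dots> = ennreal (shrink_constant TYPE('a)) * ?J"
  proof -
    have "ennreal (shrink_constant TYPE('a)) = 2 * ennreal ?d + 2 * ennreal (?d * 2 ^ (DIM('a) + 2))"
      by (simp add: shrink_constant_def ennreal_mult[symmetric] ennreal_plus[symmetric]
          numeral_mult_ennreal algebra_simps del: ennreal_plus)
    then show ?thesis by (simp add: algebra_simps)
  qed
  finally show ?thesis .
qed

text \<open>Iterating the halving \<open>n\<close> times brings the radius below \<open>r\<close>.
  The constant depends on the dimension and on \<open>n\<close> only, hence not on \<delta>.\<close>

lemma jump_energy_compare:
  assumes u: "u \<in> borel_measurable borel" and s: "0 < s" "s \<le> 1" and n: "(3/5) ^ n * s \<le> r"
  shows "jump_energy s u \<le> ennreal (shrink_constant TYPE('a) ^ n) * jump_energy r u"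
proof -
  have "jump_energy s u \<le> ennreal (shrink_constant TYPE('a) ^ n) * jump_energy ((3/5) ^ n * s) u"
  proof (induction n)
    case (Suc n)
    have "(3/5) ^ n * s \<le> 1 * 1" using s by (intro mult_mono power_le_one) auto
    then have "jump_energy ((3/5) ^ n * s) u \<le> ennreal (shrink_constant TYPE('a)) * jump_energy (3/5 * ((3/5) ^ n * s)) u"
      using s by (intro jump_energy_shrink u) auto
    then have "ennreal (shrink_constant TYPE('a) ^ n) * jump_energy ((3/5) ^ n * s) u
      \<le> ennreal (shrink_constant TYPE('a) ^ n) * (ennreal (shrink_constant TYPE('a)) * jump_energy (3/5 * ((3/5) ^ n * s)) u)"
      by (rule mult_left_mono) simp
    also have "\<dots> = ennreal (shrink_constant TYPE('a) ^ Suc n) * jump_energy ((3/5) ^ Suc n * s) u"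
      by (simp add: ennreal_mult shrink_constant_def mult_ac)
    finally show ?case using Suc by simp
  qed simp
  also have "\<dots> \<le> ennreal (shrink_constant TYPE('a) ^ n) * jump_energy r u"
    by (intro mult_left_mono jump_energy_mono n) simp
  finally show ?thesis .
qed

text \<open>With \<open>F = l \<phi>\<^sup>2 / e\<close> for the linear function \<open>l x = x \<bullet> z + M |z|\<close>, which grows by
  \<open>e |z|\<^sup>2\<close> in a jump, the jump does not increase the integral of \<open>F\<close>; the growth of \<open>l\<close> is
  therefore paid for by the increments of \<open>\<phi>\<close>.\<close>

lemma poincare_direction:
  fixes \<phi> :: "'a \<Rightarrow> real"
  assumes \<phi>: "continuous_on UNIV \<phi>" and S: "compact S" "S \<subseteq> \<Omega>" and supp: "\<And>x. x \<notin> S \<Longrightarrow> \<phi> x = 0"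
    and z: "norm z \<le> 1" and M: "0 < M" "6 * K * M * norm z \<le> 1" "\<And>x. x \<in> \<Omega> \<Longrightarrow> norm x \<le> M"
  shows "ennreal ((norm z)\<^sup>2 / 8) * (\<integral>\<^sup>+x. ennreal ((\<phi> x)\<^sup>2) * indicator \<Omega> x \<partial>lborel)
    \<le> ennreal (2 * M + 16 * M\<^sup>2 + 1)
      * (\<integral>\<^sup>+x. ennreal ((\<phi> x - \<phi> (x + e x *\<^sub>R z))\<^sup>2 / (e x)\<^sup>2) * indicator \<Omega> x \<partial>lborel)"
proof -
  have [measurable]: "\<phi> \<in> borel_measurable borel" using \<phi> by (rule borel_measurable_continuous_onI)
  have [measurable]: "S \<in> sets borel" using S by (simp add: borel_compact)
  define l where "l x = x \<bullet> z + M * norm z" for x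
  define F where "F x = indicator \<Omega> x * (l x * (\<phi> x)\<^sup>2) / (indicator \<Omega> x * e x)" for x
  define C where "C = 2 * M + 16 * M\<^sup>2 + 1"
  define D where "D x = (\<phi> x - \<phi> (x + (indicator \<Omega> x * e x) *\<^sub>R z))\<^sup>2 / (indicator \<Omega> x * e x)\<^sup>2" for x
  have [measurable]: "l \<in> borel_measurable borel" unfolding l_def by measurable
  have [measurable]: "F \<in> borel_measurable borel" "D \<in> borel_measurable borel"
    unfolding F_def D_def by measurable
  have l: "0 \<le> l x" "l x \<le> 2 * M * norm z" if "x \<in> \<Omega>" for x
  proof -
    have "\<bar>x \<bullet> z\<bar> \<le> norm x * norm z" by (rule Cauchy_Schwarz_ineq2)
    also have "\<dots> \<le> M * norm z" by (intro mult_right_mono M that) auto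
    finally have *: "\<bar>x \<bullet> z\<bar> \<le> M * norm z" .
    show "0 \<le> l x" using abs_le_D2[OF *] by (simp add: l_def)
    show "l x \<le> 2 * M * norm z" using abs_le_D1[OF *] by (simp add: l_def)
  qed
  have F_nonneg: "0 \<le> F x" for x
    using l[of x] pos[of x] by (cases "x \<in> \<Omega>") (auto simp: F_def)
  \<comment> \<open>The quotient by \<open>e\<close> is unbounded near the boundary in general; on
    the compact set \<open>S\<close> it is continuous. This makes the integral of \<open>F\<close>
    finite, so that it can be subtracted from both sides at the end.\<close>
  have "bounded (F ` S)"
  proof -
    have "continuous_on S (\<lambda>x. l x * (\<phi> x)\<^sup>2 / e x)"
      unfolding l_def using S pos
      by (intro continuous_intros continuous_on_subset[OF \<phi>] continuous_on_subset[OF continuous_horizon]) force+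
    then have "continuous_on S F"
      by (rule continuous_on_cong[THEN iffD1, rotated -1]) (use S in \<open>auto simp: F_def\<close>)
    then show ?thesis using S(1) by (intro compact_imp_bounded compact_continuous_image)
  qed
  then obtain B where B: "\<And>x. x \<in> S \<Longrightarrow> F x \<le> B" and B0: "0 < B"
    by (auto simp: bounded_pos) (metis abs_le_D1)
  have F_supp: "F x = 0" if "x \<notin> S" for x using supp[OF that] by (simp add: F_def)
  have "(\<integral>\<^sup>+x. ennreal (F x) * indicator \<Omega> x \<partial>lborel) \<le> (\<integral>\<^sup>+x. ennreal B * indicator S x \<partial>lborel)"
    using B F_supp by (intro nn_integral_mono) (auto intro!: ennreal_leI split: split_indicator)
  also have "\<dots> = ennreal B * emeasure lborel S"
    by (rule nn_integral_cmult_indicator) simp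
  also have "\<dots> < \<infinity>"
    using emeasure_compact_finite[OF S(1)] by (auto simp: ennreal_mult_less_top)
  finally have fin: "(\<integral>\<^sup>+x. ennreal (F x) * indicator \<Omega> x \<partial>lborel) \<noteq> \<infinity>" by simp
  have C: "0 \<le> C" using M by (simp add: C_def)
  have D: "0 \<le> D x" for x by (simp add: D_def)
  define J where "J x = ennreal ((1 + (indicator \<Omega> x *\<^sub>R e' x) \<bullet> z) * F (x + (indicator \<Omega> x * e x) *\<^sub>R z))" for x
  have [measurable]: "J \<in> borel_measurable borel" unfolding J_def by measurable
  have "(\<integral>\<^sup>+x. ennreal (F x) * indicator \<Omega> x \<partial>lborel)
      + ennreal ((norm z)\<^sup>2 / 8) * (\<integral>\<^sup>+x. ennreal ((\<phi> x)\<^sup>2) * indicator \<Omega> x \<partial>lborel)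
    = (\<integral>\<^sup>+x. (ennreal (F x) + ennreal ((norm z)\<^sup>2 / 8) * ennreal ((\<phi> x)\<^sup>2)) * indicator \<Omega> x \<partial>lborel)"
    by (simp add: nn_integral_add nn_integral_cmult distrib_right mult.assoc)
  also have "\<dots> \<le> (\<integral>\<^sup>+x. (J x + ennreal C * ennreal (D x)) * indicator \<Omega> x \<partial>lborel)"
  proof (rule nn_integral_mono)
    fix x
    show "(ennreal (F x) + ennreal ((norm z)\<^sup>2 / 8) * ennreal ((\<phi> x)\<^sup>2)) * indicator \<Omega> x
      \<le> (J x + ennreal C * ennreal (D x)) * indicator \<Omega> x"
    proof (cases "x \<in> \<Omega>")
      case True
      let ?y = "x + e x *\<^sub>R z"
      have y: "?y \<in> \<Omega>" using jump_in_domain[OF True z] .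
      have "l x * (\<phi> x)\<^sup>2 / e x + (norm z)\<^sup>2 / 8 * (\<phi> x)\<^sup>2
        \<le> (1 + e' x \<bullet> z) * (l ?y * (\<phi> ?y)\<^sup>2 / e ?y) + C * ((\<phi> x - \<phi> ?y)\<^sup>2 / (e x)\<^sup>2)"
        unfolding C_def
      proof (rule poincare_pointwise[where K = K])
        show "e ?y \<le> e x * (1 + e' x \<bullet> z) + K * (e x)\<^sup>2 * (norm z)\<^sup>2"
          using second_order[OF True z] by (simp add: distrib_left)
        show "l ?y = l x + e x * (norm z)\<^sup>2"
          by (simp add: l_def inner_add_left power2_norm_eq_inner)
      qed (use True y z M l jacobian_bounds pos le_1 K_nonneg in auto)
      then have "F x + (norm z)\<^sup>2 / 8 * (\<phi> x)\<^sup>2 \<le> (1 + e' x \<bullet> z) * F ?y + C * D x"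
        using True y by (simp add: F_def D_def)
      then have "ennreal (F x + (norm z)\<^sup>2 / 8 * (\<phi> x)\<^sup>2) \<le> ennreal ((1 + e' x \<bullet> z) * F ?y + C * D x)"
        by (rule ennreal_leI)
      moreover have "0 \<le> (1 + e' x \<bullet> z) * F ?y"
        using jacobian_bounds[OF True z] F_nonneg by (intro mult_nonneg_nonneg) auto
      ultimately show ?thesis
        using True C D[of x] F_nonneg[of x] by (simp add: J_def ennreal_plus ennreal_mult[symmetric] del: ennreal_plus[symmetric])
    qed simp
  qed
  also have "\<dots> = (\<integral>\<^sup>+x. J x * indicator \<Omega> x \<partial>lborel)
      + ennreal C * (\<integral>\<^sup>+x. ennreal (D x) * indicator \<Omega> x \<partial>lborel)"
    by (simp add: nn_integral_add nn_integral_cmult distrib_right mult.assoc)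
  also have "(\<integral>\<^sup>+x. J x * indicator \<Omega> x \<partial>lborel)
      = (\<integral>\<^sup>+x. ennreal ((1 + e' x \<bullet> z) * F (x + e x *\<^sub>R z)) * indicator \<Omega> x \<partial>lborel)"
    by (intro nn_integral_cong) (auto simp: J_def split: split_indicator)
  also have "\<dots> \<le> (\<integral>\<^sup>+x. ennreal (F x) * indicator \<Omega> x \<partial>lborel)"
    by (rule nn_integral_jump_le) (use z F_nonneg in auto)
  finally have "ennreal ((norm z)\<^sup>2 / 8) * (\<integral>\<^sup>+x. ennreal ((\<phi> x)\<^sup>2) * indicator \<Omega> x \<partial>lborel)
      \<le> ennreal C * (\<integral>\<^sup>+x. ennreal (D x) * indicator \<Omega> x \<partial>lborel)"
    using fin by (simp add: add_right_mono ennreal_add_left_cancel_le)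
  also have "(\<integral>\<^sup>+x. ennreal (D x) * indicator \<Omega> x \<partial>lborel)
      = (\<integral>\<^sup>+x. ennreal ((\<phi> x - \<phi> (x + e x *\<^sub>R z))\<^sup>2 / (e x)\<^sup>2) * indicator \<Omega> x \<partial>lborel)"
    by (intro nn_integral_cong) (auto simp: D_def split: split_indicator)
  finally show ?thesis by (simp add: C_def)
qed

text \<open>With the direction \<open>z\<close> outermost, estimates for a fixed direction can be
  integrated.\<close>

lemma jump_energy_polar':
  assumes [measurable]: "u \<in> borel_measurable borel"
  shows "jump_energy r u = (\<integral>\<^sup>+z. (\<integral>\<^sup>+x. ennreal ((u x - u (x + e x *\<^sub>R z))\<^sup>2 / (e x)\<^sup>2)
    * indicator \<Omega> x \<partial>lborel) * indicator (cball 0 r) z \<partial>lborel)"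
proof -
  have [measurable]: "cball (0::'a) r \<in> sets borel" by simp
  let ?e = "\<lambda>x. indicator \<Omega> x * e x"
  let ?f = "\<lambda>x z. ennreal ((u x - u (x + ?e x *\<^sub>R z))\<^sup>2 / (?e x)\<^sup>2) * indicator (cball 0 r) z * indicator \<Omega> x"
  have "jump_energy r u = (\<integral>\<^sup>+x. (\<integral>\<^sup>+z. ?f x z \<partial>lborel) \<partial>lborel)"
    unfolding jump_energy_polar[OF assms] by (intro nn_integral_cong) (auto split: split_indicator)
  also have "\<dots> = (\<integral>\<^sup>+z. (\<integral>\<^sup>+x. ?f x z \<partial>lborel) \<partial>lborel)"
    by (rule nn_integral_lborel_swap) measurable
  also have "\<dots> = (\<integral>\<^sup>+z. (\<integral>\<^sup>+x. ennreal ((u x - u (x + e x *\<^sub>R z))\<^sup>2 / (e x)\<^sup>2)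
    * indicator \<Omega> x \<partial>lborel) * indicator (cball 0 r) z \<partial>lborel)"
    by (intro nn_integral_cong) (auto intro!: nn_integral_cong split: split_indicator)
  finally show ?thesis .
qed

lemma poincare:
  fixes \<phi> :: "'a \<Rightarrow> real"
  assumes \<phi>: "continuous_on UNIV \<phi>" and S: "compact S" "S \<subseteq> \<Omega>" and supp: "\<And>x. x \<notin> S \<Longrightarrow> \<phi> x = 0"
    and r: "r \<le> 1" and M: "0 < M" "6 * K * M * r \<le> 1" "\<And>x. x \<in> \<Omega> \<Longrightarrow> norm x \<le> M"
  shows "(\<integral>\<^sup>+z. ennreal ((norm z)\<^sup>2) * indicator (cball (0::'a) r) z \<partial>lborel)
      * (\<integral>\<^sup>+x. ennreal ((\<phi> x)\<^sup>2) * indicator \<Omega> x \<partial>lborel)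
    \<le> ennreal (8 * (2 * M + 16 * M\<^sup>2 + 1)) * jump_energy r \<phi>"
proof -
  have [measurable]: "\<phi> \<in> borel_measurable borel" using \<phi> by (rule borel_measurable_continuous_onI)
  have [measurable]: "cball (0::'a) r \<in> sets borel" by simp
  let ?e = "\<lambda>x. indicator \<Omega> x * e x"
  let ?I = "\<integral>\<^sup>+x. ennreal ((\<phi> x)\<^sup>2) * indicator \<Omega> x \<partial>lborel" and ?C = "8 * (2 * M + 16 * M\<^sup>2 + 1)"
  let ?D = "\<lambda>z. \<integral>\<^sup>+x. ennreal ((\<phi> x - \<phi> (x + e x *\<^sub>R z))\<^sup>2 / (e x)\<^sup>2) * indicator \<Omega> x \<partial>lborel"
  have "?D = (\<lambda>z. \<integral>\<^sup>+x. ennreal ((\<phi> x - \<phi> (x + ?e x *\<^sub>R z))\<^sup>2 / (?e x)\<^sup>2) * indicator \<Omega> x \<partial>lborel)"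
    by (intro ext nn_integral_cong) (auto split: split_indicator)
  also have "\<dots> \<in> borel_measurable borel" by measurable
  finally have [measurable]: "?D \<in> borel_measurable borel" .
  have "(\<integral>\<^sup>+z. ennreal ((norm z)\<^sup>2) * indicator (cball (0::'a) r) z \<partial>lborel) * ?I
      = (\<integral>\<^sup>+z. ennreal ((norm z)\<^sup>2) * ?I * indicator (cball (0::'a) r) z \<partial>lborel)"
    by (subst nn_integral_multc[symmetric]) (auto simp: mult_ac)
  also have "\<dots> \<le> (\<integral>\<^sup>+z. ennreal ?C * ?D z * indicator (cball 0 r) z \<partial>lborel)"
  proof (rule nn_integral_mono)
    fix z :: 'a
    show "ennreal ((norm z)\<^sup>2) * ?I * indicator (cball 0 r) z \<le> ennreal ?C * ?D z * indicator (cball 0 r) z"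
    proof (cases "z \<in> cball 0 r")
      case True
      have "6 * K * M * norm z \<le> 6 * K * M * r"
        using True K_nonneg M(1) by (intro mult_left_mono) auto
      then have "ennreal ((norm z)\<^sup>2 / 8) * ?I \<le> ennreal (2 * M + 16 * M\<^sup>2 + 1) * ?D z"
        using True r M by (intro poincare_direction[OF \<phi> S supp]) auto
      then have "ennreal 8 * (ennreal ((norm z)\<^sup>2 / 8) * ?I) \<le> ennreal 8 * (ennreal (2 * M + 16 * M\<^sup>2 + 1) * ?D z)"
        by (rule mult_left_mono) simp
      moreover have scale: "ennreal 8 * (ennreal a * b) = ennreal (8 * a) * b" if "0 \<le> a" for a b
        using that by (simp add: ennreal_mult' mult.assoc)
      have "ennreal 8 * (ennreal ((norm z)\<^sup>2 / 8) * ?I) = ennreal ((norm z)\<^sup>2) * ?I"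
        by (subst scale) auto
      moreover have "ennreal 8 * (ennreal (2 * M + 16 * M\<^sup>2 + 1) * ?D z) = ennreal ?C * ?D z"
        using M by (intro scale) auto
      ultimately have "ennreal ((norm z)\<^sup>2) * ?I \<le> ennreal ?C * ?D z" by (simp only:)
      then show ?thesis by (rule mult_right_mono) simp
    qed simp
  qed
  also have "\<dots> = ennreal ?C * jump_energy r \<phi>"
    by (subst jump_energy_polar') (simp_all add: mult.assoc nn_integral_cmult)
  finally show ?thesis .
qed

text \<open>The point at time \<open>t\<close> on the way from \<open>x\<close> to
  \<open>x + e x *\<^sub>R z\<close> is itself the end of a jump, in direction
  \<open>t *\<^sub>R z\<close>, so the same substitution applies for every \<open>t\<close>. The
  factor 3/2 is the reciprocal of the lower bound of the Jacobian, and the length of the jump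
  cancels the division by \<open>e\<close> squared.\<close>

lemma jump_energy_le_gradient:
  assumes \<phi>: "\<And>x. (\<phi> has_derivative (\<lambda>v. g x \<bullet> v)) (at x)" and g: "continuous_on UNIV g"
    and r: "r \<le> 1"
  shows "jump_energy r \<phi> \<le> ennreal (3/2) * emeasure lborel (cball (0::'a) r)
    * (\<integral>\<^sup>+x. ennreal ((norm (g x))\<^sup>2) * indicator \<Omega> x \<partial>lborel)"
proof -
  have "continuous_on UNIV \<phi>"
    using \<phi> by (meson continuous_at_imp_continuous_on has_derivative_continuous)
  then have [measurable]: "\<phi> \<in> borel_measurable borel" by (rule borel_measurable_continuous_onI)
  have [measurable]: "g \<in> borel_measurable borel" using g by (rule borel_measurable_continuous_onI)
  have [measurable]: "cball (0::'a) r \<in> sets borel" by simp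
  let ?e = "\<lambda>x. indicator \<Omega> x * e x"
  let ?g = "\<lambda>x z t. ennreal ((norm (g (x + t *\<^sub>R (?e x *\<^sub>R z))))\<^sup>2) * indicator \<Omega> x"
  let ?G = "\<integral>\<^sup>+x. ennreal ((norm (g x))\<^sup>2) * indicator \<Omega> x \<partial>lborel"
  have scaled: "(\<integral>\<^sup>+x. ?g x z t \<partial>lborel) \<le> ennreal (3/2) * ?G"
    if z: "z \<in> cball 0 r" and t: "t \<in> {0..1}" for z t
  proof -
    have "t * norm z \<le> 1 * 1" using z t r by (intro mult_mono) auto
    then have tz: "norm (t *\<^sub>R z) \<le> 1" using t by simp
    let ?G' = "\<lambda>x. ennreal ((1 + (indicator \<Omega> x *\<^sub>R e' x) \<bullet> (t *\<^sub>R z))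
        * (norm (g (x + ?e x *\<^sub>R (t *\<^sub>R z))))\<^sup>2) * indicator \<Omega> x"
    have "(\<integral>\<^sup>+x. ?g x z t \<partial>lborel)
      \<le> (\<integral>\<^sup>+x. ennreal (3/2) * (?G' x) \<partial>lborel)"
    proof (rule nn_integral_mono)
      fix x
      show "?g x z t
        \<le> ennreal (3/2) * (?G' x)"
      proof (cases "x \<in> \<Omega>")
        case True
        have "1 * (norm (g (x + e x *\<^sub>R (t *\<^sub>R z))))\<^sup>2
          \<le> (3/2 * (1 + e' x \<bullet> (t *\<^sub>R z))) * (norm (g (x + e x *\<^sub>R (t *\<^sub>R z))))\<^sup>2"
          using jacobian_bounds[OF True tz] by (intro mult_right_mono) auto
        then have "ennreal ((norm (g (x + e x *\<^sub>R (t *\<^sub>R z))))\<^sup>2)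
          \<le> ennreal (3/2 * ((1 + e' x \<bullet> (t *\<^sub>R z)) * (norm (g (x + e x *\<^sub>R (t *\<^sub>R z))))\<^sup>2))"
          by (intro ennreal_leI) (simp only: mult.assoc mult_1_left)
        also have "\<dots> = ennreal (3/2) * ennreal ((1 + e' x \<bullet> (t *\<^sub>R z)) * (norm (g (x + e x *\<^sub>R (t *\<^sub>R z))))\<^sup>2)"
          by (rule ennreal_mult') simp
        finally show ?thesis using True by (simp add: mult.commute[of t])
      qed simp
    qed
    also have "\<dots> = ennreal (3/2) * (\<integral>\<^sup>+x. ?G' x \<partial>lborel)"
      by (rule nn_integral_cmult) measurable
    also have "(\<integral>\<^sup>+x. ?G' x \<partial>lborel)
      = (\<integral>\<^sup>+x. ennreal ((1 + e' x \<bullet> (t *\<^sub>R z)) * (norm (g (x + e x *\<^sub>R (t *\<^sub>R z))))\<^sup>2) * indicator \<Omega> x \<partial>lborel)"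
      by (intro nn_integral_cong) (auto split: split_indicator)
    also have "\<dots> \<le> ?G" by (rule nn_integral_jump_le) (use tz in auto)
    finally show ?thesis by (simp add: mult_left_mono)
  qed
  have "jump_energy r \<phi> \<le> (\<integral>\<^sup>+z. (\<integral>\<^sup>+x. (\<integral>\<^sup>+t. ?g x z t
      * indicator {0..1} t \<partial>lborel) \<partial>lborel) * indicator (cball 0 r) z \<partial>lborel)"
    unfolding jump_energy_polar'[OF \<open>\<phi> \<in> borel_measurable borel\<close>]
  proof (intro nn_integral_mono)
    fix z :: 'a
    have "ennreal ((\<phi> x - \<phi> (x + e x *\<^sub>R z))\<^sup>2 / (e x)\<^sup>2)
        \<le> (\<integral>\<^sup>+t. ennreal ((norm (g (x + t *\<^sub>R (e x *\<^sub>R z))))\<^sup>2) * indicator {0..1} t \<partial>lborel)" (is "_ \<le> ?T")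
      if x: "x \<in> \<Omega>" and z: "z \<in> cball 0 r" for x
    proof -
      have ex: "0 < e x" using pos[OF x] .
      have "norm (e x *\<^sub>R z) \<le> e x" using ex z r mult_left_mono[of "norm z" 1 "e x"] by simp
      then have "(norm (e x *\<^sub>R z))\<^sup>2 \<le> (e x)\<^sup>2" by (intro power_mono) auto
      then have le: "(norm (e x *\<^sub>R z))\<^sup>2 / (e x)\<^sup>2 \<le> 1" using ex by simp
      have "ennreal ((\<phi> x - \<phi> (x + e x *\<^sub>R z))\<^sup>2 / (e x)\<^sup>2)
        = ennreal (1 / (e x)\<^sup>2) * ennreal ((\<phi> (x + e x *\<^sub>R z) - \<phi> x)\<^sup>2)"
        by (simp add: ennreal_mult[symmetric] power2_commute)
      also have "\<dots> \<le> ennreal (1 / (e x)\<^sup>2) * (ennreal ((norm (e x *\<^sub>R z))\<^sup>2) * ?T)"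
        by (intro mult_left_mono increment_square_le[OF \<phi> g]) auto
      also have "\<dots> = ennreal ((norm (e x *\<^sub>R z))\<^sup>2 / (e x)\<^sup>2) * ?T"
        by (simp only: mult.assoc[symmetric]) (simp add: ennreal_mult[symmetric])
      also have "\<dots> \<le> ennreal 1 * ?T" using le by (intro mult_right_mono ennreal_leI) auto
      finally show ?thesis by simp
    qed
    then have "(\<integral>\<^sup>+x. ennreal ((\<phi> x - \<phi> (x + e x *\<^sub>R z))\<^sup>2 / (e x)\<^sup>2) * indicator \<Omega> x \<partial>lborel)
      \<le> (\<integral>\<^sup>+x. (\<integral>\<^sup>+t. ?g x z t * indicator {0..1} t \<partial>lborel) \<partial>lborel)"
      if "z \<in> cball 0 r"
      using that by (intro nn_integral_mono) (auto split: split_indicator)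
    then show "(\<integral>\<^sup>+x. ennreal ((\<phi> x - \<phi> (x + e x *\<^sub>R z))\<^sup>2 / (e x)\<^sup>2) * indicator \<Omega> x \<partial>lborel) * indicator (cball 0 r) z
      \<le> (\<integral>\<^sup>+x. (\<integral>\<^sup>+t. ?g x z t * indicator {0..1} t \<partial>lborel) \<partial>lborel)
        * indicator (cball 0 r) z"
      by (auto split: split_indicator)
  qed
  also have "\<dots> \<le> (\<integral>\<^sup>+z. ennreal (3/2) * ?G * indicator (cball (0::'a) r) z \<partial>lborel)"
  proof (rule nn_integral_mono)
    fix z :: 'a
    show "(\<integral>\<^sup>+x. (\<integral>\<^sup>+t. ?g x z t
      * indicator {0..1} t \<partial>lborel) \<partial>lborel) * indicator (cball 0 r) z
      \<le> ennreal (3/2) * ?G * indicator (cball 0 r) z"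
    proof (cases "z \<in> cball 0 r")
      case True
      have "(\<integral>\<^sup>+x. (\<integral>\<^sup>+t. ?g x z t
          * indicator {0..1} t \<partial>lborel) \<partial>lborel)
        = (\<integral>\<^sup>+(t::real). (\<integral>\<^sup>+x. ?g x z t
          * indicator {0..1} t \<partial>lborel) \<partial>lborel)"
        by (rule nn_integral_lborel_swap) measurable
      also have "\<dots> = (\<integral>\<^sup>+(t::real). (\<integral>\<^sup>+x. ?g x z t \<partial>lborel)
          * indicator {0..1} t \<partial>lborel)"
        by (intro nn_integral_cong nn_integral_multc) measurable
      also have "\<dots> \<le> (\<integral>\<^sup>+(t::real). ennreal (3/2) * ?G * indicator {0..1} t \<partial>lborel)"
        using scaled[OF True] by (intro nn_integral_mono) (auto split: split_indicator)
      also have "\<dots> = ennreal (3/2) * ?G" by (simp add: nn_integral_cmult_indicator)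
      finally show ?thesis by (rule mult_right_mono) simp
    qed simp
  qed
  also have "\<dots> = ennreal (3/2) * emeasure lborel (cball (0::'a) r) * ?G"
    by (subst nn_integral_cmult_indicator) (auto simp: mult_ac)
  finally show ?thesis .
qed

end

section \<open>Test functions and localization functions\<close>

lemma frechet_derivative_grad:
  fixes f :: "'a::euclidean_space \<Rightarrow> real"
  assumes "f differentiable at x"
  shows "frechet_derivative f (at x) v = grad f x \<bullet> v"
proof -
  interpret linear "frechet_derivative f (at x)" using assms by (rule linear_frechet_derivative)
  have "frechet_derivative f (at x) v = frechet_derivative f (at x) (\<Sum>b\<in>Basis. (v \<bullet> b) *\<^sub>R b)"
    by (simp add: euclidean_representation)
  also have "\<dots> = (\<Sum>b\<in>Basis. (v \<bullet> b) * frechet_derivative f (at x) b)"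
    by (simp only: sum scale real_scaleR_def)
  also have "\<dots> = grad f x \<bullet> v"
    by (simp add: grad_def inner_sum_right inner_commute[of _ v] mult.commute)
  finally show ?thesis .
qed

lemma has_derivative_grad:
  fixes f :: "'a::euclidean_space \<Rightarrow> real"
  assumes "f differentiable at x"
  shows "(f has_derivative (\<lambda>v. grad f x \<bullet> v)) (at x)"
proof -
  have "frechet_derivative f (at x) = (\<lambda>v. grad f x \<bullet> v)"
    using frechet_derivative_grad[OF assms] by auto
  then show ?thesis using assms by (simp only: frechet_derivative_works)
qed

lemma continuous_on_grad: "Ck_on (Suc k) S f \<Longrightarrow> continuous_on S (grad f)"
  unfolding grad_def Ck_on_def by (intro continuous_intros) (auto dest!: spec[of _ "[_]"])

text \<open>All orders at once and without the continuity clauses of \<open>Ck_on\<close>, which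
  follow from differentiability; inductions on the list of directions become simpler.\<close>

definition smooth :: "('a::euclidean_space \<Rightarrow> real) \<Rightarrow> bool" where
  "smooth f \<longleftrightarrow> (\<forall>bs. set bs \<subseteq> Basis \<longrightarrow> (\<forall>x. partials bs f differentiable at x))"

lemma smooth_iff_Ck_on: "smooth f \<longleftrightarrow> (\<forall>k. Ck_on k UNIV f)"
proof
  assume f: "smooth f"
  have "continuous_on UNIV (partials bs f)" if "set bs \<subseteq> Basis" for bs
    using f that by (intro continuous_at_imp_continuous_on ballI differentiable_imp_continuous_within)
      (auto simp: smooth_def)
  with f show "\<forall>k. Ck_on k UNIV f" by (auto simp: Ck_on_def smooth_def)
next
  assume "\<forall>k. Ck_on k UNIV f"
  then show "smooth f" by (auto simp: Ck_on_def smooth_def intro!: less_Suc_eq_le[THEN iffD2])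
qed

lemma smooth_differentiable: "smooth f \<Longrightarrow> f differentiable at x"
  unfolding smooth_def by (drule spec[of _ "[]"]) auto

lemma partials_add:
  assumes "smooth f" "smooth g" "set bs \<subseteq> Basis"
  shows "partials bs (\<lambda>x. f x + g x) = (\<lambda>x. partials bs f x + partials bs g x)"
  using assms(3)
proof (induction bs)
  case (Cons b bs)
  have "frechet_derivative (\<lambda>x. partials bs f x + partials bs g x) (at x) b
    = frechet_derivative (partials bs f) (at x) b + frechet_derivative (partials bs g) (at x) b" for x
  proof -
    have "((\<lambda>x. partials bs f x + partials bs g x) has_derivative
      (\<lambda>v. frechet_derivative (partials bs f) (at x) v + frechet_derivative (partials bs g) (at x) v)) (at x)"
      using assms Cons.prems
      by (intro has_derivative_add) (auto simp: smooth_def frechet_derivative_works[symmetric])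
    from frechet_derivative_at[OF this] show ?thesis by (metis (no_types, lifting))
  qed
  then show ?case using Cons by simp
qed simp

lemma partials_scale:
  assumes "smooth f" "set bs \<subseteq> Basis"
  shows "partials bs (\<lambda>x. c * f x) = (\<lambda>x. c * partials bs f x)"
  using assms(2)
proof (induction bs)
  case (Cons b bs)
  have "frechet_derivative (\<lambda>x. c * partials bs f x) (at x) b = c * frechet_derivative (partials bs f) (at x) b" for x
  proof -
    have "((\<lambda>x. c * partials bs f x) has_derivative (\<lambda>v. c * frechet_derivative (partials bs f) (at x) v)) (at x)"
      using assms Cons.prems
      by (intro has_derivative_mult_right) (auto simp: smooth_def frechet_derivative_works[symmetric])
    from frechet_derivative_at[OF this] show ?thesis by (metis (no_types, lifting))
  qed
  then show ?case using Cons by simp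
qed simp

lemma smooth_add: "smooth f \<Longrightarrow> smooth g \<Longrightarrow> smooth (\<lambda>x. f x + g x)"
  by (subst smooth_def) (auto simp: partials_add smooth_def)

lemma smooth_scale: "smooth f \<Longrightarrow> smooth (\<lambda>x. c * f x)"
  by (subst smooth_def) (auto simp: partials_scale smooth_def)

text \<open>Any compact set outside which the function vanishes will do, which makes sums immediate:
  the union of two such sets serves.\<close>

lemma test_functions_iff:
  "\<phi> \<in> test_functions \<Omega> \<longleftrightarrow> smooth \<phi> \<and> (\<exists>S. compact S \<and> S \<subseteq> \<Omega> \<and> (\<forall>x. x \<notin> S \<longrightarrow> \<phi> x = 0))"
proof
  assume "\<phi> \<in> test_functions \<Omega>"
  then show "smooth \<phi> \<and> (\<exists>S. compact S \<and> S \<subseteq> \<Omega> \<and> (\<forall>x. x \<notin> S \<longrightarrow> \<phi> x = 0))"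
    using closure_subset[of "{x. \<phi> x \<noteq> 0}"]
    by (auto simp: test_functions_def smooth_iff_Ck_on intro!: exI[of _ "closure {x. \<phi> x \<noteq> 0}"])
next
  assume *: "smooth \<phi> \<and> (\<exists>S. compact S \<and> S \<subseteq> \<Omega> \<and> (\<forall>x. x \<notin> S \<longrightarrow> \<phi> x = 0))"
  then obtain S where S: "compact S" "S \<subseteq> \<Omega>" "{x. \<phi> x \<noteq> 0} \<subseteq> S" by blast
  have cl: "closure {x. \<phi> x \<noteq> 0} \<subseteq> S" using S by (intro closure_minimal compact_imp_closed)
  then have "closure {x. \<phi> x \<noteq> 0} = S \<inter> closure {x. \<phi> x \<noteq> 0}" by blast
  also have "compact \<dots>" using S by (intro compact_Int_closed) auto
  finally have "compact (closure {x. \<phi> x \<noteq> 0})" .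
  with * cl S show "\<phi> \<in> test_functions \<Omega>" by (auto simp: test_functions_def smooth_iff_Ck_on)
qed

lemma function_subspace_test_functions: "function_subspace (test_functions \<Omega>)"
  unfolding function_subspace_def
proof (intro conjI ballI allI)
  have "partials bs (\<lambda>x::'a. 0) = (\<lambda>x. 0)" for bs :: "'a list"
    by (induction bs) auto
  then show "(\<lambda>x. 0) \<in> test_functions \<Omega>"
    by (auto simp: test_functions_iff smooth_def intro!: exI[of _ "{}"])
next
  fix u v assume "u \<in> test_functions \<Omega>" "v \<in> test_functions \<Omega>"
  then obtain S T where "smooth u" "smooth v" "compact S" "compact T" "S \<subseteq> \<Omega>" "T \<subseteq> \<Omega>"
    "\<forall>x. x \<notin> S \<longrightarrow> u x = 0" "\<forall>x. x \<notin> T \<longrightarrow> v x = 0" by (auto simp: test_functions_iff)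
  then show "(\<lambda>x. u x + v x) \<in> test_functions \<Omega>"
    by (auto simp: test_functions_iff intro!: smooth_add exI[of _ "S \<union> T"])
next
  fix c u assume "u \<in> test_functions \<Omega>"
  then show "(\<lambda>x. c * u x) \<in> test_functions \<Omega>" by (auto simp: test_functions_iff intro: smooth_scale)
qed

lemma test_functions_subset_smooth_closure: "test_functions \<Omega> \<subseteq> smooth_closure \<Omega>"
proof
  fix \<phi> assume "\<phi> \<in> test_functions \<Omega>"
  then have C: "Ck_on k UNIV \<phi>" for k by (simp add: test_functions_def)
  have cont: "continuous_on T (partials bs \<phi>)" if "set bs \<subseteq> Basis" for bs T
    using C[of "length bs"] that unfolding Ck_on_def by (blast intro: continuous_on_subset)
  show "\<phi> \<in> smooth_closure \<Omega>"
    unfolding smooth_closure_def Ck_closure_def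
  proof (intro CollectI allI conjI impI)
    fix k
    show "continuous_on (closure \<Omega>) \<phi>" using cont[of "[]"] by simp
    show "Ck_on k \<Omega> \<phi>" using C[of k] by (auto simp: Ck_on_def intro: continuous_on_subset)
    fix bs assume "set bs \<subseteq> (Basis :: 'a set) \<and> length bs \<le> k"
    then show "\<exists>g. continuous_on (closure \<Omega>) g \<and> (\<forall>x\<in>\<Omega>. g x = partials bs \<phi> x)"
      using cont by blast
  qed
qed

lemma grad_add: "smooth f \<Longrightarrow> smooth g \<Longrightarrow> grad (\<lambda>x. f x + g x) x = grad f x + grad g x"
  by (simp add: grad_def partials_add[of f g "[_]", simplified] scaleR_add_left sum.distrib)

lemma grad_scale: "smooth f \<Longrightarrow> grad (\<lambda>x. c * f x) x = c *\<^sub>R grad f x"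
  by (simp add: grad_def partials_scale[of f "[_]", simplified] scaleR_sum_right)

text \<open>Cauchy-Schwarz over pairs of indices: the Frobenius norm of the matrix of products of
  coordinates of \<open>z\<close> is the squared norm of \<open>z\<close>.\<close>

lemma second_derivative_le_hessian:
  fixes f :: "'a::euclidean_space \<Rightarrow> real"
  shows "\<bar>\<Sum>j\<in>Basis. (\<Sum>i\<in>Basis. partials [i, j] f x * (z \<bullet> i)) * (z \<bullet> j)\<bar> \<le> hessian_norm f x * (norm z)\<^sup>2"
proof -
  let ?B = "(Basis :: 'a set) \<times> (Basis :: 'a set)"
  let ?h = "\<lambda>p. partials [fst p, snd p] f x" and ?z = "\<lambda>p. (z \<bullet> fst p) * (z \<bullet> snd p)"
  have "(\<Sum>j\<in>Basis. (\<Sum>i\<in>Basis. partials [i, j] f x * (z \<bullet> i)) * (z \<bullet> j))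
      = (\<Sum>i\<in>Basis. \<Sum>j\<in>Basis. partials [i, j] f x * ((z \<bullet> i) * (z \<bullet> j)))"
    by (subst sum.swap) (simp add: sum_distrib_right mult.assoc del: partials.simps)
  also have "\<dots> = (\<Sum>p\<in>?B. ?h p * ?z p)"
    by (simp add: sum.cartesian_product case_prod_beta del: partials.simps)
  also have "\<bar>\<dots>\<bar> \<le> (\<Sum>p\<in>?B. \<bar>?h p\<bar> * \<bar>?z p\<bar>)"
    using sum_abs[of "\<lambda>p. ?h p * ?z p" ?B] by (simp add: abs_mult del: partials.simps)
  also have "\<dots> \<le> L2_set ?h ?B * L2_set ?z ?B" by (rule L2_set_mult_ineq)
  also have "L2_set ?h ?B = hessian_norm f x"
    by (simp add: L2_set_def hessian_norm_def sum.cartesian_product case_prod_beta del: partials.simps)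
  also have "L2_set ?z ?B = (norm z)\<^sup>2"
  proof -
    have n: "(norm z)\<^sup>2 = (\<Sum>i\<in>Basis. (z \<bullet> i)\<^sup>2)"
      unfolding power2_norm_eq_inner euclidean_inner[of z z] by (simp add: power2_eq_square)
    have "(\<Sum>p\<in>?B. (?z p)\<^sup>2) = ((norm z)\<^sup>2)\<^sup>2"
      unfolding n power2_eq_square[of "sum _ _"] sum_product
      by (simp add: sum.cartesian_product case_prod_beta power_mult_distrib)
    then show ?thesis unfolding L2_set_def by (simp only: real_sqrt_abs) simp
  qed
  finally show ?thesis .
qed

text \<open>Two applications of the mean value theorem along the segment, first to \<open>f\<close>
  and then to its directional derivative. The intermediate point \<open>a\<close> is bounded by
  \<open>h\<close>, which loses the usual factor 1/2 of Taylor's formula.\<close>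

lemma second_order_upper_bound:
  fixes f :: "'a::euclidean_space \<Rightarrow> real"
  assumes f: "Ck_on 2 \<Omega> f" and h: "0 < h" and seg: "\<And>s. 0 \<le> s \<Longrightarrow> s \<le> h \<Longrightarrow> x + s *\<^sub>R z \<in> \<Omega>"
    and K: "\<And>y. y \<in> \<Omega> \<Longrightarrow> hessian_norm f y \<le> K"
  shows "f (x + h *\<^sub>R z) \<le> f x + h * (grad f x \<bullet> z) + K * h\<^sup>2 * (norm z)\<^sup>2"
proof -
  have diff: "f differentiable at y" and diff': "b \<in> Basis \<Longrightarrow> partials [b] f differentiable at y"
    if "y \<in> \<Omega>" for b y
  proof -
    have D: "partials bs f differentiable at y" if "set bs \<subseteq> Basis" "length bs < 2" for bs
      using f \<open>y \<in> \<Omega>\<close> that unfolding Ck_on_def by blast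
    show "f differentiable at y" using D[of "[]"] by simp
    show "b \<in> Basis \<Longrightarrow> partials [b] f differentiable at y" by (rule D) auto
  qed
  define f2 where "f2 s = (\<Sum>j\<in>Basis. (\<Sum>i\<in>Basis. partials [i, j] f (x + s *\<^sub>R z) * (z \<bullet> i)) * (z \<bullet> j))" for s
  have line: "((\<lambda>s. g (x + s *\<^sub>R z)) has_real_derivative grad g (x + s *\<^sub>R z) \<bullet> z) (at s)"
    if "g differentiable at (x + s *\<^sub>R z)" for g :: "'a \<Rightarrow> real" and s :: real
  proof -
    have 1: "((\<lambda>s. x + s *\<^sub>R z) has_derivative (\<lambda>h. h *\<^sub>R z)) (at s)"
      by (auto intro!: derivative_eq_intros)
    show ?thesis
      using has_derivative_compose[OF 1 has_derivative_grad[OF that]]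
      by (simp add: has_field_derivative_def mult_commute_abs)
  qed
  have d1: "((\<lambda>s. f (x + s *\<^sub>R z)) has_real_derivative grad f (x + s *\<^sub>R z) \<bullet> z) (at s)"
    if "0 \<le> s" "s \<le> h" for s
    using that by (intro line diff seg)
  have d2: "((\<lambda>s. grad f (x + s *\<^sub>R z) \<bullet> z) has_real_derivative f2 s) (at s)"
    if "0 \<le> s" "s \<le> h" for s
  proof -
    have "((\<lambda>s. \<Sum>j\<in>Basis. partials [j] f (x + s *\<^sub>R z) * (z \<bullet> j)) has_real_derivative
      (\<Sum>j\<in>Basis. (grad (partials [j] f) (x + s *\<^sub>R z) \<bullet> z) * (z \<bullet> j))) (at s)"
      using that by (intro DERIV_sum DERIV_cmult_right line diff' seg)
    moreover have "(\<Sum>j\<in>Basis. (grad (partials [j] f) (x + s *\<^sub>R z) \<bullet> z) * (z \<bullet> j)) = f2 s"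
      by (simp add: f2_def grad_def inner_sum_right inner_commute[of _ z])
    moreover have "(\<lambda>s. \<Sum>j\<in>Basis. partials [j] f (x + s *\<^sub>R z) * (z \<bullet> j)) = (\<lambda>s. grad f (x + s *\<^sub>R z) \<bullet> z)"
      by (simp add: grad_def inner_sum_right inner_commute[of _ z])
    ultimately show ?thesis by (simp only:)
  qed
  obtain a where a: "0 < a" "a < h" "f (x + h *\<^sub>R z) - f (x + 0 *\<^sub>R z) = (h - 0) * (grad f (x + a *\<^sub>R z) \<bullet> z)"
    using MVT2[OF h d1] by blast
  obtain b where b: "0 < b" "b < a" "grad f (x + a *\<^sub>R z) \<bullet> z - grad f (x + 0 *\<^sub>R z) \<bullet> z = (a - 0) * f2 b"
    using MVT2[OF a(1), of "\<lambda>s. grad f (x + s *\<^sub>R z) \<bullet> z" f2] d2 a by force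
  have "f2 b \<le> hessian_norm f (x + b *\<^sub>R z) * (norm z)\<^sup>2"
    unfolding f2_def by (rule order_trans[OF abs_ge_self second_derivative_le_hessian])
  also have "\<dots> \<le> K * (norm z)\<^sup>2" using a b by (intro mult_right_mono K seg) auto
  finally have f2: "f2 b \<le> K * (norm z)\<^sup>2" .
  have "0 \<le> hessian_norm f (x + b *\<^sub>R z)" by (simp add: hessian_norm_def sum_nonneg)
  also have "\<dots> \<le> K" using a b by (intro K seg) auto
  finally have K0: "0 \<le> K" .
  have "h * (a * f2 b) \<le> h * (a * (K * (norm z)\<^sup>2))" using f2 a h by (intro mult_left_mono) auto
  also have "\<dots> \<le> h * (h * (K * (norm z)\<^sup>2))" using a h K0 by (intro mult_left_mono mult_right_mono) auto
  finally have "h * (a * f2 b) \<le> K * h\<^sup>2 * (norm z)\<^sup>2" by (simp add: power2_eq_square mult_ac)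
  moreover have "f (x + h *\<^sub>R z) = f x + h * (grad f x \<bullet> z) + h * (a * f2 b)"
    using a(3) b(3) by (simp add: algebra_simps)
  ultimately show ?thesis by simp
qed

text \<open>A segment leaving \<open>\<Omega>\<close> crosses the frontier, and the crossing point
  is no farther from \<open>x\<close> than \<open>y\<close> is.\<close>

lemma in_domain_if_near:
  assumes "x \<in> \<Omega>" "norm (y - x) < infdist x (frontier \<Omega>)"
  shows "y \<in> \<Omega>"
proof (rule ccontr)
  assume "y \<notin> \<Omega>"
  have "closed_segment x y \<inter> frontier \<Omega> \<noteq> {}"
    using assms(1) \<open>y \<notin> \<Omega>\<close> by (intro connected_Int_frontier) auto
  then obtain p where p: "p \<in> closed_segment x y" "p \<in> frontier \<Omega>" by blast
  have "infdist x (frontier \<Omega>) \<le> dist x p" using p by (intro infdist_le)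
  also have "\<dots> \<le> norm (y - x)"
    using segment_bound1[OF p(1)] by (simp add: dist_norm norm_minus_commute)
  finally show False using assms(2) by simp
qed

text \<open>Each term of \<open>delta0\<close> has its task: \<open>1/(9 \<kappa>1^2)\<close> bounds
  the gradient by 1/3, \<open>1/(2 \<kappa>b^2)\<close> keeps the horizon below the distance to the
  frontier, which gives \<open>reach\<close>, and together with \<delta> below 1 it gives the bound
  \<open>e \<le> 1\<close>. The second-order constant is \<open>\<kappa>2\<close>, independent of
  \<delta>.\<close>

lemma horizon_localization:
  assumes \<Omega>: "bounded_C2_domain \<Omega>" and pos: "0 < \<kappa>1" "0 < \<kappa>2" "0 < \<kappa>b"
    and fam: "localization_family \<Omega> \<kappa>0 \<kappa>1 \<kappa>2 \<kappa>b \<eta>" and \<delta>: "0 < \<delta>" "\<delta> < delta0 \<kappa>1 \<kappa>b"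
  shows "horizon \<Omega> (\<eta> \<delta>) (grad (\<eta> \<delta>)) \<kappa>2"
proof -
  let ?e = "\<eta> \<delta>" and ?d = "\<lambda>x. infdist x (frontier \<Omega>)"
  have e_pos: "0 < ?e x" and e_le: "?e x \<le> \<kappa>b * min \<delta> ((?d x)\<^sup>2)"
    and grad_le: "norm (grad ?e x) \<le> \<kappa>1 * sqrt \<delta>" and hess_le: "hessian_norm ?e x \<le> \<kappa>2" if "x \<in> \<Omega>" for x
    using fam \<delta> that unfolding localization_family_def by blast+
  have C2: "Ck_on 2 \<Omega> ?e"
    using fam \<delta> unfolding localization_family_def Ck_closure_def by blast
  have \<delta>1: "\<delta> < 1" and "\<delta> < 1 / (9 * \<kappa>1\<^sup>2)" "\<delta> < 1 / (2 * \<kappa>b\<^sup>2)"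
    using \<delta> by (auto simp: delta0_def)
  then have \<kappa>1: "\<kappa>1\<^sup>2 * \<delta> \<le> (1/3)\<^sup>2" and \<kappa>b: "\<kappa>b\<^sup>2 * \<delta> < 1"
    using pos by (simp_all add: field_simps power2_eq_square)
  have sq: "(?e x)\<^sup>2 \<le> \<kappa>b\<^sup>2 * (min \<delta> ((?d x)\<^sup>2))\<^sup>2" if "x \<in> \<Omega>" for x
    using power_mono[OF e_le[OF that], of 2] e_pos[OF that] by (simp add: power_mult_distrib)
  \<comment> \<open>The minimum of \<delta> and the squared distance enters squared; one factor is
    estimated by \<delta> and the other by the squared distance.\<close>
  have e_less_dist: "?e x < ?d x" if x: "x \<in> \<Omega>" for x
  proof (rule power_less_imp_less_base)
    let ?m = "min \<delta> ((?d x)\<^sup>2)"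
    have "0 < \<kappa>b * ?m" using e_pos[OF x] e_le[OF x] by linarith
    then have m: "0 < ?m" using pos by (simp add: zero_less_mult_iff)
    have "(?e x)\<^sup>2 \<le> \<kappa>b\<^sup>2 * (?m * ?m)" using sq[OF x] by (simp add: power2_eq_square)
    also have "\<dots> \<le> \<kappa>b\<^sup>2 * (\<delta> * (?d x)\<^sup>2)"
      using m by (intro mult_left_mono mult_mono) auto
    also have "\<dots> = (\<kappa>b\<^sup>2 * \<delta>) * (?d x)\<^sup>2" by simp
    also have "\<dots> < 1 * (?d x)\<^sup>2" using \<kappa>b m by (intro mult_strict_right_mono) auto
    finally show "(?e x)\<^sup>2 < (?d x)\<^sup>2" by simp
  qed (rule infdist_nonneg)
  have reach: "y \<in> \<Omega>" if "x \<in> \<Omega>" "norm (y - x) \<le> ?e x" for x y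
    using that e_less_dist[OF that(1)] by (intro in_domain_if_near[OF that(1)]) simp
  show ?thesis
  proof
    show "open \<Omega>" "bounded \<Omega>" using \<Omega> by (auto simp: bounded_C2_domain_def)
    show "0 \<le> \<kappa>2" using pos by simp
    show "continuous_on \<Omega> (grad ?e)" using C2 continuous_on_grad[of 1] by (simp add: numeral_2_eq_2)
  next
    fix x assume x: "x \<in> \<Omega>"
    show "0 < ?e x" using x by (rule e_pos)
    show "?e x \<le> 1"
    proof (rule power2_le_imp_le)
      have "(?e x)\<^sup>2 \<le> \<kappa>b\<^sup>2 * (\<delta> * \<delta>)"
        using sq[OF x] \<delta> by (elim order_trans) (auto simp: power2_eq_square intro!: mult_left_mono mult_mono)
      also have "\<dots> = (\<kappa>b\<^sup>2 * \<delta>) * \<delta>" by simp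
      also have "\<dots> \<le> 1 * 1" using \<kappa>b \<delta> \<delta>1 by (intro mult_mono) auto
      finally show "(?e x)\<^sup>2 \<le> 1\<^sup>2" by simp
    qed simp
    show "(?e has_derivative (\<lambda>v. grad ?e x \<bullet> v)) (at x)"
      using C2 x by (intro has_derivative_grad) (auto simp: Ck_on_def dest: spec[of _ "[]"])
    have "\<kappa>1 * sqrt \<delta> \<le> 1/3"
    proof (rule power2_le_imp_le)
      show "(\<kappa>1 * sqrt \<delta>)\<^sup>2 \<le> (1/3)\<^sup>2" using \<kappa>1 \<delta> by (simp add: power_mult_distrib)
    qed simp
    then show "norm (grad ?e x) \<le> 1/3" using grad_le[OF x] by simp
  next
    fix x y assume "x \<in> \<Omega>" "norm (y - x) \<le> ?e x"
    then show "y \<in> \<Omega>" by (rule reach)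
  next
    fix x z :: 'a assume x: "x \<in> \<Omega>" and z: "norm z \<le> 1"
    show "?e (x + ?e x *\<^sub>R z) \<le> ?e x + ?e x * (grad ?e x \<bullet> z) + \<kappa>2 * (?e x)\<^sup>2 * (norm z)\<^sup>2"
    proof (rule second_order_upper_bound[OF C2 e_pos[OF x] _ hess_le])
      fix s assume s: "0 \<le> s" "s \<le> ?e x"
      have "s * norm z \<le> ?e x * 1" using s z by (intro mult_mono) auto
      then show "x + s *\<^sub>R z \<in> \<Omega>" using s by (intro reach[OF x]) simp
    qed
  qed
qed

section \<open>Closed subspaces and coercive forms\<close>

lemma dual_space_add: "f \<in> dual_space N X \<Longrightarrow> u \<in> X \<Longrightarrow> v \<in> X \<Longrightarrow> f (\<lambda>x. u x + v x) = f u + f v"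
  and dual_space_scale: "f \<in> dual_space N X \<Longrightarrow> u \<in> X \<Longrightarrow> f (\<lambda>x. c * u x) = c * f u"
  by (auto simp: dual_space_def)

text \<open>\<open>dual_norm\<close> is a supremum of reals, so boundedness has to be checked before
  it has a meaning. As \<open>N\<close> may vanish on nonzero functions, normalization is impossible
  there; on such functions \<open>f\<close> is zero because it is bounded by a multiple of
  \<open>N\<close>.\<close>

lemma dual_norm_bounds:
  assumes f: "f \<in> dual_space N X" and X: "function_subspace X"
    and N: "\<And>u. 0 \<le> N u" "\<And>c u. u \<in> X \<Longrightarrow> N (\<lambda>x. c * u x) = \<bar>c\<bar> * N u"
  shows "0 \<le> dual_norm N X f" and "u \<in> X \<Longrightarrow> \<bar>f u\<bar> \<le> dual_norm N X f * N u"
proof -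
  obtain K where K: "\<And>u. u \<in> X \<Longrightarrow> \<bar>f u\<bar> \<le> K * N u" using f unfolding dual_space_def by blast
  have bdd: "bdd_above ((\<lambda>v. \<bar>f v\<bar>) ` {v \<in> X. N v \<le> 1})"
  proof (rule bdd_aboveI2)
    fix v assume v: "v \<in> {v \<in> X. N v \<le> 1}"
    have "\<bar>f v\<bar> \<le> K * N v" using v by (auto intro: K)
    also have "\<dots> \<le> \<bar>K\<bar> * 1" using v N(1)[of v] by (intro mult_mono) auto
    finally show "\<bar>f v\<bar> \<le> \<bar>K\<bar>" by simp
  qed
  have upper: "\<bar>f v\<bar> \<le> dual_norm N X f" if "v \<in> X" "N v \<le> 1" for v
    unfolding dual_norm_def using that by (intro cSUP_upper bdd) auto
  \<comment> \<open>Zero is written as a multiple, so that homogeneity yields its norm, about which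
    nothing else is assumed.\<close>
  have "(\<lambda>x. 0 * 0) \<in> X" using function_subspace_zero[OF X] by simp
  moreover have "N (\<lambda>x. 0 * 0) = 0" using N(2)[OF function_subspace_zero[OF X], of 0] by simp
  ultimately show nonneg: "0 \<le> dual_norm N X f"
    using upper[of "\<lambda>x. 0 * 0"] by simp
  show "\<bar>f u\<bar> \<le> dual_norm N X f * N u" if u: "u \<in> X"
  proof (cases "N u = 0")
    case True
    then show ?thesis using K[OF u] by simp
  next
    case False
    then have pos: "0 < N u" using N(1)[of u] by simp
    have "\<bar>f (\<lambda>x. (1 / N u) * u x)\<bar> \<le> dual_norm N X f"
    proof (rule upper[OF function_subspace_scale[OF X u]])
      show "N (\<lambda>x. (1 / N u) * u x) \<le> 1" unfolding N(2)[OF u] using pos by simp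
    qed
    then have "\<bar>(1 / N u) * f u\<bar> \<le> dual_norm N X f" unfolding dual_space_scale[OF f u] .
    then show ?thesis using pos by (simp add: abs_mult field_simps)
  qed
qed

lemma ennreal_quarters:
  assumes "0 \<le> \<epsilon>"
  shows "2 * ennreal (\<epsilon> / 4) + 2 * ennreal (\<epsilon> / 4) = ennreal \<epsilon>"
proof -
  have "2 * ennreal (\<epsilon> / 4) = ennreal (\<epsilon> / 2)" using ennreal_mult'[of 2 "\<epsilon> / 4"] by simp
  then show ?thesis using ennreal_plus[of "\<epsilon> / 2" "\<epsilon> / 2"] assms by simp
qed

section \<open>Closed subspaces: completeness, projection, weak closedness\<close>

context kernel_form
begin

definition form_norm :: "('b \<Rightarrow> real) \<Rightarrow> real" where
  "form_norm u = sqrt (enn2real (norm_sq u))"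

lemma semi_inner_product_inner_form:
  assumes "function_subspace V" "V \<subseteq> finite_norm"
  shows "semi_inner_product V inner_form"
  using assms by unfold_locales (auto intro: inner_form_commute inner_form_add inner_form_scale inner_form_nonneg)

lemma semi_inner_product_energy:
  assumes "function_subspace V" "V \<subseteq> finite_norm"
  shows "semi_inner_product V energy"
  using assms by unfold_locales (auto intro: energy_commute energy_add energy_scale energy_nonneg)

lemma form_norm_inner_form: "u \<in> finite_norm \<Longrightarrow> form_norm u = sqrt (inner_form u u)"
  by (simp add: form_norm_def ennreal_inner_form[symmetric] inner_form_nonneg)

lemma form_norm_nonneg: "0 \<le> form_norm u" by (simp add: form_norm_def)

lemma form_norm_scale:
  assumes "u \<in> finite_norm"
  shows "form_norm (\<lambda>x. c * u x) = \<bar>c\<bar> * form_norm u"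
  using finite_normD(1)[OF assms]
  by (simp add: form_norm_def norm_sq_scale enn2real_mult real_sqrt_mult)

lemma inner_form_bound:
  assumes "u \<in> finite_norm" "v \<in> finite_norm"
  shows "\<bar>inner_form u v\<bar> \<le> form_norm u * form_norm v"
  using semi_inner_product.cauchy_schwarz[OF semi_inner_product_inner_form[OF function_subspace_finite_norm order_refl] assms]
  by (simp add: form_norm_inner_form assms)

text \<open>Membership only sees squared norms of differences, so the closure is stable under
  changes on null sets. It is taken among all measurable functions; finiteness of the norm then
  follows from that of the approximants.\<close>

definition form_closure :: "('b \<Rightarrow> real) set \<Rightarrow> ('b \<Rightarrow> real) set" where
  "form_closure T = {u \<in> borel_measurable M. \<forall>\<epsilon>::real. 0 < \<epsilon> \<longrightarrow> (\<exists>\<phi>\<in>T. norm_sq (\<lambda>x. u x - \<phi> x) \<le> ennreal \<epsilon>)}"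

lemma form_closure_approx:
  "u \<in> form_closure T \<Longrightarrow> 0 < \<epsilon> \<Longrightarrow> \<exists>\<phi>\<in>T. norm_sq (\<lambda>x. u x - \<phi> x) \<le> ennreal \<epsilon>"
  by (simp add: form_closure_def)

text \<open>For squared norms each of two summands costs a factor 2, which explains the quarters of
  the tolerance.\<close>

lemma norm_sq_triangle:
  assumes "u \<in> borel_measurable M" "v \<in> borel_measurable M" "w \<in> borel_measurable M"
    and "norm_sq (\<lambda>x. u x - v x) \<le> ennreal (\<epsilon> / 4)" "norm_sq (\<lambda>x. v x - w x) \<le> ennreal (\<epsilon> / 4)" "0 \<le> \<epsilon>"
  shows "norm_sq (\<lambda>x. u x - w x) \<le> ennreal \<epsilon>"
proof -
  have "norm_sq (\<lambda>x. u x - w x) = norm_sq (\<lambda>x. (u x - v x) + (v x - w x))" by simp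
  also have "\<dots> \<le> 2 * norm_sq (\<lambda>x. u x - v x) + 2 * norm_sq (\<lambda>x. v x - w x)"
    using assms by (intro norm_sq_add_le) auto
  also have "\<dots> \<le> 2 * ennreal (\<epsilon> / 4) + 2 * ennreal (\<epsilon> / 4)"
    using assms by (intro add_mono mult_left_mono) auto
  also have "\<dots> = ennreal \<epsilon>" using assms(6) by (rule ennreal_quarters)
  finally show ?thesis .
qed

context
  fixes T assumes T: "function_subspace T" "T \<subseteq> finite_norm"
begin

lemma form_closure_subset_finite_norm: "form_closure T \<subseteq> finite_norm"
proof
  fix u assume u: "u \<in> form_closure T"
  then obtain \<phi> where \<phi>: "\<phi> \<in> T" "norm_sq (\<lambda>x. u x - \<phi> x) \<le> ennreal 1"
    using form_closure_approx[of u T 1] by auto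
  have [measurable]: "u \<in> borel_measurable M" "\<phi> \<in> borel_measurable M"
    using u \<phi> T by (auto simp: form_closure_def dest: finite_normD)
  have "(\<lambda>x. u x - \<phi> x) \<in> finite_norm"
    using le_less_trans[OF \<phi>(2) ennreal_less_top] by (simp add: finite_norm_def)
  then show "u \<in> finite_norm"
    using function_subspace_add[OF function_subspace_finite_norm, of "\<lambda>x. u x - \<phi> x" \<phi>] \<phi> T by auto
qed

lemma form_closure_measurable: "u \<in> form_closure T \<Longrightarrow> u \<in> borel_measurable M"
  by (simp add: form_closure_def)

lemma subset_form_closure: "T \<subseteq> form_closure T"
proof
  fix u assume "u \<in> T"
  moreover have "norm_sq (\<lambda>x. u x - u x) = 0" by (simp add: norm_sq_def energy_sq_def)
  ultimately show "u \<in> form_closure T"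
    using T unfolding form_closure_def by (auto dest: finite_normD intro!: bexI[of _ u])
qed

lemma form_closure_closed:
  assumes u: "u \<in> borel_measurable M"
    and approx: "\<And>\<epsilon>::real. 0 < \<epsilon> \<Longrightarrow> \<exists>w\<in>form_closure T. norm_sq (\<lambda>x. u x - w x) \<le> ennreal \<epsilon>"
  shows "u \<in> form_closure T"
proof -
  have "\<exists>\<phi>\<in>T. norm_sq (\<lambda>x. u x - \<phi> x) \<le> ennreal \<epsilon>" if \<epsilon>: "0 < \<epsilon>" for \<epsilon> :: real
  proof -
    obtain w where w: "w \<in> form_closure T" "norm_sq (\<lambda>x. u x - w x) \<le> ennreal (\<epsilon> / 4)"
      using approx[of "\<epsilon> / 4"] \<epsilon> by auto
    obtain \<phi> where \<phi>: "\<phi> \<in> T" "norm_sq (\<lambda>x. w x - \<phi> x) \<le> ennreal (\<epsilon> / 4)"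
      using form_closure_approx[OF w(1), of "\<epsilon> / 4"] \<epsilon> by auto
    have "norm_sq (\<lambda>x. u x - \<phi> x) \<le> ennreal \<epsilon>"
      using w \<phi> u \<epsilon> T by (intro norm_sq_triangle[of u w \<phi>]) (auto dest: finite_normD form_closure_measurable)
    then show ?thesis using \<phi> by blast
  qed
  then show ?thesis using u by (simp add: form_closure_def)
qed

lemma function_subspace_form_closure: "function_subspace (form_closure T)"
  unfolding function_subspace_def
proof (intro conjI ballI allI)
  show "(\<lambda>x. 0) \<in> form_closure T" using subset_form_closure function_subspace_zero[OF T(1)] by blast
next
  fix u v assume u: "u \<in> form_closure T" and v: "v \<in> form_closure T"
  note [measurable] = form_closure_measurable[OF u] form_closure_measurable[OF v]
  have "\<exists>\<phi>\<in>T. norm_sq (\<lambda>x. u x + v x - \<phi> x) \<le> ennreal \<epsilon>" if \<epsilon>: "0 < \<epsilon>" for \<epsilon> :: real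
  proof -
    obtain \<phi> \<psi> where \<phi>: "\<phi> \<in> T" "norm_sq (\<lambda>x. u x - \<phi> x) \<le> ennreal (\<epsilon> / 4)"
      and \<psi>: "\<psi> \<in> T" "norm_sq (\<lambda>x. v x - \<psi> x) \<le> ennreal (\<epsilon> / 4)"
      using form_closure_approx[OF u, of "\<epsilon> / 4"] form_closure_approx[OF v, of "\<epsilon> / 4"] \<epsilon> by auto
    have [measurable]: "\<phi> \<in> borel_measurable M" "\<psi> \<in> borel_measurable M"
      using \<phi> \<psi> T by (auto dest: finite_normD)
    have "norm_sq (\<lambda>x. u x + v x - (\<phi> x + \<psi> x)) = norm_sq (\<lambda>x. (u x - \<phi> x) + (v x - \<psi> x))"
      by (rule arg_cong[where f = norm_sq]) auto
    also have "\<dots> \<le> 2 * norm_sq (\<lambda>x. u x - \<phi> x) + 2 * norm_sq (\<lambda>x. v x - \<psi> x)"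
      by (intro norm_sq_add_le) measurable
    also have "\<dots> \<le> 2 * ennreal (\<epsilon> / 4) + 2 * ennreal (\<epsilon> / 4)"
      using \<phi> \<psi> by (intro add_mono mult_left_mono) auto
    also have "\<dots> = ennreal \<epsilon>" using \<epsilon> by (intro ennreal_quarters) simp
    finally have "norm_sq (\<lambda>x. u x + v x - (\<phi> x + \<psi> x)) \<le> ennreal \<epsilon>" .
    then show ?thesis
      by (rule bexI[of _ "\<lambda>x. \<phi> x + \<psi> x"]) (rule function_subspace_add[OF T(1) \<phi>(1) \<psi>(1)])
  qed
  then show "(\<lambda>x. u x + v x) \<in> form_closure T" unfolding form_closure_def by simp
next
  fix c u assume u: "u \<in> form_closure T"
  note [measurable] = form_closure_measurable[OF u]
  have "\<exists>\<phi>\<in>T. norm_sq (\<lambda>x. c * u x - \<phi> x) \<le> ennreal \<epsilon>" if \<epsilon>: "0 < \<epsilon>" for \<epsilon> :: real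
  proof -
    have "0 < \<epsilon> / (c\<^sup>2 + 1)" using \<epsilon> by (intro divide_pos_pos) (auto intro: add_nonneg_pos)
    then obtain \<phi> where \<phi>: "\<phi> \<in> T" "norm_sq (\<lambda>x. u x - \<phi> x) \<le> ennreal (\<epsilon> / (c\<^sup>2 + 1))"
      using form_closure_approx[OF u] by blast
    have [measurable]: "\<phi> \<in> borel_measurable M" using \<phi> T by (auto dest: finite_normD)
    have "norm_sq (\<lambda>x. c * u x - c * \<phi> x) = norm_sq (\<lambda>x. c * (u x - \<phi> x))"
      by (simp add: algebra_simps)
    also have "\<dots> = ennreal (c\<^sup>2) * norm_sq (\<lambda>x. u x - \<phi> x)" by (rule norm_sq_scale) measurable
    also have "\<dots> \<le> ennreal (c\<^sup>2) * ennreal (\<epsilon> / (c\<^sup>2 + 1))" using \<phi> by (intro mult_left_mono) auto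
    also have "\<dots> \<le> ennreal \<epsilon>"
    proof -
      have "c\<^sup>2 * (\<epsilon> / (c\<^sup>2 + 1)) = \<epsilon> * (c\<^sup>2 / (c\<^sup>2 + 1))" by simp
      also have "\<dots> \<le> \<epsilon> * 1"
        using \<epsilon> by (intro mult_left_mono) (auto simp: divide_le_eq_1 add_nonneg_pos)
      finally show ?thesis by (simp add: ennreal_mult'[symmetric] ennreal_leI)
    qed
    finally have "norm_sq (\<lambda>x. c * u x - c * \<phi> x) \<le> ennreal \<epsilon>" .
    then show ?thesis
      by (rule bexI[of _ "\<lambda>x. c * \<phi> x"]) (rule function_subspace_scale[OF T(1) \<phi>(1)])
  qed
  then show "(\<lambda>x. c * u x) \<in> form_closure T" unfolding form_closure_def by simp
qed

lemma form_closure_complete: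
  assumes X: "\<And>n::nat. X n \<in> form_closure T"
    and cauchy: "\<And>\<epsilon>::real. 0 < \<epsilon> \<Longrightarrow> \<exists>N. \<forall>m\<ge>N. \<forall>n\<ge>N. norm_sq (\<lambda>x. X m x - X n x) \<le> ennreal \<epsilon>"
  shows "\<exists>u\<in>form_closure T. \<forall>\<epsilon>::real. 0 < \<epsilon> \<longrightarrow> (\<exists>N. \<forall>n\<ge>N. norm_sq (\<lambda>x. X n x - u x) \<le> ennreal \<epsilon>)"
proof -
  obtain u where u: "u \<in> finite_norm"
    and lim: "\<And>\<epsilon>::real. 0 < \<epsilon> \<Longrightarrow> \<exists>N. \<forall>n\<ge>N. norm_sq (\<lambda>x. X n x - u x) \<le> ennreal \<epsilon>"
    using complete[of X] X form_closure_subset_finite_norm cauchy by blast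
  have "u \<in> form_closure T"
  proof (rule form_closure_closed)
    show "\<exists>w\<in>form_closure T. norm_sq (\<lambda>x. u x - w x) \<le> ennreal \<epsilon>" if "0 < \<epsilon>" for \<epsilon> :: real
    proof -
      obtain N where "norm_sq (\<lambda>x. X N x - u x) \<le> ennreal \<epsilon>" using lim[OF \<open>0 < \<epsilon>\<close>] by blast
      then show ?thesis using X norm_sq_minus_commute[of u "X N"] by (intro bexI[of _ "X N"]) auto
    qed
  qed (use u finite_normD in auto)
  with lim show ?thesis by blast
qed

text \<open>The two-sided bound makes \<open>G\<close> equivalent to the squared norm, so
  completeness carries over. It is used for the nonlocal form, to solve the equation, and for
  \<open>inner_form\<close>, to obtain orthogonal projections.\<close>

lemma riesz_form_closure:
  assumes G: "semi_inner_product (form_closure T) G"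
    and upper: "\<And>u. u \<in> form_closure T \<Longrightarrow> ennreal (G u u) \<le> ennreal C * norm_sq u" and C: "0 \<le> C"
    and lower: "\<And>u. u \<in> form_closure T \<Longrightarrow> norm_sq u \<le> ennreal c * ennreal (G u u)" and c: "0 \<le> c"
    and f: "\<And>u v. u \<in> form_closure T \<Longrightarrow> v \<in> form_closure T \<Longrightarrow> f (\<lambda>x. u x + v x) = f u + f v"
      "\<And>t u. u \<in> form_closure T \<Longrightarrow> f (\<lambda>x. t * u x) = t * f u"
      "\<And>u. u \<in> form_closure T \<Longrightarrow> \<bar>f u\<bar> \<le> L * sqrt (G u u)"
  shows "\<exists>u\<in>form_closure T. \<forall>v\<in>form_closure T. G u v = f v"
proof -
  interpret G: semi_inner_product "form_closure T" G by (rule G)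
  note diff_mem = function_subspace_diff[OF G.subspace]
  show ?thesis
  proof (rule G.riesz[OF _ f])
    fix X :: "nat \<Rightarrow> 'b \<Rightarrow> real"
    assume X: "\<And>n. X n \<in> form_closure T"
      and cauchy: "\<And>\<epsilon>::real. 0 < \<epsilon> \<Longrightarrow> \<exists>N. \<forall>m\<ge>N. \<forall>n\<ge>N. G (\<lambda>x. X m x - X n x) (\<lambda>x. X m x - X n x) < \<epsilon>"
    have "\<exists>N. \<forall>m\<ge>N. \<forall>n\<ge>N. norm_sq (\<lambda>x. X m x - X n x) \<le> ennreal \<epsilon>" if \<epsilon>: "0 < \<epsilon>" for \<epsilon> :: real
    proof -
      \<comment> \<open>Dividing by \<open>c + 1\<close> avoids a special case for
        \<open>c = 0\<close>.\<close>
      have "0 < \<epsilon> / (c + 1)" using \<epsilon> c by simp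
      then obtain N where N: "\<And>m n. N \<le> m \<Longrightarrow> N \<le> n \<Longrightarrow> G (\<lambda>x. X m x - X n x) (\<lambda>x. X m x - X n x) < \<epsilon> / (c + 1)"
        using cauchy by blast
      have "norm_sq (\<lambda>x. X m x - X n x) \<le> ennreal \<epsilon>" if "N \<le> m" "N \<le> n" for m n
      proof -
        let ?d = "\<lambda>x. X m x - X n x"
        have d: "?d \<in> form_closure T" using X by (intro diff_mem)
        have "norm_sq ?d \<le> ennreal (c * G ?d ?d)" using lower[OF d] c by (simp add: ennreal_mult')
        also have "\<dots> \<le> ennreal \<epsilon>"
        proof (rule ennreal_leI)
          have "c * G ?d ?d \<le> (c + 1) * (\<epsilon> / (c + 1))"
            using N[OF that] c G.nonneg[OF d] by (intro mult_mono) auto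
          then show "c * G ?d ?d \<le> \<epsilon>" using c by simp
        qed
        finally show ?thesis .
      qed
      then show ?thesis by blast
    qed
    from form_closure_complete[OF X this] obtain u where u: "u \<in> form_closure T"
      and lim: "\<And>\<epsilon>::real. 0 < \<epsilon> \<Longrightarrow> \<exists>N. \<forall>n\<ge>N. norm_sq (\<lambda>x. X n x - u x) \<le> ennreal \<epsilon>" by blast
    have "(\<lambda>n. G (\<lambda>x. X n x - u x) (\<lambda>x. X n x - u x)) \<longlonglongrightarrow> 0"
    proof (rule LIMSEQ_I)
      fix \<epsilon> :: real assume \<epsilon>: "0 < \<epsilon>"
      then have "0 < \<epsilon> / (C + 1)" using C by simp
      then obtain N where N: "\<And>n. N \<le> n \<Longrightarrow> norm_sq (\<lambda>x. X n x - u x) \<le> ennreal (\<epsilon> / (C + 1))"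
        using lim by blast
      have "norm (G (\<lambda>x. X n x - u x) (\<lambda>x. X n x - u x) - 0) < \<epsilon>" if "N \<le> n" for n
      proof -
        let ?d = "\<lambda>x. X n x - u x"
        have d: "?d \<in> form_closure T" using X u by (intro diff_mem)
        have "ennreal (G ?d ?d) \<le> ennreal C * ennreal (\<epsilon> / (C + 1))"
          by (rule order_trans[OF upper[OF d] mult_left_mono[OF N[OF that]]]) simp
        also have "\<dots> = ennreal (C * (\<epsilon> / (C + 1)))" using C by (rule ennreal_mult'[symmetric])
        finally have "G ?d ?d \<le> C * (\<epsilon> / (C + 1))" using C \<epsilon> by (subst (asm) ennreal_le_iff) auto
        also have "\<dots> < \<epsilon>" using C \<epsilon> by (simp add: field_simps)
        finally show ?thesis using G.nonneg[OF d] by simp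
      qed
      then show "\<exists>N. \<forall>n\<ge>N. norm (G (\<lambda>x. X n x - u x) (\<lambda>x. X n x - u x) - 0) < \<epsilon>" by blast
    qed
    with u show "\<exists>u\<in>form_closure T. (\<lambda>n. G (\<lambda>x. X n x - u x) (\<lambda>x. X n x - u x)) \<longlonglongrightarrow> 0" by blast
  qed
qed

text \<open>The orthogonal projection of \<open>u\<close> is the Riesz representative, within the
  closed subspace, of the functional given by the inner product with \<open>u\<close>.\<close>

lemma projection_exists:
  assumes u: "u \<in> finite_norm"
  shows "\<exists>p\<in>form_closure T. \<forall>v\<in>form_closure T. inner_form p v = inner_form u v"
proof (rule riesz_form_closure[where C = 1 and c = 1])
  note sub = form_closure_subset_finite_norm
  show "semi_inner_product (form_closure T) inner_form"
    by (rule semi_inner_product_inner_form[OF function_subspace_form_closure sub])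
  fix v assume "v \<in> form_closure T"
  then have v: "v \<in> finite_norm" using sub by auto
  show "ennreal (inner_form v v) \<le> ennreal 1 * norm_sq v" "norm_sq v \<le> ennreal 1 * ennreal (inner_form v v)"
    by (simp_all add: ennreal_inner_form[OF v])
  show "inner_form u (\<lambda>x. t * v x) = t * inner_form u v" for t
    using inner_form_scale[of t v u] by (simp add: inner_form_commute[of u])
  show "\<bar>inner_form u v\<bar> \<le> form_norm u * sqrt (inner_form v v)"
    using inner_form_bound[OF u v] v by (simp add: form_norm_inner_form)
  fix w assume "w \<in> form_closure T"
  then show "inner_form u (\<lambda>x. v x + w x) = inner_form u v + inner_form u w"
    using inner_form_add[of v w u] v sub u by (auto simp: inner_form_commute[of u])
qed auto

text \<open>A point \<open>u\<close> outside the subspace is separated from it by one functional,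
  the inner product with \<open>d = u - p\<close>, where \<open>p\<close> is the projection. It
  vanishes on the subspace, and at \<open>u\<close> it equals the squared norm of \<open>d\<close>,
  which is nonzero because otherwise \<open>u\<close> would lie in the closure.\<close>

lemma closedin_weak_topology_form_closure:
  assumes X: "form_closure T \<subseteq> X" "X \<subseteq> finite_norm"
  shows "closedin (weak_topology form_norm X) (form_closure T)"
proof -
  let ?S = "{{u \<in> X. f u \<in> U} | f U. f \<in> dual_space form_norm X \<and> open U}"
  have dual: "(\<lambda>w. inner_form w d) \<in> dual_space form_norm X" if d: "d \<in> finite_norm" for d
    unfolding dual_space_def
  proof (intro CollectI conjI ballI allI exI[of _ "form_norm d"])
    fix u v assume "u \<in> X" "v \<in> X"
    then show "inner_form (\<lambda>x. u x + v x) d = inner_form u d + inner_form v d"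
      using X(2) d by (intro inner_form_add) auto
  next
    fix u assume "u \<in> X"
    then show "\<bar>inner_form u d\<bar> \<le> form_norm d * form_norm u"
      using inner_form_bound[of u d] X(2) d by (auto simp: mult.commute)
  qed (rule inner_form_scale)
  have "(\<lambda>x. 0) \<in> finite_norm" by (rule function_subspace_zero[OF function_subspace_finite_norm])
  \<comment> \<open>Preimages of the whole real line make \<open>X\<close> one of the generating
    sets, so the topology lives on all of \<open>X\<close>.\<close>
  from dual[OF this] have "X \<in> ?S" by (intro CollectI exI[of _ "\<lambda>w. inner_form w (\<lambda>x. 0)"] exI[of _ UNIV]) auto
  then have top: "topspace (weak_topology form_norm X) = X"
    unfolding weak_topology_def topology_generated_by_topspace by blast
  have "openin (weak_topology form_norm X) (X - form_closure T)"
    unfolding openin_subopen[of _ "X - form_closure T"]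
  proof
    fix u assume u: "u \<in> X - form_closure T"
    then have fin_u: "u \<in> finite_norm" using X by auto
    obtain p where p: "p \<in> form_closure T" and orth: "\<And>v. v \<in> form_closure T \<Longrightarrow> inner_form p v = inner_form u v"
      using projection_exists[OF fin_u] by blast
    define d where "d = (\<lambda>x. u x - p x)"
    have fin_p: "p \<in> finite_norm" using p form_closure_subset_finite_norm by auto
    have d: "d \<in> finite_norm"
      unfolding d_def by (rule function_subspace_diff[OF function_subspace_finite_norm fin_u fin_p])
    interpret semi_inner_product finite_norm inner_form
      by (rule semi_inner_product_inner_form[OF function_subspace_finite_norm order_refl])
    have zero: "inner_form v d = 0" if "v \<in> form_closure T" for v
      using diff[OF fin_u fin_p, of v] orth[OF that] that form_closure_subset_finite_norm
      by (auto simp: inner_form_commute[of v] d_def)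
    have "inner_form u d \<noteq> 0"
    proof
      assume "inner_form u d = 0"
      then have "inner_form d d = 0"
        using diff[OF fin_u fin_p d] zero[OF p] by (simp add: d_def)
      then have "norm_sq (\<lambda>x. u x - p x) = 0"
        using ennreal_inner_form[OF d] by (simp add: d_def)
      then have "u \<in> form_closure T"
        using finite_normD(1)[OF fin_u] by (intro form_closure_closed bexI[OF _ p]) auto
      with u show False by blast
    qed
    then have "u \<in> {w \<in> X. inner_form w d \<in> - {0}}" using u by auto
    moreover have "{w \<in> X. inner_form w d \<in> - {0}} \<subseteq> X - form_closure T" using zero by auto
    moreover have "openin (weak_topology form_norm X) {w \<in> X. inner_form w d \<in> - {0}}"
      unfolding weak_topology_def
      by (rule topology_generated_by_Basis)
        (intro CollectI exI[of _ "\<lambda>w. inner_form w d"] exI[of _ "- {0}"] conjI refl dual d, auto)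
    ultimately show "\<exists>T'. openin (weak_topology form_norm X) T' \<and> u \<in> T' \<and> T' \<subseteq> X - form_closure T"
      by blast
  qed
  then show ?thesis using X top by (simp add: closedin_def)
qed

end

end

text \<open>The kernel \<open>k\<close> gives the norm and \<open>b\<close> the equation. The upper
  bound makes the energy finite and continuous on \<open>H\<close>; the constant in the estimate is
  the coercivity constant \<open>c\<close> alone, obtained by testing the equation with
  \<open>u\<close> itself and cancelling one factor \<open>N u\<close>. Uniqueness is almost
  everywhere, because coercivity also controls the \<open>L2\<close> part.\<close>

lemma coercive_form_solvable:
  assumes W: "kernel_form M k" and B: "kernel_form M b"
    and T: "function_subspace T" "T \<subseteq> kernel_form.finite_norm M k"
  defines "H \<equiv> kernel_form.form_closure M k T" and "N \<equiv> kernel_form.form_norm M k"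
  assumes upper: "\<And>u. u \<in> H \<Longrightarrow> kernel_form.energy_sq M b u \<le> ennreal C * kernel_form.norm_sq M k u"
    and lower: "\<And>u. u \<in> H \<Longrightarrow> kernel_form.norm_sq M k u \<le> ennreal c * kernel_form.energy_sq M b u"
    and c: "0 \<le> c" and C: "0 \<le> C"
    and f: "f \<in> dual_space N H"
  shows "\<exists>u\<in>H. (\<forall>v\<in>H. kernel_form.energy M b u v = f v)
    \<and> (\<forall>w\<in>H. (\<forall>v\<in>H. kernel_form.energy M b w v = f v) \<longrightarrow> (AE x in M. w x = u x))
    \<and> N u \<le> c * dual_norm N H f"
proof -
  interpret W: kernel_form M k by (rule W)
  interpret B: kernel_form M b by (rule B)
  have H_W: "H \<subseteq> W.finite_norm" unfolding H_def by (rule W.form_closure_subset_finite_norm[OF T])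
  have H: "function_subspace H" unfolding H_def by (rule W.function_subspace_form_closure[OF T])
  have H_B: "H \<subseteq> B.finite_norm"
  proof
    fix u assume u: "u \<in> H"
    then have uW: "u \<in> W.finite_norm" using H_W by auto
    then have "W.norm_sq u < \<infinity>" by (simp add: W.finite_norm_def)
    then have "B.energy_sq u < \<infinity>"
      using upper[OF u] by (auto simp: ennreal_mult_less_top elim!: le_less_trans)
    then show "u \<in> B.finite_norm"
      using W.finite_normD[OF uW] by (simp add: B.finite_norm_def B.norm_sq_def)
  qed
  have energy_eq: "B.energy_sq v = ennreal (B.energy v v)" if "v \<in> H" for v
    using B.ennreal_energy[of v] that H_B by auto
  interpret S: semi_inner_product H B.energy by (rule B.semi_inner_product_energy[OF H H_B])
  have lower': "(N u)\<^sup>2 \<le> c * B.energy u u" if u: "u \<in> H" for u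
  proof -
    have "W.norm_sq u \<le> ennreal (c * B.energy u u)"
      using lower[OF u] B.ennreal_energy[of u] u H_B c by (auto simp: ennreal_mult' B.energy_nonneg)
    then have "enn2real (W.norm_sq u) \<le> c * B.energy u u"
      using c B.energy_nonneg by (intro enn2real_leI) auto
    then show ?thesis by (simp add: N_def W.form_norm_def)
  qed
  have N_scale: "N (\<lambda>x. t * u x) = \<bar>t\<bar> * N u" if "u \<in> H" for t u
    using that H_W W.form_norm_scale by (auto simp: N_def)
  have N_nonneg: "0 \<le> N u" for u by (simp add: N_def W.form_norm_nonneg)
  have bounds: "0 \<le> dual_norm N H f" "\<And>u. u \<in> H \<Longrightarrow> \<bar>f u\<bar> \<le> dual_norm N H f * N u"
    using dual_norm_bounds[OF f H] N_nonneg N_scale by blast+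
  have "\<exists>u\<in>H. \<forall>v\<in>H. B.energy u v = f v"
  proof (rule W.riesz_form_closure[OF T _ _ C _ c, folded H_def])
    show "semi_inner_product H B.energy" by unfold_locales
    fix u assume u: "u \<in> H"
    show "ennreal (B.energy u u) \<le> ennreal C * W.norm_sq u" "W.norm_sq u \<le> ennreal c * ennreal (B.energy u u)"
      using upper[OF u] lower[OF u] by (simp_all add: energy_eq[OF u])
    have "N u \<le> sqrt (c * B.energy u u)" using lower'[OF u] by (rule real_le_rsqrt)
    then have "dual_norm N H f * N u \<le> dual_norm N H f * (sqrt c * sqrt (B.energy u u))"
      using bounds(1) by (intro mult_left_mono) (auto simp: real_sqrt_mult)
    then show "\<bar>f u\<bar> \<le> dual_norm N H f * sqrt c * sqrt (B.energy u u)"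
      using bounds(2)[OF u] by simp
  qed (use f in \<open>auto intro: dual_space_add dual_space_scale\<close>)
  then obtain u where u: "u \<in> H" and sol: "\<And>v. v \<in> H \<Longrightarrow> B.energy u v = f v" by blast
  have "AE x in M. w x = u x" if w: "w \<in> H" and sol_w: "\<And>v. v \<in> H \<Longrightarrow> B.energy w v = f v" for w
  proof -
    let ?d = "\<lambda>x. w x - u x"
    have d: "?d \<in> H" using w u by (rule function_subspace_diff[OF H])
    have "B.energy ?d ?d = 0" using S.diff[OF w u d] sol[OF d] sol_w[OF d] by simp
    then have "B.energy_sq ?d = 0" using B.ennreal_energy[of ?d] d H_B by auto
    then have "W.norm_sq ?d = 0" using lower[OF d] by simp
    then have "(\<integral>\<^sup>+x. ennreal ((?d x)\<^sup>2) \<partial>M) = 0" by (simp add: W.norm_sq_def)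
    moreover have "?d \<in> borel_measurable M" using d H_W W.finite_normD by auto
    ultimately have "AE x in M. ennreal ((?d x)\<^sup>2) = 0" by (subst (asm) nn_integral_0_iff_AE) auto
    then show ?thesis by eventually_elim simp
  qed
  moreover have "N u \<le> c * dual_norm N H f"
  proof (cases "N u = 0")
    case True
    then show ?thesis using c bounds(1) by simp
  next
    case False
    then have pos: "0 < N u" using N_nonneg[of u] by simp
    have "(N u)\<^sup>2 \<le> c * f u" using lower'[OF u] sol[OF u] by simp
    also have "\<dots> \<le> c * (dual_norm N H f * N u)"
      using c bounds(2)[OF u] by (intro mult_left_mono) auto
    finally show ?thesis using pos by (simp add: power2_eq_square)
  qed
  ultimately show ?thesis using u sol by blast
qed

section \<open>The nonlocal form\<close>

lemma finite_measure_leb_on: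
  assumes "open \<Omega>" "bounded (\<Omega> :: 'a::euclidean_space set)"
  shows "finite_measure (leb_on \<Omega>)"
proof
  have "emeasure (leb_on \<Omega>) (space (leb_on \<Omega>)) = emeasure lborel \<Omega>"
    using assms by (subst emeasure_restrict_space) (auto simp: space_restrict_space)
  also have "\<dots> < \<infinity>" using emeasure_bounded_finite[OF assms(2)] by simp
  finally show "emeasure (leb_on \<Omega>) (space (leb_on \<Omega>)) \<noteq> \<infinity>" by simp
qed

lemma measurable_pair_leb_on:
  assumes "(\<lambda>p. k (fst p) (snd p)) \<in> borel_measurable (borel \<Otimes>\<^sub>M borel)"
  shows "(\<lambda>p. k (fst p) (snd p)) \<in> borel_measurable (leb_on \<Omega> \<Otimes>\<^sub>M leb_on \<Omega>)"
proof -
  have id: "(\<lambda>x. x) \<in> leb_on \<Omega> \<rightarrow>\<^sub>M borel" by (intro measurable_restrict_space1) auto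
  have "(\<lambda>p. (fst p, snd p)) \<in> leb_on \<Omega> \<Otimes>\<^sub>M leb_on \<Omega> \<rightarrow>\<^sub>M borel \<Otimes>\<^sub>M borel"
    by (intro measurable_Pair measurable_compose[OF measurable_fst id] measurable_compose[OF measurable_snd id])
  from measurable_compose[OF this assms] show ?thesis by simp
qed

lemma admissible_kernel_bounds:
  assumes "admissible_kernel \<rho>"
  shows "\<exists>\<rho>0 r0 S. 0 < \<rho>0 \<and> 0 < r0 \<and> 0 \<le> S \<and> continuous_on {0..} \<rho> \<and> (\<forall>r\<ge>0. 0 \<le> \<rho> r \<and> \<rho> r \<le> S)
    \<and> (\<forall>r\<in>{0..r0}. \<rho>0 \<le> \<rho> r) \<and> (\<forall>r>1. \<rho> r = 0)"
proof -
  obtain \<rho>0 r0 R0 \<rho>' where c: "0 < \<rho>0" "0 < r0" "R0 < 1"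
    and d: "\<And>r. 0 \<le> r \<Longrightarrow> (\<rho> has_real_derivative \<rho>' r) (at r within {0..})"
    and nonneg: "\<And>r. 0 \<le> r \<Longrightarrow> 0 \<le> \<rho> r" and supp: "closure {r. 0 \<le> r \<and> \<rho> r \<noteq> 0} \<subseteq> {0..<R0}"
    and low: "\<forall>r\<in>{0..r0}. \<rho>0 \<le> \<rho> r"
    using assms unfolding admissible_kernel_def by blast
  have zero: "\<rho> r = 0" if "1 < r" for r
  proof (rule ccontr)
    assume "\<rho> r \<noteq> 0"
    then have "r \<in> closure {r. 0 \<le> r \<and> \<rho> r \<noteq> 0}" using that by (intro subsetD[OF closure_subset]) simp
    then show False using supp that c by auto
  qed
  have cont: "continuous_on {0..} \<rho>"
    unfolding continuous_on_eq_continuous_within using d by (auto intro: DERIV_continuous)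
  have "bounded (\<rho> ` {0..1})"
    by (intro compact_imp_bounded compact_continuous_image continuous_on_subset[OF cont]) auto
  then obtain S where S: "0 < S" "\<And>r. r \<in> {0..1} \<Longrightarrow> norm (\<rho> r) \<le> S"
    by (auto simp: bounded_pos)
  have "\<rho> r \<le> S" if "0 \<le> r" for r
  proof (cases "r \<le> 1")
    case True
    then show ?thesis using S(2)[of r] that by auto
  next
    case False
    then show ?thesis using zero[of r] S by simp
  qed
  then show ?thesis
    using c S cont nonneg low zero by (intro exI[of _ \<rho>0] exI[of _ r0] exI[of _ S]) auto
qed

section \<open>Comparison of the nonlocal form, the seminorm and the gradient norm\<close>

context horizon
begin

lemma kernel_form_jump: "kernel_form (leb_on \<Omega>) (jump_kernel r)"
proof -
  interpret finite_measure "leb_on \<Omega>" by (rule finite_measure_leb_on[OF open_domain bounded_domain])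
  show ?thesis
    by unfold_locales (auto intro: measurable_pair_leb_on[OF jump_kernel_measurable] jump_kernel_nonneg)
qed

lemma W_seminorm_sq_eq: "W_seminorm_sq r e \<Omega> u = kernel_form.energy_sq (leb_on \<Omega>) (jump_kernel r) u"
  unfolding W_seminorm_sq_def kernel_form.energy_sq_def[OF kernel_form_jump]
  by (intro nn_integral_cong)
    (auto simp: jump_kernel_def space_restrict_space simp del: add_2_eq_Suc' split: split_indicator)

lemma W_norm_sq_eq: "W_norm_sq r e \<Omega> u = kernel_form.norm_sq (leb_on \<Omega>) (jump_kernel r) u"
  unfolding W_norm_sq_def kernel_form.norm_sq_def[OF kernel_form_jump] W_seminorm_sq_eq by simp

lemma W_norm_eq: "W_norm r e \<Omega> = kernel_form.form_norm (leb_on \<Omega>) (jump_kernel r)"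
  unfolding W_norm_def[abs_def] kernel_form.form_norm_def[OF kernel_form_jump, abs_def] W_norm_sq_eq by simp

lemma nn_integral_leb_on: "(\<integral>\<^sup>+x. f x \<partial>leb_on \<Omega>) = (\<integral>\<^sup>+x. f x * indicator \<Omega> x \<partial>lborel)"
  by (rule nn_integral_restrict_space) simp

lemma extend_measurable:
  fixes u :: "'a \<Rightarrow> real"
  assumes "u \<in> borel_measurable (leb_on \<Omega>)"
  shows "(\<lambda>x. indicator \<Omega> x * u x) \<in> borel_measurable borel"
  using assms borel_measurable_restrict_space_iff[of \<Omega> lborel u] by simp

text \<open>For \<open>r \<le> 1\<close> no jump from \<open>\<Omega>\<close> leaves
  \<open>\<Omega>\<close>, so extending by zero adds no interaction across the boundary. This
  connects integrals over \<open>\<Omega>\<close> with those over the whole space.\<close>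

lemma energy_sq_jump:
  assumes "r \<le> 1"
  shows "kernel_form.energy_sq (leb_on \<Omega>) (jump_kernel r) u = jump_energy r (\<lambda>x. indicator \<Omega> x * u x)"
  unfolding kernel_form.energy_sq_def[OF kernel_form_jump] jump_energy_def nn_integral_leb_on
proof (rule nn_integral_cong)
  fix x
  show "(\<integral>\<^sup>+y. ennreal (jump_kernel r x y * (u x - u y)\<^sup>2) * indicator \<Omega> y \<partial>lborel) * indicator \<Omega> x
    = (\<integral>\<^sup>+y. ennreal (jump_kernel r x y * (indicator \<Omega> x * u x - indicator \<Omega> y * u y)\<^sup>2) \<partial>lborel)"
  proof (cases "x \<in> \<Omega>")
    case True
    have "jump_kernel r x y = 0" if "y \<notin> \<Omega>" for y
    proof -
      have "r * e x \<le> 1 * e x" using assms pos[OF True] by (intro mult_right_mono) auto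
      then have "\<not> norm (y - x) \<le> r * e x" using reach[OF True, of y] that by auto
      then show ?thesis by (simp add: jump_kernel_def)
    qed
    then have "(\<integral>\<^sup>+y. ennreal (jump_kernel r x y * (u x - u y)\<^sup>2) * indicator \<Omega> y \<partial>lborel)
      = (\<integral>\<^sup>+y. ennreal (jump_kernel r x y * (indicator \<Omega> x * u x - indicator \<Omega> y * u y)\<^sup>2) \<partial>lborel)"
      using True by (intro nn_integral_cong) (auto split: split_indicator)
    then show ?thesis using True by simp
  qed (simp add: jump_kernel_def)
qed

text \<open>From below one of the two halves of the symmetrized kernel is enough, the other being
  nonnegative. From above both are present, and the half scaled with the horizon at \<open>y\<close>
  appears as the kernel with exchanged arguments. Radius 1 comes from the support of
  \<open>\<rho>\<close>.\<close>

lemma scaled_kernel_bounds: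
  assumes \<rho>: "\<And>r. 0 \<le> r \<Longrightarrow> 0 \<le> \<rho> r" "\<And>r. 0 \<le> r \<Longrightarrow> \<rho> r \<le> S" "\<And>r. 1 < r \<Longrightarrow> \<rho> r = 0" "0 \<le> S"
    and low: "\<And>s. 0 \<le> s \<Longrightarrow> s \<le> r \<Longrightarrow> \<rho>0 \<le> \<rho> s"
    and xy: "x \<in> \<Omega>" "y \<in> \<Omega>"
  shows "0 \<le> scaled_kernel \<rho> e 2 x y"
    and "\<rho>0 / 2 * jump_kernel r x y \<le> scaled_kernel \<rho> e 2 x y"
    and "scaled_kernel \<rho> e 2 x y \<le> S / 2 * jump_kernel 1 x y + S / 2 * jump_kernel 1 y x"
proof -
  define a where "a x y = 1 / e x ^ (DIM('a) + 2) * \<rho> (norm (y - x) / e x)" for x y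
  have a: "scaled_kernel \<rho> e 2 x y = 1/2 * (a x y + a y x)"
  proof -
    have "e w powr (real DIM('a) + 2) = e w ^ (DIM('a) + 2)" if "w \<in> \<Omega>" for w
      using powr_realpow[OF pos[OF that], of "DIM('a) + 2"] by (simp add: add.commute)
    then show ?thesis using xy by (simp add: scaled_kernel_def a_def norm_minus_commute)
  qed
  have a_bounds: "0 \<le> a x y \<and> a x y \<le> S * jump_kernel 1 x y" if x: "x \<in> \<Omega>" for x y
  proof -
    have ex: "0 < e x" using pos[OF x] .
    have "\<rho> (norm (y - x) / e x) = 0" if "\<not> norm (y - x) \<le> 1 * e x"
      using that ex by (intro \<rho>(3)) (simp add: field_simps)
    moreover have "1 / e x ^ (DIM('a) + 2) * \<rho> (norm (y - x) / e x) \<le> 1 / e x ^ (DIM('a) + 2) * S"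
      using ex by (intro mult_left_mono \<rho>(2)) auto
    ultimately show ?thesis
      using ex x \<rho>(1)[of "norm (y - x) / e x"] by (auto simp: a_def jump_kernel_def simp del: add_2_eq_Suc')
  qed
  show "0 \<le> scaled_kernel \<rho> e 2 x y" using a_bounds xy unfolding a by fastforce
  show "scaled_kernel \<rho> e 2 x y \<le> S / 2 * jump_kernel 1 x y + S / 2 * jump_kernel 1 y x"
    unfolding a using a_bounds[OF xy(1), of y] a_bounds[OF xy(2), of x] by simp
  have "\<rho>0 * jump_kernel r x y \<le> a x y"
  proof (cases "norm (y - x) \<le> r * e x")
    case True
    have ex: "0 < e x" using pos[OF xy(1)] .
    have "\<rho>0 \<le> \<rho> (norm (y - x) / e x)" using True ex by (intro low) (auto simp: field_simps)
    then have "1 / e x ^ (DIM('a) + 2) * \<rho>0 \<le> a x y"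
      unfolding a_def using ex by (intro mult_left_mono) auto
    then show ?thesis using True xy by (simp add: jump_kernel_def del: add_2_eq_Suc')
  next
    case False
    then show ?thesis using a_bounds[OF xy(1), of y] by (simp add: jump_kernel_def)
  qed
  then show "\<rho>0 / 2 * jump_kernel r x y \<le> scaled_kernel \<rho> e 2 x y"
    unfolding a using a_bounds[OF xy(2), of x] by simp
qed

lemma kernel_form_scaled:
  assumes "continuous_on {0..} \<rho>" "\<And>x y. x \<in> \<Omega> \<Longrightarrow> y \<in> \<Omega> \<Longrightarrow> 0 \<le> scaled_kernel \<rho> e 2 x y"
  shows "kernel_form (leb_on \<Omega>) (scaled_kernel \<rho> e 2)"
proof -
  interpret finite_measure "leb_on \<Omega>" by (rule finite_measure_leb_on[OF open_domain bounded_domain])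
  let ?e = "\<lambda>x. indicator \<Omega> x * e x"
  \<comment> \<open>Nothing is known of \<open>\<rho>\<close> at negative arguments and of
    \<open>e\<close> outside \<open>\<Omega>\<close>; measurability is shown for a kernel
    \<open>k\<close> with both repaired, which agrees with the given one on pairs of points of
    \<open>\<Omega>\<close>.\<close>
  have "continuous_on UNIV (\<lambda>r. \<rho> (max 0 r))"
    by (rule continuous_on_compose2[OF assms(1)]) (auto intro!: continuous_intros)
  then have [measurable]: "(\<lambda>r. \<rho> (max 0 r)) \<in> borel_measurable borel" by (rule borel_measurable_continuous_onI)
  define k where "k x y = 1/2 * (1 / ?e x powr (real DIM('a) + 2) * \<rho> (max 0 (norm (y - x) / ?e x))
         + 1 / ?e y powr (real DIM('a) + 2) * \<rho> (max 0 (norm (y - x) / ?e y)))" for x y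
  have rho_meas: "(\<lambda>p. \<rho> (max 0 (g p))) \<in> borel_measurable N" if [measurable]: "g \<in> borel_measurable N" for g and N :: "'c measure"
    using measurable_compose[OF that \<open>(\<lambda>r. \<rho> (max 0 r)) \<in> borel_measurable borel\<close>] by simp
  have "(\<lambda>p. k (fst p) (snd p)) \<in> borel_measurable (borel \<Otimes>\<^sub>M borel)"
    unfolding k_def
    by (intro borel_measurable_add borel_measurable_times rho_meas borel_measurable_const) measurable
  then have "(\<lambda>p. k (fst p) (snd p)) \<in> borel_measurable (leb_on \<Omega> \<Otimes>\<^sub>M leb_on \<Omega>)"
    by (rule measurable_pair_leb_on)
  moreover have "k (fst p) (snd p) = scaled_kernel \<rho> e 2 (fst p) (snd p)"
    if "p \<in> space (leb_on \<Omega> \<Otimes>\<^sub>M leb_on \<Omega>)" for p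
  proof -
    have "fst p \<in> \<Omega>" "snd p \<in> \<Omega>" using that by (auto simp: space_pair_measure space_restrict_space)
    then show ?thesis
      using pos[of "fst p"] pos[of "snd p"] by (simp add: k_def scaled_kernel_def max_absorb2)
  qed
  ultimately have "(\<lambda>p. scaled_kernel \<rho> e 2 (fst p) (snd p)) \<in> borel_measurable (leb_on \<Omega> \<Otimes>\<^sub>M leb_on \<Omega>)"
    by (subst measurable_cong[where g = "\<lambda>p. k (fst p) (snd p)"]) auto
  then show ?thesis
    using assms(2) by unfold_locales (auto simp: space_restrict_space)
qed

lemma test_functions_bounds:
  assumes \<phi>: "\<phi> \<in> test_functions \<Omega>"
  shows "continuous_on UNIV \<phi>" "\<phi> \<in> borel_measurable (leb_on \<Omega>)"
    and "grad \<phi> \<in> borel_measurable (leb_on \<Omega>)"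
    and "(\<integral>\<^sup>+x. ennreal ((\<phi> x)\<^sup>2) \<partial>leb_on \<Omega>) < \<infinity>"
    and "(\<integral>\<^sup>+x. ennreal ((norm (grad \<phi> x))\<^sup>2) \<partial>leb_on \<Omega>) < \<infinity>"
    and "r \<le> 1 \<Longrightarrow> kernel_form.energy_sq (leb_on \<Omega>) (jump_kernel r) \<phi>
      \<le> ennreal (3/2) * emeasure lborel (cball (0::'a) r) * (\<integral>\<^sup>+x. ennreal ((norm (grad \<phi> x))\<^sup>2) \<partial>leb_on \<Omega>)"
proof -
  interpret finite_measure "leb_on \<Omega>" by (rule finite_measure_leb_on[OF open_domain bounded_domain])
  have smooth: "smooth \<phi>" using \<phi> by (simp add: test_functions_iff)
  have "Ck_on 1 UNIV \<phi>" using smooth by (simp add: smooth_iff_Ck_on)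
  then have g: "continuous_on UNIV (grad \<phi>)" using continuous_on_grad[of 0] by simp
  show c: "continuous_on UNIV \<phi>"
    using smooth_differentiable[OF smooth]
    by (intro continuous_at_imp_continuous_on ballI differentiable_imp_continuous_within) auto
  have meas: "h \<in> borel_measurable (leb_on \<Omega>)" if "continuous_on UNIV h" for h :: "'a \<Rightarrow> 'b::topological_space"
    using borel_measurable_continuous_onI[OF that] by (intro measurable_restrict_space1) auto
  show "\<phi> \<in> borel_measurable (leb_on \<Omega>)" "grad \<phi> \<in> borel_measurable (leb_on \<Omega>)"
    using c g by (auto intro: meas)
  have bounded: "(\<integral>\<^sup>+x. ennreal ((norm (h x))\<^sup>2) \<partial>leb_on \<Omega>) < \<infinity>"
    if h: "continuous_on UNIV h" for h :: "'a \<Rightarrow> 'b::real_normed_vector"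
  proof -
    have "bounded (h ` closure \<Omega>)"
      using bounded_domain by (intro compact_imp_bounded compact_continuous_image continuous_on_subset[OF h]) auto
    then obtain B where B: "\<And>x. x \<in> \<Omega> \<Longrightarrow> norm (h x) \<le> B"
      using closure_subset[of \<Omega>] by (auto simp: bounded_pos)
    have "(\<integral>\<^sup>+x. ennreal ((norm (h x))\<^sup>2) \<partial>leb_on \<Omega>) \<le> (\<integral>\<^sup>+x. ennreal (B\<^sup>2) \<partial>leb_on \<Omega>)"
      using B by (intro nn_integral_mono ennreal_leI power_mono) (auto simp: space_restrict_space)
    also have "\<dots> < \<infinity>" using emeasure_finite[of \<Omega>] by (simp add: ennreal_mult_less_top less_top emeasure_eq_measure)
    finally show ?thesis .
  qed
  show "(\<integral>\<^sup>+x. ennreal ((\<phi> x)\<^sup>2) \<partial>leb_on \<Omega>) < \<infinity>" using bounded[OF c] by simp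
  show "(\<integral>\<^sup>+x. ennreal ((norm (grad \<phi> x))\<^sup>2) \<partial>leb_on \<Omega>) < \<infinity>" using bounded[OF g] .
  have zero: "(\<lambda>x. indicator \<Omega> x * \<phi> x) = \<phi>"
    using \<phi> by (auto simp: test_functions_iff fun_eq_iff split: split_indicator)
  show "kernel_form.energy_sq (leb_on \<Omega>) (jump_kernel r) \<phi>
      \<le> ennreal (3/2) * emeasure lborel (cball (0::'a) r) * (\<integral>\<^sup>+x. ennreal ((norm (grad \<phi> x))\<^sup>2) \<partial>leb_on \<Omega>)"
    if "r \<le> 1"
    unfolding energy_sq_jump[OF that] zero nn_integral_leb_on
    by (rule jump_energy_le_gradient[OF has_derivative_grad[OF smooth_differentiable[OF smooth]] g that])
qed

lemma test_functions_finite_norm: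
  assumes "r \<le> 1"
  shows "test_functions \<Omega> \<subseteq> kernel_form.finite_norm (leb_on \<Omega>) (jump_kernel r)"
proof
  interpret W: kernel_form "leb_on \<Omega>" "jump_kernel r" by (rule kernel_form_jump)
  fix \<phi> assume \<phi>: "\<phi> \<in> test_functions \<Omega>"
  note b = test_functions_bounds[OF \<phi>]
  have "ennreal (3/2) * emeasure lborel (cball (0::'a) r) * (\<integral>\<^sup>+x. ennreal ((norm (grad \<phi> x))\<^sup>2) \<partial>leb_on \<Omega>) < \<infinity>"
    using b(5) emeasure_lborel_cball_finite[of "0::'a" r] by (auto simp: ennreal_mult_less_top)
  then have "W.energy_sq \<phi> < \<infinity>" using b(6)[OF assms] by (rule le_less_trans[rotated])
  then show "\<phi> \<in> W.finite_norm" using b by (simp add: W.finite_norm_def W.norm_sq_def)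
qed

lemma test_function_poincare:
  assumes \<phi>: "\<phi> \<in> test_functions \<Omega>" and r: "r \<le> 1"
    and M: "0 < M" "6 * K * M * r \<le> 1" "\<And>x. x \<in> \<Omega> \<Longrightarrow> norm x \<le> M"
    and m: "0 < m" "(\<integral>\<^sup>+z. ennreal ((norm z)\<^sup>2) * indicator (cball (0::'a) r) z \<partial>lborel) = ennreal m"
  shows "(\<integral>\<^sup>+x. ennreal ((\<phi> x)\<^sup>2) \<partial>leb_on \<Omega>)
    \<le> ennreal (8 * (2 * M + 16 * M\<^sup>2 + 1) / m) * kernel_form.energy_sq (leb_on \<Omega>) (jump_kernel r) \<phi>"
proof -
  let ?I = "\<integral>\<^sup>+x. ennreal ((\<phi> x)\<^sup>2) \<partial>leb_on \<Omega>"
  let ?E = "kernel_form.energy_sq (leb_on \<Omega>) (jump_kernel r) \<phi>"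
  let ?C = "8 * (2 * M + 16 * M\<^sup>2 + 1)"
  obtain S where S: "compact S" "S \<subseteq> \<Omega>" "\<And>x. x \<notin> S \<Longrightarrow> \<phi> x = 0"
    using \<phi> by (auto simp: test_functions_iff)
  have zero: "(\<lambda>x. indicator \<Omega> x * \<phi> x) = \<phi>"
    using S by (auto simp: fun_eq_iff split: split_indicator)
  have "ennreal m * (\<integral>\<^sup>+x. ennreal ((\<phi> x)\<^sup>2) * indicator \<Omega> x \<partial>lborel) \<le> ennreal ?C * jump_energy r \<phi>"
    unfolding m(2)[symmetric] by (rule poincare[OF test_functions_bounds(1)[OF \<phi>] S r M])
  then have "ennreal m * ?I \<le> ennreal ?C * ?E"
    by (simp only: energy_sq_jump[OF r] zero nn_integral_leb_on)
  then have "ennreal (1 / m) * (ennreal m * ?I) \<le> ennreal (1 / m) * (ennreal ?C * ?E)"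
    by (rule mult_left_mono) simp
  moreover have "ennreal (1 / m) * (ennreal m * ?I) = ?I"
    using m by (simp add: mult.assoc[symmetric] ennreal_mult[symmetric])
  moreover have "ennreal (1 / m) * (ennreal ?C * ?E) = ennreal (?C / m) * ?E"
  proof -
    have "ennreal (1 / m) * ennreal ?C = ennreal (?C / m)"
      using m by (subst ennreal_mult'[symmetric]) auto
    then show ?thesis by (simp only: mult.assoc[symmetric])
  qed
  ultimately show ?thesis by (simp only:)
qed

lemma energy_sq_jump_mono:
  "r \<le> s \<Longrightarrow> kernel_form.energy_sq (leb_on \<Omega>) (jump_kernel r) u \<le> kernel_form.energy_sq (leb_on \<Omega>) (jump_kernel s) u"
  unfolding kernel_form.energy_sq_def[OF kernel_form_jump]
  by (intro nn_integral_mono ennreal_leI mult_right_mono jump_kernel_mono) auto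

lemma energy_sq_jump_compare:
  assumes "u \<in> borel_measurable (leb_on \<Omega>)" "0 < s" "s \<le> 1" "r \<le> 1" "(3/5) ^ n * s \<le> r"
  shows "kernel_form.energy_sq (leb_on \<Omega>) (jump_kernel s) u
    \<le> ennreal (shrink_constant TYPE('a) ^ n) * kernel_form.energy_sq (leb_on \<Omega>) (jump_kernel r) u"
  using jump_energy_compare[OF extend_measurable[OF assms(1)] assms(2,3,5)] assms by (simp add: energy_sq_jump)

text \<open>The Poincare inequality at the small radius \<open>r\<close> passes to the closure by
  density, and the energy at \<open>R\<close> is compared with the one at \<open>r\<close>. In
  \<open>4 * P\<close> one factor 2 comes from splitting \<open>u\<close> into
  \<open>u - \<phi>\<close> and \<open>\<phi>\<close>, the other from returning from the energy of
  \<open>\<phi>\<close> to that of \<open>u\<close>.\<close>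

lemma norm_sq_le_energy_sq:
  assumes u: "u \<in> kernel_form.form_closure (leb_on \<Omega>) (jump_kernel R) (test_functions \<Omega>)"
    and R: "0 < R" "R \<le> 1" and r: "r \<le> R" "(3/5) ^ n * R \<le> r" and P: "0 \<le> P"
    and poincare: "\<And>\<phi>. \<phi> \<in> test_functions \<Omega> \<Longrightarrow> (\<integral>\<^sup>+x. ennreal ((\<phi> x)\<^sup>2) \<partial>leb_on \<Omega>)
      \<le> ennreal P * kernel_form.energy_sq (leb_on \<Omega>) (jump_kernel r) \<phi>"
  shows "kernel_form.norm_sq (leb_on \<Omega>) (jump_kernel R) u
    \<le> ennreal (4 * P + shrink_constant TYPE('a) ^ n) * kernel_form.energy_sq (leb_on \<Omega>) (jump_kernel r) u"
proof -
  interpret W: kernel_form "leb_on \<Omega>" "jump_kernel R" by (rule kernel_form_jump)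
  interpret V: kernel_form "leb_on \<Omega>" "jump_kernel r" by (rule kernel_form_jump)
  have u_meas[measurable]: "u \<in> borel_measurable (leb_on \<Omega>)" using u by (simp add: W.form_closure_def)
  let ?I = "\<lambda>v::'a \<Rightarrow> real. \<integral>\<^sup>+x. ennreal ((v x)\<^sup>2) \<partial>leb_on \<Omega>"
  have "?I u \<le> ennreal (4 * P) * V.energy_sq u + ennreal \<epsilon>" if \<epsilon>: "0 < \<epsilon>" for \<epsilon> :: real
  proof -
    \<comment> \<open>The remainder of the two splittings is
      \<open>2 * \<epsilon>' + 4 * P * \<epsilon>'\<close>, which this choice makes equal to
      \<open>\<epsilon>\<close>.\<close>
    define \<epsilon>' where "\<epsilon>' = \<epsilon> / (2 + 4 * P)"
    have \<epsilon>': "0 < \<epsilon>'" using \<epsilon> P by (simp add: \<epsilon>'_def)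
    have "2 * \<epsilon>' + 4 * P * \<epsilon>' = (2 + 4 * P) * \<epsilon>'" by (simp add: algebra_simps)
    then have \<epsilon>_eq: "2 * \<epsilon>' + 4 * P * \<epsilon>' = \<epsilon>" using P by (simp add: \<epsilon>'_def)
    obtain \<phi> where \<phi>: "\<phi> \<in> test_functions \<Omega>" and close: "W.norm_sq (\<lambda>x. u x - \<phi> x) \<le> ennreal \<epsilon>'"
      using W.form_closure_approx[OF u \<epsilon>'] by blast
    have [measurable]: "\<phi> \<in> borel_measurable (leb_on \<Omega>)" using test_functions_bounds[OF \<phi>] by blast
    have "?I (\<lambda>x. u x - \<phi> x) \<le> W.norm_sq (\<lambda>x. u x - \<phi> x)" by (simp add: W.norm_sq_def)
    then have I: "?I (\<lambda>x. u x - \<phi> x) \<le> ennreal \<epsilon>'" using close by (rule order_trans)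
    have "V.energy_sq (\<lambda>x. \<phi> x - u x) \<le> W.energy_sq (\<lambda>x. \<phi> x - u x)"
      using r(1) by (rule energy_sq_jump_mono)
    also have "\<dots> \<le> W.norm_sq (\<lambda>x. \<phi> x - u x)" by (simp add: W.norm_sq_def)
    also have "\<dots> \<le> ennreal \<epsilon>'" using close by (simp add: W.norm_sq_minus_commute[of \<phi>])
    finally have E: "V.energy_sq (\<lambda>x. \<phi> x - u x) \<le> ennreal \<epsilon>'" .
    have "V.energy_sq \<phi> = V.energy_sq (\<lambda>x. u x + (\<phi> x - u x))" by simp
    also have "\<dots> \<le> 2 * V.energy_sq u + 2 * V.energy_sq (\<lambda>x. \<phi> x - u x)"
      by (rule V.energy_sq_add_le) measurable
    also have "\<dots> \<le> 2 * V.energy_sq u + 2 * ennreal \<epsilon>'"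
      by (intro add_left_mono mult_left_mono E) simp
    finally have V: "V.energy_sq \<phi> \<le> 2 * V.energy_sq u + 2 * ennreal \<epsilon>'" .
    have "?I u = ?I (\<lambda>x. (u x - \<phi> x) + \<phi> x)" by simp
    also have "\<dots> \<le> 2 * ?I (\<lambda>x. u x - \<phi> x) + 2 * ?I \<phi>"
      using nn_integral_square_add_le[of "\<lambda>x. u x - \<phi> x" "leb_on \<Omega>" \<phi> "\<lambda>_. 1"] by simp
    also have "\<dots> \<le> 2 * ennreal \<epsilon>' + 2 * (ennreal P * (2 * V.energy_sq u + 2 * ennreal \<epsilon>'))"
      by (intro add_mono mult_left_mono I order_trans[OF poincare[OF \<phi>]] V) auto
    also have "\<dots> = ennreal (4 * P) * V.energy_sq u + (2 * ennreal \<epsilon>' + 4 * (ennreal P * ennreal \<epsilon>'))"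
      using ennreal_mult'[of 4 P] by (simp add: algebra_simps)
    also have "2 * ennreal \<epsilon>' + 4 * (ennreal P * ennreal \<epsilon>') = ennreal \<epsilon>"
    proof -
      have "ennreal \<epsilon> = ennreal (2 * \<epsilon>') + ennreal (4 * (P * \<epsilon>'))"
        using \<epsilon>' P \<epsilon>_eq by (subst ennreal_plus[symmetric]) (auto simp: mult.assoc)
      also have "\<dots> = 2 * ennreal \<epsilon>' + 4 * (ennreal P * ennreal \<epsilon>')"
        using ennreal_mult'[of 2 \<epsilon>'] ennreal_mult'[of 4 "P * \<epsilon>'"] ennreal_mult'[OF P, of \<epsilon>'] by simp
      finally show ?thesis by simp
    qed
    finally show ?thesis .
  qed
  then have "?I u \<le> ennreal (4 * P) * V.energy_sq u" by - (rule ennreal_le_epsilon, blast)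
  moreover have "W.energy_sq u \<le> ennreal (shrink_constant TYPE('a) ^ n) * V.energy_sq u"
    using R r by (intro energy_sq_jump_compare) auto
  ultimately have "W.norm_sq u \<le> ennreal (4 * P) * V.energy_sq u + ennreal (shrink_constant TYPE('a) ^ n) * V.energy_sq u"
    unfolding W.norm_sq_def by (rule add_mono)
  then show ?thesis
    using P by (simp add: shrink_constant_def distrib_right)
qed

text \<open>By Tonelli the kernel with exchanged arguments has the same energy, since the squared
  increment is symmetric; the two halves add up to \<open>S\<close>.\<close>

lemma energy_sq_scaled_le:
  assumes B: "kernel_form (leb_on \<Omega>) b" and S: "0 \<le> S" and u: "u \<in> borel_measurable (leb_on \<Omega>)"
    and b: "\<And>x y. x \<in> \<Omega> \<Longrightarrow> y \<in> \<Omega> \<Longrightarrow> b x y \<le> S / 2 * jump_kernel 1 x y + S / 2 * jump_kernel 1 y x"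
  shows "kernel_form.energy_sq (leb_on \<Omega>) b u \<le> ennreal S * kernel_form.energy_sq (leb_on \<Omega>) (jump_kernel 1) u"
proof -
  interpret B: kernel_form "leb_on \<Omega>" b by (rule B)
  interpret W: kernel_form "leb_on \<Omega>" "jump_kernel 1" by (rule kernel_form_jump)
  interpret P: pair_sigma_finite "leb_on \<Omega>" "leb_on \<Omega>" ..
  note u[measurable] W.kernel_measurable[measurable]
  let ?a = "\<lambda>x y. ennreal (S / 2) * ennreal (jump_kernel 1 x y * (u x - u y)\<^sup>2)"
  have meas: "(\<lambda>p. ?a (fst p) (snd p)) \<in> borel_measurable (leb_on \<Omega> \<Otimes>\<^sub>M leb_on \<Omega>)" by measurable
  then have meas': "(\<lambda>(x, y). ?a x y) \<in> borel_measurable (leb_on \<Omega> \<Otimes>\<^sub>M leb_on \<Omega>)"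
    by (simp add: case_prod_beta')
  have meas'': "(\<lambda>(x, y). ?a y x) \<in> borel_measurable (leb_on \<Omega> \<Otimes>\<^sub>M leb_on \<Omega>)"
    using measurable_compose[OF measurable_pair_swap' meas'] by (simp add: case_prod_beta')
  have int1: "(\<integral>\<^sup>+x. (\<integral>\<^sup>+y. ?a x y \<partial>leb_on \<Omega>) \<partial>leb_on \<Omega>) = ennreal (S / 2) * W.energy_sq u"
    unfolding W.energy_sq_pair[OF u]
    by (subst B.nn_integral_fst[OF meas', simplified]) (simp add: case_prod_beta' nn_integral_cmult)
  have int2: "(\<integral>\<^sup>+x. (\<integral>\<^sup>+y. ?a y x \<partial>leb_on \<Omega>) \<partial>leb_on \<Omega>) = ennreal (S / 2) * W.energy_sq u"
    using P.Fubini'[OF meas'] int1 by simp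
  have "B.energy_sq u \<le> (\<integral>\<^sup>+p. (\<lambda>(x, y). ?a x y) p + (\<lambda>(x, y). ?a y x) p \<partial>(leb_on \<Omega> \<Otimes>\<^sub>M leb_on \<Omega>))"
    unfolding B.energy_sq_pair[OF u]
  proof (rule nn_integral_mono)
    fix p assume "p \<in> space (leb_on \<Omega> \<Otimes>\<^sub>M leb_on \<Omega>)"
    then obtain x y where p: "p = (x, y)" "x \<in> \<Omega>" "y \<in> \<Omega>"
      by (auto simp: space_pair_measure space_restrict_space)
    have "b x y * (u x - u y)\<^sup>2 \<le> (S / 2 * jump_kernel 1 x y + S / 2 * jump_kernel 1 y x) * (u x - u y)\<^sup>2"
      using p by (intro mult_right_mono b) auto
    also have "\<dots> = S / 2 * (jump_kernel 1 x y * (u x - u y)\<^sup>2) + S / 2 * (jump_kernel 1 y x * (u y - u x)\<^sup>2)"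
      by (simp add: power2_commute[of "u y"] distrib_right)
    finally have "ennreal (b x y * (u x - u y)\<^sup>2)
      \<le> ennreal (S / 2 * (jump_kernel 1 x y * (u x - u y)\<^sup>2) + S / 2 * (jump_kernel 1 y x * (u y - u x)\<^sup>2))"
      by (rule ennreal_leI)
    also have "\<dots> = ?a x y + ?a y x"
      using S jump_kernel_nonneg by (subst ennreal_plus) (auto simp: ennreal_mult'[symmetric])
    finally show "ennreal (b (fst p) (snd p) * (u (fst p) - u (snd p))\<^sup>2) \<le> (\<lambda>(x, y). ?a x y) p + (\<lambda>(x, y). ?a y x) p"
      by (simp add: p)
  qed
  also have "\<dots> = (\<integral>\<^sup>+p. (\<lambda>(x, y). ?a x y) p \<partial>(leb_on \<Omega> \<Otimes>\<^sub>M leb_on \<Omega>))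
      + (\<integral>\<^sup>+p. (\<lambda>(x, y). ?a y x) p \<partial>(leb_on \<Omega> \<Otimes>\<^sub>M leb_on \<Omega>))"
    by (rule nn_integral_add[OF meas' meas''])
  also have "\<dots> = ennreal (S / 2) * W.energy_sq u + ennreal (S / 2) * W.energy_sq u"
    using B.nn_integral_fst[OF meas'] B.nn_integral_fst[OF meas''] int1 int2 by simp
  also have "\<dots> = (ennreal (S / 2) + ennreal (S / 2)) * W.energy_sq u" by (simp only: distrib_right)
  also have "ennreal (S / 2) + ennreal (S / 2) = ennreal S"
    using S by (subst ennreal_plus[symmetric]) auto
  finally show ?thesis .
qed

text \<open>The gradient bound is applied to differences of approximating test functions only. Being
  Cauchy in \<open>H1\<close>, they are Cauchy in the nonlocal norm; their limit \<open>w\<close> in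
  the closure and \<open>u\<close> are limits of the same sequence in \<open>L2\<close>, hence agree
  almost everywhere.\<close>

lemma H10_subset:
  assumes R: "0 < R" "R \<le> 1"
  shows "H10 \<Omega> \<subseteq> kernel_form.form_closure (leb_on \<Omega>) (jump_kernel R) (test_functions \<Omega>)"
proof
  interpret W: kernel_form "leb_on \<Omega>" "jump_kernel R" by (rule kernel_form_jump)
  let ?M = "leb_on \<Omega>" and ?T = "test_functions \<Omega>" and ?H = "W.form_closure (test_functions \<Omega>)"
  note T = function_subspace_test_functions test_functions_finite_norm[OF R(2)]
  fix u assume "u \<in> H10 \<Omega>"
  then obtain g where u: "u \<in> L2 \<Omega>" and g: "g \<in> L2 \<Omega>"
    and approx: "\<And>\<epsilon>. 0 < \<epsilon> \<Longrightarrow> \<exists>\<phi>\<in>?T. (LINT x|?M. (u x - \<phi> x)\<^sup>2) + (LINT x|?M. (norm (g x - grad \<phi> x))\<^sup>2) < \<epsilon>\<^sup>2"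
    by (auto simp: H10_def)
  have [measurable]: "u \<in> borel_measurable ?M" "g \<in> borel_measurable ?M" using u g by (auto simp: L2_def)
  have finite: "(\<integral>\<^sup>+x. ennreal ((norm (h x))\<^sup>2) \<partial>?M) < \<infinity>" if "h \<in> L2 \<Omega>" for h :: "'a \<Rightarrow> 'b::euclidean_space"
    using that by (auto simp: L2_def integrable_iff_bounded)
  have sq_add: "(\<integral>\<^sup>+x. ennreal ((norm (f x - h x))\<^sup>2) \<partial>?M)
      \<le> 2 * (\<integral>\<^sup>+x. ennreal ((norm (f x))\<^sup>2) \<partial>?M) + 2 * (\<integral>\<^sup>+x. ennreal ((norm (h x))\<^sup>2) \<partial>?M)"
    if [measurable]: "f \<in> borel_measurable ?M" "h \<in> borel_measurable ?M" for f h :: "'a \<Rightarrow> 'b::euclidean_space"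
  proof -
    have "(\<integral>\<^sup>+x. ennreal ((norm (f x - h x))\<^sup>2) \<partial>?M) \<le> (\<integral>\<^sup>+x. ennreal (1 * (norm (f x) + norm (h x))\<^sup>2) \<partial>?M)"
      by (intro nn_integral_mono ennreal_leI) (auto intro!: power_mono norm_triangle_ineq4)
    also have "\<dots> \<le> 2 * (\<integral>\<^sup>+x. ennreal (1 * (norm (f x))\<^sup>2) \<partial>?M) + 2 * (\<integral>\<^sup>+x. ennreal (1 * (norm (h x))\<^sup>2) \<partial>?M)"
      by (rule nn_integral_square_add_le) auto
    finally show ?thesis by simp
  qed
  let ?I = "\<lambda>v::'a \<Rightarrow> real. \<integral>\<^sup>+x. ennreal ((norm (v x))\<^sup>2) \<partial>?M" and ?G = "\<lambda>v::'a \<Rightarrow> 'a. \<integral>\<^sup>+x. ennreal ((norm (v x))\<^sup>2) \<partial>?M"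
  have approx': "\<exists>\<phi>\<in>?T. ?I (\<lambda>x. u x - \<phi> x) \<le> ennreal \<epsilon> \<and> ?G (\<lambda>x. g x - grad \<phi> x) \<le> ennreal \<epsilon>" if \<epsilon>: "0 < \<epsilon>" for \<epsilon> :: real
  proof -
    obtain \<phi> where \<phi>: "\<phi> \<in> ?T" and lt: "(LINT x|?M. (u x - \<phi> x)\<^sup>2) + (LINT x|?M. (norm (g x - grad \<phi> x))\<^sup>2) < (sqrt \<epsilon>)\<^sup>2"
      using approx[of "sqrt \<epsilon>"] \<epsilon> by auto
    note b = test_functions_bounds[OF \<phi>]
    note [measurable] = b(2,3)
    \<comment> \<open>A Bochner integral could be small merely because it does not exist, so
      integrability is settled before the approximation is restated with nonnegative
      integrals.\<close>
    have "?I (\<lambda>x. u x - \<phi> x) < \<infinity>"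
      using finite[OF u] b(4) by (intro le_less_trans[OF sq_add]) (auto simp: ennreal_mult_less_top)
    then have i1: "integrable ?M (\<lambda>x. (u x - \<phi> x)\<^sup>2)" by (intro integrableI_nonneg) auto
    have "?G (\<lambda>x. g x - grad \<phi> x) < \<infinity>"
      using finite[OF g] b(5) by (intro le_less_trans[OF sq_add]) (auto simp: ennreal_mult_less_top)
    then have i2: "integrable ?M (\<lambda>x. (norm (g x - grad \<phi> x))\<^sup>2)" by (intro integrableI_nonneg) auto
    have "(LINT x|?M. (u x - \<phi> x)\<^sup>2) + (LINT x|?M. (norm (g x - grad \<phi> x))\<^sup>2) < \<epsilon>" using lt \<epsilon> by simp
    moreover have "0 \<le> (LINT x|?M. (u x - \<phi> x)\<^sup>2)" "0 \<le> (LINT x|?M. (norm (g x - grad \<phi> x))\<^sup>2)"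
      by (intro Bochner_Integration.integral_nonneg; simp)+
    ultimately have "(LINT x|?M. (u x - \<phi> x)\<^sup>2) \<le> \<epsilon>" "(LINT x|?M. (norm (g x - grad \<phi> x))\<^sup>2) \<le> \<epsilon>"
      by linarith+
    then show ?thesis
      using \<phi> nn_integral_eq_integral[OF i1] nn_integral_eq_integral[OF i2]
      by (intro bexI[of _ \<phi>]) (auto intro!: ennreal_leI)
  qed
  have "\<forall>n. \<exists>\<phi>. \<phi> \<in> ?T \<and> ?I (\<lambda>x. u x - \<phi> x) \<le> ennreal (1 / real (Suc n))
      \<and> ?G (\<lambda>x. g x - grad \<phi> x) \<le> ennreal (1 / real (Suc n))"
  proof
    fix n
    show "\<exists>\<phi>. \<phi> \<in> ?T \<and> ?I (\<lambda>x. u x - \<phi> x) \<le> ennreal (1 / real (Suc n))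
      \<and> ?G (\<lambda>x. g x - grad \<phi> x) \<le> ennreal (1 / real (Suc n))"
      using approx'[of "1 / real (Suc n)"] by (simp only: Bex_def) simp
  qed
  from choice[OF this] obtain \<phi> where
    \<phi>_all: "\<forall>n. \<phi> n \<in> ?T \<and> ?I (\<lambda>x. u x - \<phi> n x) \<le> ennreal (1 / real (Suc n))
      \<and> ?G (\<lambda>x. g x - grad (\<phi> n) x) \<le> ennreal (1 / real (Suc n))" ..
  have \<phi>: "\<phi> n \<in> ?T" for n
    using \<phi>_all by blast
  have I: "?I (\<lambda>x. u x - \<phi> n x) \<le> ennreal (1 / real (Suc n))" for n
    by (rule conjunct1[OF conjunct2[OF spec[OF \<phi>_all]]])
  have G: "?G (\<lambda>x. g x - grad (\<phi> n) x) \<le> ennreal (1 / real (Suc n))" for n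
    by (rule conjunct2[OF conjunct2[OF spec[OF \<phi>_all]]])
  have [measurable]: "\<phi> n \<in> borel_measurable ?M" "grad (\<phi> n) \<in> borel_measurable ?M" for n
    using test_functions_bounds[OF \<phi>] by auto
  define c where "c = measure lborel (cball (0::'a) R)"
  have c: "emeasure lborel (cball (0::'a) R) = ennreal c" "0 \<le> c"
    using emeasure_lborel_cball_finite[of "0::'a" R] by (auto simp: c_def emeasure_eq_ennreal_measure)
  have small: "W.norm_sq (\<lambda>x. \<phi> m x - \<phi> n x) \<le> ennreal ((1 + 3/2 * c) * (4 / real (Suc N)))"
    if "N \<le> m" "N \<le> n" for N m n
  proof -
    let ?d = "\<lambda>x. \<phi> m x - \<phi> n x" and ?\<epsilon> = "1 / real (Suc N)"
    have le: "1 / real (Suc m) \<le> ?\<epsilon>" "1 / real (Suc n) \<le> ?\<epsilon>" using that by (auto intro!: frac_le)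
    have quad: "2 * ennreal t + 2 * ennreal t = ennreal (4 * t)" if "0 \<le> t" for t
      using ennreal_quarters[of "4 * t"] that by simp
    have four: "2 * ennreal ?\<epsilon> + 2 * ennreal ?\<epsilon> = ennreal (4 * ?\<epsilon>)"
      by (rule quad) simp
    have d: "?d \<in> ?T" using function_subspace_diff[OF T(1) \<phi> \<phi>] .
    have "?I ?d = ?I (\<lambda>x. (u x - \<phi> n x) - (u x - \<phi> m x))" by simp
    also have "\<dots> \<le> 2 * ?I (\<lambda>x. u x - \<phi> n x) + 2 * ?I (\<lambda>x. u x - \<phi> m x)" by (rule sq_add) measurable
    also have "\<dots> \<le> 2 * ennreal ?\<epsilon> + 2 * ennreal ?\<epsilon>"
      using le by (intro add_mono mult_left_mono order_trans[OF I] ennreal_leI) auto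
    finally have 1: "?I ?d \<le> ennreal (4 * ?\<epsilon>)" unfolding four .
    have sm: "smooth (\<phi> i)" for i using \<phi> by (simp add: test_functions_iff)
    have "grad ?d x = grad (\<phi> m) x - grad (\<phi> n) x" for x
      using grad_add[OF sm[of m] smooth_scale[OF sm[of n], of "-1"], of x] grad_scale[OF sm[of n], of "-1" x] by simp
    then have "?G (grad ?d) = ?G (\<lambda>x. (g x - grad (\<phi> n) x) - (g x - grad (\<phi> m) x))" by simp
    also have "\<dots> \<le> 2 * ?G (\<lambda>x. g x - grad (\<phi> n) x) + 2 * ?G (\<lambda>x. g x - grad (\<phi> m) x)" by (rule sq_add) measurable
    also have "\<dots> \<le> 2 * ennreal ?\<epsilon> + 2 * ennreal ?\<epsilon>"
      using le by (intro add_mono mult_left_mono order_trans[OF G] ennreal_leI) auto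
    finally have 2: "?G (grad ?d) \<le> ennreal (4 * ?\<epsilon>)" unfolding four .
    have "W.norm_sq ?d \<le> ennreal (4 * ?\<epsilon>) + ennreal (3/2) * ennreal c * ennreal (4 * ?\<epsilon>)"
      unfolding W.norm_sq_def
    proof (rule add_mono)
      show "(\<integral>\<^sup>+x. ennreal ((?d x)\<^sup>2) \<partial>?M) \<le> ennreal (4 * ?\<epsilon>)" using 1 by simp
      have "W.energy_sq ?d \<le> ennreal (3/2) * ennreal c * ?G (grad ?d)"
        using test_functions_bounds(6)[OF d R(2)] unfolding c(1) .
      also have "\<dots> \<le> ennreal (3/2) * ennreal c * ennreal (4 * ?\<epsilon>)" using 2 by (rule mult_left_mono) simp
      finally show "W.energy_sq ?d \<le> ennreal (3/2) * ennreal c * ennreal (4 * ?\<epsilon>)" .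
    qed
    also have "ennreal (3/2) * ennreal c * ennreal (4 * ?\<epsilon>) = ennreal (3/2 * c * (4 * ?\<epsilon>))"
      using c(2) by (simp add: ennreal_mult'[symmetric])
    also have "ennreal (4 * ?\<epsilon>) + ennreal (3/2 * c * (4 * ?\<epsilon>)) = ennreal (4 * ?\<epsilon> + 3/2 * c * (4 * ?\<epsilon>))"
      using c(2) by (intro ennreal_plus[symmetric]) auto
    also have "4 * ?\<epsilon> + 3/2 * c * (4 * ?\<epsilon>) = (1 + 3/2 * c) * (4 / real (Suc N))" by (simp add: algebra_simps)
    finally show ?thesis .
  qed
  have "\<exists>N. \<forall>m\<ge>N. \<forall>n\<ge>N. W.norm_sq (\<lambda>x. \<phi> m x - \<phi> n x) \<le> ennreal \<epsilon>" if \<epsilon>: "0 < \<epsilon>" for \<epsilon> :: real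
  proof -
    have pos: "0 < (1 + 3/2 * c) * 4" using c(2) by simp
    then have "0 < \<epsilon> / ((1 + 3/2 * c) * 4)" using \<epsilon> by (intro divide_pos_pos)
    then obtain N where "inverse (real (Suc N)) < \<epsilon> / ((1 + 3/2 * c) * 4)" using reals_Archimedean by blast
    then have "(1 + 3/2 * c) * (4 / real (Suc N)) \<le> \<epsilon>" using pos by (simp add: field_simps)
    then show ?thesis
      by (intro exI[of _ N] allI impI) (rule order_trans[OF small ennreal_leI])
  qed
  then obtain w where w: "w \<in> ?H" and lim: "\<And>\<epsilon>::real. 0 < \<epsilon> \<Longrightarrow> \<exists>N. \<forall>n\<ge>N. W.norm_sq (\<lambda>x. \<phi> n x - w x) \<le> ennreal \<epsilon>"
    using W.form_closure_complete[OF T, of \<phi>] \<phi> W.subset_form_closure[OF T] by blast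
  have [measurable]: "w \<in> borel_measurable ?M" using w by (simp add: W.form_closure_def)
  have "?I (\<lambda>x. u x - w x) \<le> 0 + ennreal \<epsilon>" if \<epsilon>: "0 < \<epsilon>" for \<epsilon> :: real
  proof -
    obtain N where N: "\<And>n. N \<le> n \<Longrightarrow> W.norm_sq (\<lambda>x. \<phi> n x - w x) \<le> ennreal (\<epsilon> / 4)"
      using lim[of "\<epsilon> / 4"] \<epsilon> by auto
    obtain N' where N': "inverse (real (Suc N')) < \<epsilon> / 4" using reals_Archimedean[of "\<epsilon> / 4"] \<epsilon> by auto
    let ?n = "max N N'"
    have "1 / real (Suc ?n) \<le> 1 / real (Suc N')" by (intro frac_le) auto
    then have n': "1 / real (Suc ?n) \<le> \<epsilon> / 4" using N' by (simp add: inverse_eq_divide)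
    have "?I (\<lambda>x. \<phi> ?n x - w x) \<le> W.norm_sq (\<lambda>x. \<phi> ?n x - w x)" by (simp add: W.norm_sq_def)
    also have "\<dots> \<le> ennreal (\<epsilon> / 4)" by (rule N) simp
    finally have 1: "?I (\<lambda>x. \<phi> ?n x - w x) \<le> ennreal (\<epsilon> / 4)" .
    have "?I (\<lambda>x. u x - w x) = ?I (\<lambda>x. (u x - \<phi> ?n x) - (w x - \<phi> ?n x))" by simp
    also have "\<dots> \<le> 2 * ?I (\<lambda>x. u x - \<phi> ?n x) + 2 * ?I (\<lambda>x. w x - \<phi> ?n x)" by (rule sq_add) measurable
    also have "?I (\<lambda>x. w x - \<phi> ?n x) = ?I (\<lambda>x. \<phi> ?n x - w x)" by (simp only: norm_minus_commute)
    also have "2 * ?I (\<lambda>x. u x - \<phi> ?n x) + 2 * \<dots> \<le> 2 * ennreal (\<epsilon> / 4) + 2 * ennreal (\<epsilon> / 4)"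
      using 1 order_trans[OF I ennreal_leI[OF n']] by (intro add_mono mult_left_mono) auto
    also have "\<dots> = ennreal \<epsilon>" using \<epsilon> by (intro ennreal_quarters) simp
    finally show ?thesis by simp
  qed
  then have "?I (\<lambda>x. u x - w x) \<le> 0" by - (rule ennreal_le_epsilon, blast)
  then have "AE x in ?M. ennreal ((norm (u x - w x))\<^sup>2) = 0"
    by (subst nn_integral_0_iff_AE[symmetric]) auto
  then have "AE x in ?M. u x - w x = 0" by eventually_elim simp
  then have "W.norm_sq (\<lambda>x. u x - w x) = W.norm_sq (\<lambda>x. 0)"
    by (intro W.norm_sq_cong_AE) auto
  also have "\<dots> = 0" by (simp add: W.norm_sq_def W.energy_sq_def)
  finally show "u \<in> ?H"
    by (intro W.form_closure_closed[OF T] bexI[OF _ w]) auto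
qed

end

section \<open>Well-posedness with explicit constants\<close>

context horizon
begin

lemma form_closure_subset_W_space:
  assumes R: "0 < R" "R \<le> 1"
  shows "kernel_form.form_closure (leb_on \<Omega>) (jump_kernel R) (test_functions \<Omega>) \<subseteq> W_space R e \<Omega>"
    and "W_space R e \<Omega> \<subseteq> kernel_form.finite_norm (leb_on \<Omega>) (jump_kernel R)"
proof -
  interpret W: kernel_form "leb_on \<Omega>" "jump_kernel R" by (rule kernel_form_jump)
  note T = function_subspace_test_functions test_functions_finite_norm[OF R(2)]
  show "W_space R e \<Omega> \<subseteq> W.finite_norm"
    by (auto simp: W_space_def L2_def W.finite_norm_def W_norm_sq_eq)
  show "W.form_closure (test_functions \<Omega>) \<subseteq> W_space R e \<Omega>"
  proof
    fix u assume u: "u \<in> W.form_closure (test_functions \<Omega>)"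
    then have fin: "u \<in> W.finite_norm" using W.form_closure_subset_finite_norm[OF T] by auto
    note fin' = W.finite_normD[OF fin]
    have "\<exists>\<phi>\<in>smooth_closure \<Omega>. W.norm_sq (\<lambda>x. u x - \<phi> x) < ennreal (\<epsilon>\<^sup>2)" if \<epsilon>: "0 < \<epsilon>" for \<epsilon> :: real
    proof -
      \<comment> \<open>Halving turns the non-strict bound of \<open>form_closure\<close> into the
        strict one of \<open>W_space\<close>.\<close>
      have "0 < \<epsilon>\<^sup>2 / 2" using \<epsilon> by simp
      then obtain \<phi> where \<phi>: "\<phi> \<in> test_functions \<Omega>" "W.norm_sq (\<lambda>x. u x - \<phi> x) \<le> ennreal (\<epsilon>\<^sup>2 / 2)"
        using W.form_closure_approx[OF u] by blast
      note \<phi>(2)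
      also have "ennreal (\<epsilon>\<^sup>2 / 2) < ennreal (\<epsilon>\<^sup>2)" using \<epsilon> by (intro ennreal_lessI) auto
      finally show ?thesis using \<phi>(1) test_functions_subset_smooth_closure[of \<Omega>] by blast
    qed
    moreover have "integrable (leb_on \<Omega>) (\<lambda>x. (norm (u x))\<^sup>2)"
      using fin' by (intro integrableI_nonneg) auto
    ultimately show "u \<in> W_space R e \<Omega>"
      using fin' fin by (auto simp: W_space_def L2_def W_norm_sq_eq W.finite_norm_def)
  qed
qed

text \<open>All constants are named in the hypotheses and \<open>C\<close> is an explicit expression
  in them that does not contain \<open>e\<close>; this is what allows \<open>C\<close> to be chosen
  before the localization functions and \<delta>. The factor \<open>2/\<rho>0\<close> comes from
  keeping one half of the symmetrized kernel.\<close>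

lemma well_posed:
  assumes R: "0 < R" "R < 1" and r: "0 < r" "r \<le> R" and n: "(3/5) ^ n \<le> r"
    and M: "0 < M" "6 * K * M * r \<le> 1" "\<And>x. x \<in> \<Omega> \<Longrightarrow> norm x \<le> M"
    and m: "0 < m" "(\<integral>\<^sup>+z. ennreal ((norm z)\<^sup>2) * indicator (cball (0::'a) r) z \<partial>lborel) = ennreal m"
    and \<rho>: "continuous_on {0..} \<rho>" "\<And>s. 0 \<le> s \<Longrightarrow> 0 \<le> \<rho> s" "\<And>s. 0 \<le> s \<Longrightarrow> \<rho> s \<le> S" "\<And>s. 1 < s \<Longrightarrow> \<rho> s = 0" "0 \<le> S"
    and low: "0 < \<rho>0" "\<And>s. 0 \<le> s \<Longrightarrow> s \<le> r \<Longrightarrow> \<rho>0 \<le> \<rho> s"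
    and C: "C = (4 * (8 * (2 * M + 16 * M\<^sup>2 + 1) / m) + shrink_constant TYPE('a) ^ n) * (2 / \<rho>0)"
  shows "\<exists>H. H \<subseteq> W_space R e \<Omega> \<and> function_subspace H \<and>
        closedin (weak_topology (W_norm R e \<Omega>) (W_space R e \<Omega>)) H \<and>
        H10 \<Omega> \<subseteq> H \<and> H \<subseteq> L2 \<Omega> \<and>
        (\<forall>f\<in>dual_space (W_norm R e \<Omega>) H.
          \<exists>u\<in>H.
            (\<forall>v\<in>H. nonlocal_form \<rho> e \<Omega> u v = f v) \<and>
            (\<forall>w\<in>H. (\<forall>v\<in>H. nonlocal_form \<rho> e \<Omega> w v = f v) \<longrightarrow>
              (AE x in leb_on \<Omega>. w x = u x)) \<and>
            W_norm R e \<Omega> u \<le> C * dual_norm (W_norm R e \<Omega>) H f)"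
proof -
  let ?M = "leb_on \<Omega>" and ?T = "test_functions \<Omega>"
  let ?b = "scaled_kernel \<rho> e 2" and ?P = "8 * (2 * M + 16 * M\<^sup>2 + 1) / m"
  have R1: "R \<le> 1" and r1: "r \<le> 1" using R r by auto
  note T = function_subspace_test_functions[of \<Omega>] test_functions_finite_norm[OF R1]
  note bounds = scaled_kernel_bounds[OF \<rho>(2-5) low(2)]
  have B_form: "kernel_form ?M ?b"
    by (rule kernel_form_scaled[OF \<rho>(1) bounds(1)])
  interpret W: kernel_form ?M "jump_kernel R" by (rule kernel_form_jump)
  interpret V: kernel_form ?M "jump_kernel r" by (rule kernel_form_jump)
  interpret B: kernel_form ?M ?b by (rule B_form)
  define H where "H = W.form_closure ?T"
  have P: "0 \<le> ?P" using M m by simp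
  have shrink: "0 \<le> shrink_constant TYPE('a)" by (simp add: shrink_constant_def)
  have C0: "0 \<le> C" using P shrink low(1) unfolding C
    by (intro mult_nonneg_nonneg add_nonneg_nonneg zero_le_power) auto
  have upper: "B.energy_sq u \<le> ennreal (S * shrink_constant TYPE('a) ^ n) * W.norm_sq u" if "u \<in> H" for u
  proof -
    have u: "u \<in> borel_measurable ?M" using that by (simp add: H_def W.form_closure_def)
    have "B.energy_sq u \<le> ennreal S * kernel_form.energy_sq ?M (jump_kernel 1) u"
      by (rule energy_sq_scaled_le[OF B_form \<rho>(5) u bounds(3)])
    \<comment> \<open>The same \<open>n\<close> serves twice: here it leads from radius 1 to
      \<open>R\<close>, because \<open>r \<le> R\<close>, and in the lower bound from
      \<open>R\<close> to \<open>r\<close>.\<close>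
    also have "\<dots> \<le> ennreal S * (ennreal (shrink_constant TYPE('a) ^ n) * W.energy_sq u)"
      using R r n by (intro mult_left_mono energy_sq_jump_compare[OF u]) auto
    also have "\<dots> \<le> ennreal S * (ennreal (shrink_constant TYPE('a) ^ n) * W.norm_sq u)"
      by (intro mult_left_mono) (auto simp: W.norm_sq_def)
    finally show ?thesis using \<rho>(5) by (simp add: ennreal_mult' mult.assoc)
  qed
  have lower: "W.norm_sq u \<le> ennreal C * B.energy_sq u" if "u \<in> H" for u
  proof -
    have "(3/5) ^ n * R \<le> (3/5) ^ n * 1" using R by (intro mult_left_mono) auto
    also have "\<dots> \<le> r" using n by simp
    finally have n': "(3/5) ^ n * R \<le> r" .
    have "V.energy_sq u \<le> (\<integral>\<^sup>+p. ennreal (2 / \<rho>0) * ennreal (?b (fst p) (snd p) * (u (fst p) - u (snd p))\<^sup>2) \<partial>(?M \<Otimes>\<^sub>M ?M))"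
      using that unfolding H_def W.form_closure_def
    proof (subst V.energy_sq_pair, simp, intro nn_integral_mono)
      fix p assume "p \<in> space (?M \<Otimes>\<^sub>M ?M)"
      then have "\<rho>0 / 2 * jump_kernel r (fst p) (snd p) \<le> ?b (fst p) (snd p)"
        by (intro bounds(2)) (auto simp: space_pair_measure space_restrict_space)
      then have "jump_kernel r (fst p) (snd p) \<le> 2 / \<rho>0 * ?b (fst p) (snd p)"
        using low(1) by (simp add: field_simps)
      then have "jump_kernel r (fst p) (snd p) * (u (fst p) - u (snd p))\<^sup>2
        \<le> 2 / \<rho>0 * ?b (fst p) (snd p) * (u (fst p) - u (snd p))\<^sup>2" by (rule mult_right_mono) simp
      then have "ennreal (jump_kernel r (fst p) (snd p) * (u (fst p) - u (snd p))\<^sup>2)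
        \<le> ennreal (2 / \<rho>0 * (?b (fst p) (snd p) * (u (fst p) - u (snd p))\<^sup>2))"
        by (intro ennreal_leI) (simp only: mult.assoc)
      also have "\<dots> = ennreal (2 / \<rho>0) * ennreal (?b (fst p) (snd p) * (u (fst p) - u (snd p))\<^sup>2)"
        using low(1) by (intro ennreal_mult') simp
      finally show "ennreal (jump_kernel r (fst p) (snd p) * (u (fst p) - u (snd p))\<^sup>2)
        \<le> ennreal (2 / \<rho>0) * ennreal (?b (fst p) (snd p) * (u (fst p) - u (snd p))\<^sup>2)" .
    qed
    also have "\<dots> = ennreal (2 / \<rho>0) * B.energy_sq u"
    proof -
      have u[measurable]: "u \<in> borel_measurable ?M" using that by (simp add: H_def W.form_closure_def)
      note B.kernel_measurable[measurable]
      show ?thesis unfolding B.energy_sq_pair[OF u] by (rule nn_integral_cmult) measurable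
    qed
    finally have V: "V.energy_sq u \<le> ennreal (2 / \<rho>0) * B.energy_sq u" .
    have "W.norm_sq u \<le> ennreal (4 * ?P + shrink_constant TYPE('a) ^ n) * V.energy_sq u"
      using that[unfolded H_def] R(1) R1 r(2) n' P test_function_poincare[OF _ r1 M m]
      by (rule norm_sq_le_energy_sq)
    also have "\<dots> \<le> ennreal (4 * ?P + shrink_constant TYPE('a) ^ n) * (ennreal (2 / \<rho>0) * B.energy_sq u)"
      by (intro mult_left_mono V) simp
    also have "\<dots> = ennreal C * B.energy_sq u"
    proof -
      have "0 \<le> 4 * ?P + shrink_constant TYPE('a) ^ n"
        using P shrink by (intro add_nonneg_nonneg mult_nonneg_nonneg zero_le_power) auto
      then have "ennreal C = ennreal (4 * ?P + shrink_constant TYPE('a) ^ n) * ennreal (2 / \<rho>0)"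
        unfolding C by (rule ennreal_mult')
      then show ?thesis by (simp only: mult.assoc)
    qed
    finally show ?thesis .
  qed
  have norm_eq: "W_norm R e \<Omega> = W.form_norm" by (rule W_norm_eq)
  have form_eq: "nonlocal_form \<rho> e \<Omega> = B.energy" by (intro ext) (simp add: nonlocal_form_def B.energy_def)
  have HW: "H \<subseteq> W_space R e \<Omega>" unfolding H_def by (rule form_closure_subset_W_space(1)[OF R(1) R1])
  show ?thesis
  proof (intro exI[of _ H] conjI ballI)
    show "H \<subseteq> W_space R e \<Omega>" by (rule HW)
    show "function_subspace H" unfolding H_def by (rule W.function_subspace_form_closure[OF T])
    show "closedin (weak_topology (W_norm R e \<Omega>) (W_space R e \<Omega>)) H"
      using HW unfolding H_def norm_eq
      by (rule W.closedin_weak_topology_form_closure[OF T _ form_closure_subset_W_space(2)[OF R(1) R1]])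
    show "H10 \<Omega> \<subseteq> H" unfolding H_def by (rule H10_subset[OF R(1) R1])
    show "H \<subseteq> L2 \<Omega>" using HW by (auto simp: W_space_def)
    fix f assume "f \<in> dual_space (W_norm R e \<Omega>) H"
    then show "\<exists>u\<in>H. (\<forall>v\<in>H. nonlocal_form \<rho> e \<Omega> u v = f v) \<and>
            (\<forall>w\<in>H. (\<forall>v\<in>H. nonlocal_form \<rho> e \<Omega> w v = f v) \<longrightarrow> (AE x in leb_on \<Omega>. w x = u x)) \<and>
            W_norm R e \<Omega> u \<le> C * dual_norm (W_norm R e \<Omega>) H f"
      unfolding norm_eq form_eq H_def
      using upper lower C0 \<rho>(5) shrink
      by (intro coercive_form_solvable[OF kernel_form_jump B_form T, where C = "S * shrink_constant TYPE('a) ^ n"])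
        (auto simp: H_def)
  qed
qed

end

theorem theorem1p2:
  fixes \<Omega> :: "'a::euclidean_space set"
    and \<rho> :: "real \<Rightarrow> real"
    and \<kappa>0 \<kappa>1 \<kappa>2 \<kappa>b R :: real
  assumes "bounded_C2_domain \<Omega>"
    and "0 < \<kappa>0" "\<kappa>0 < 1" "0 < \<kappa>1" "0 < \<kappa>2" "0 < \<kappa>b"
    and "admissible_kernel \<rho>"
    and "normalized_kernel TYPE('a) \<rho>"
    and "0 < R" "R < 1"
  shows "\<exists>C::real. \<forall>\<eta>. localization_family \<Omega> \<kappa>0 \<kappa>1 \<kappa>2 \<kappa>b \<eta> \<longrightarrow>
    (\<forall>\<delta>. 0 < \<delta> \<and> \<delta> < delta0 \<kappa>1 \<kappa>b \<longrightarrow>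
      (\<exists>H. H \<subseteq> W_space R (\<eta> \<delta>) \<Omega> \<and> function_subspace H \<and>
        closedin (weak_topology (W_norm R (\<eta> \<delta>) \<Omega>) (W_space R (\<eta> \<delta>) \<Omega>)) H \<and>
        H10 \<Omega> \<subseteq> H \<and> H \<subseteq> L2 \<Omega> \<and>
        (\<forall>f\<in>dual_space (W_norm R (\<eta> \<delta>) \<Omega>) H.
          \<exists>u\<in>H.
            (\<forall>v\<in>H. nonlocal_form \<rho> (\<eta> \<delta>) \<Omega> u v = f v) \<and>
            (\<forall>w\<in>H. (\<forall>v\<in>H. nonlocal_form \<rho> (\<eta> \<delta>) \<Omega> w v = f v) \<longrightarrow>
              (AE x in leb_on \<Omega>. w x = u x)) \<and>
            W_norm R (\<eta> \<delta>) \<Omega> u \<le> C * dual_norm (W_norm R (\<eta> \<delta>) \<Omega>) H f)))"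
proof -
  obtain \<rho>0 r0 S where \<rho>0: "0 < \<rho>0" and r0: "0 < r0" and S: "0 \<le> S" and cont: "continuous_on {0..} \<rho>"
    and \<rho>: "\<And>r. 0 \<le> r \<Longrightarrow> 0 \<le> \<rho> r" "\<And>r. 0 \<le> r \<Longrightarrow> \<rho> r \<le> S" "\<And>r. 1 < r \<Longrightarrow> \<rho> r = 0"
    and low: "\<And>r. 0 \<le> r \<Longrightarrow> r \<le> r0 \<Longrightarrow> \<rho>0 \<le> \<rho> r"
    using admissible_kernel_bounds[OF assms(7)] by (metis atLeastAtMost_iff)
  have "bounded \<Omega>" using assms(1) by (simp add: bounded_C2_domain_def)
  then obtain M where M: "0 < M" "\<And>x. x \<in> \<Omega> \<Longrightarrow> norm x \<le> M" by (auto simp: bounded_pos)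
  \<comment> \<open>Three constraints: \<open>R\<close> keeps the energy at \<open>r\<close> below
    the one in the norm, \<open>r0\<close> ensures that the kernel is bounded below, and the last
    term lets the cubic error of the Poincare inequality be absorbed.\<close>
  define r where "r = min R (min r0 (1 / (6 * \<kappa>2 * M)))"
  have r: "0 < r" "r \<le> R" "r \<le> r0" "r \<le> 1 / (6 * \<kappa>2 * M)"
    using assms r0 M by (auto simp: r_def)
  have low': "\<rho>0 \<le> \<rho> s" if "0 \<le> s" "s \<le> r" for s
    using that r(3) by (intro low) auto
  have small: "6 * \<kappa>2 * M * r \<le> 1"
    using r(4) assms(5) M(1) by (simp add: field_simps)
  obtain n where n: "(3/5) ^ n < r" using real_arch_pow_inv[OF r(1), of "3/5"] by auto
  obtain m where m: "0 < m" "(\<integral>\<^sup>+z. ennreal ((norm z)\<^sup>2) * indicator (cball (0::'a) r) z \<partial>lborel) = ennreal m"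
    using ball_second_moment[OF r(1)] by blast
  \<comment> \<open>Here \<open>M\<close>, \<open>m\<close>, \<open>n\<close> and
    \<open>\<rho>0\<close> come from the domain, the dimension, the kernel, \<open>R\<close> and
    \<open>\<kappa>2\<close>; neither \<delta> nor the localization functions have been fixed
    yet.\<close>
  let ?C = "(4 * (8 * (2 * M + 16 * M\<^sup>2 + 1) / m) + shrink_constant TYPE('a) ^ n) * (2 / \<rho>0)"
  show ?thesis
  proof (rule exI[of _ ?C], intro allI impI, goal_cases)
    case (1 \<eta> \<delta>)
    interpret horizon \<Omega> "\<eta> \<delta>" "grad (\<eta> \<delta>)" \<kappa>2
      using horizon_localization[OF assms(1,4,5,6) 1(1)] 1(2) by blast
    show ?case
      by (rule well_posed[OF assms(9,10) r(1,2) less_imp_le[OF n] M(1) small M(2) m cont \<rho> S \<rho>0 low' refl])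
  qed
qed

end
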